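(* Let $n\ge3$. There exists a constant $\varepsilon>0$, depending only on $n$, such that the following holds. Let $V:\mathbb{R}^n\to\mathbb{C}$ be a potential such that either (i) $V\in\mathcal{KS}_n$ and $\limsup_{r\to0}\|\mathbf{1}_{B(z,r)}V\|_{\mathcal{KS}_n}\le\varepsilon$ for all $z\in\mathbb{R}^n$, or (ii) $V\in\mathcal{K}_n$. Then for every $a\in\mathbb{R}^n$ there exists $\rho>0$ (depending only on $n$, $V$ and $a$) such that: if $K\subset B(a,\rho)$ is compact and $u\in W^{2,2}(\mathbb{R}^n)$ is a solution of $|\Delta u(x)|\le|V(x)u(x)|$ for a.e. $x\in\mathbb{R}^n$ which vanishes in the complement of $K$, then $u$ vanishes identically (i.e. $u=0$ a.e. in $\mathbb{R}^n$).
   Context: $W^{m,p}(\mathbb{R}^n)$ is the Sobolev space of (complex-valued) functions whose derivatives up to order $m$ belong to $L^p(\mathbb{R}^n)$. $B(x,r)$ is the open ball of radius $r$ centered at $x$, and $\mathbf{1}_A$ is the characteristic function of $A$. For $n\ge3$ and $V$ locally integrable on $\mathbb{R}^n$, the Kerman-Sawyer norm is $$\|V\|_{\mathcal{KS}_n}=\sup_{Q}\Big(\int_Q|V(x)|\,dx\Big)^{-1}\int_Q\int_Q\frac{|V(x)V(y)|}{|x-y|^{n-2}}\,dx\,dy,$$ where the supremum is over all dyadic cubes $Q$ in $\mathbb{R}^n$ (cubes with $\int_Q|V|=0$ contribute $0$). The Kerman-Sawyer class $\mathcal{KS}_n$ is the set of $V$ with $\|V\|_{\mathcal{KS}_n}<\infty$.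 The Kato class $\mathcal{K}_n$ consists of all $V\in L^1_{\mathrm{loc}}(\mathbb{R}^n)$ with $$\lim_{r\to0}\ \sup_{x\in\mathbb{R}^n}\int_{|x-y|<r}\frac{|V(y)|}{|x-y|^{n-2}}\,dy=0.$$ *)

theory Defs
  imports "HOL-Analysis.Analysis"
begin

text \<open>
  Functions on \<open>real ^ 'n\<close> are pointwise representatives; measurability and integrability refer to
  the (complete) Lebesgue measure.
\<close>

definition locally_integrable :: "(real ^ 'n \<Rightarrow> complex) \<Rightarrow> bool" where
  "locally_integrable f \<longleftrightarrow> (\<forall>K. compact K \<longrightarrow> f absolutely_integrable_on K)"

definition partial_deriv :: "'n \<Rightarrow> (real ^ 'n \<Rightarrow> real) \<Rightarrow> real ^ 'n \<Rightarrow> real" where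
  "partial_deriv i f x = frechet_derivative f (at x) (axis i 1)"

text \<open>
  A list \<open>[i\<^sub>1, \<dots>, i\<^sub>k]\<close> of coordinate indices plays the role of a multi-index of order \<open>k\<close>: it stands
  for the mixed partial derivative in these coordinates.
\<close>

primrec iterated_partial :: "'n list \<Rightarrow> (real ^ 'n \<Rightarrow> real) \<Rightarrow> real ^ 'n \<Rightarrow> real" where
  "iterated_partial [] f = f"
| "iterated_partial (i # js) f = partial_deriv i (iterated_partial js f)"

text \<open>
  (Frechet) differentiability of all iterated partial derivatives makes all of them continuous, so
  this is membership in \<open>C\<^sup>\<infinity>\<close> with compact support.
\<close>

definition test_function :: "(real ^ 'n \<Rightarrow> real) \<Rightarrow> bool" where
  "test_function \<phi> \<longleftrightarrow>
     (\<forall>js x. iterated_partial js \<phi> differentiable (at x)) \<and> compact (closure {x. \<phi> x \<noteq> 0})"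

definition has_weak_partial ::
    "'n list \<Rightarrow> (real ^ 'n \<Rightarrow> complex) \<Rightarrow> (real ^ 'n \<Rightarrow> complex) \<Rightarrow> bool" where
  "has_weak_partial js u g \<longleftrightarrow> locally_integrable u \<and> locally_integrable g \<and>
     (\<forall>\<phi>. test_function \<phi> \<longrightarrow>
        (\<integral>x. iterated_partial js \<phi> x *\<^sub>R u x \<partial>lebesgue)
          = (-1) ^ length js * (\<integral>x. \<phi> x *\<^sub>R g x \<partial>lebesgue))"

definition Lp_space :: "real \<Rightarrow> (real ^ 'n \<Rightarrow> complex) set" where
  "Lp_space p =
     {f \<in> borel_measurable lebesgue. integrable lebesgue (\<lambda>x. norm (f x) powr p)}"

text \<open>For \<open>js = []\<close> the condition says that \<open>u\<close> itself belongs to \<open>L\<^sup>p\<close>.\<close>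

definition sobolev_space :: "nat \<Rightarrow> real \<Rightarrow> (real ^ 'n \<Rightarrow> complex) set" where
  "sobolev_space m p =
     {u. \<forall>js. length js \<le> m \<longrightarrow> (\<exists>g \<in> Lp_space p. has_weak_partial js u g)}"

definition has_weak_laplacian ::
    "(real ^ 'n \<Rightarrow> complex) \<Rightarrow> (real ^ 'n \<Rightarrow> complex) \<Rightarrow> bool" where
  "has_weak_laplacian u L \<longleftrightarrow>
     (\<exists>g. (\<forall>i. has_weak_partial [i, i] u (g i)) \<and> L = (\<lambda>x. \<Sum>i\<in>UNIV. g i x))"

definition dyadic_cubes :: "(real ^ 'n) set set" where
  "dyadic_cubes =
     {Q. \<exists>(k::int) (m::'n \<Rightarrow> int).
        Q = {x. \<forall>i. 2 powi k * of_int (m i) \<le> x $ i \<and> x $ i < 2 powi k * (of_int (m i) + 1)}}"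

text \<open>
  In the integrals below the integrand at \<open>x = y\<close> is \<open>0\<close> because of division by zero; the diagonal
  does not contribute to them.
\<close>

definition KS_norm :: "(real ^ 'n \<Rightarrow> complex) \<Rightarrow> ennreal" where
  "KS_norm V =
     (SUP Q \<in> dyadic_cubes.
        let I = (\<integral>\<^sup>+x\<in>Q. ennreal (norm (V x)) \<partial>lebesgue);
            J = (\<integral>\<^sup>+x\<in>Q. (\<integral>\<^sup>+y\<in>Q.
                   ennreal (norm (V x * V y) / norm (x - y) ^ (CARD('n) - 2)) \<partial>lebesgue) \<partial>lebesgue)
        in if I = 0 then 0 else inverse I * J)"

definition KS_class :: "(real ^ 'n \<Rightarrow> complex) set" where
  "KS_class = {V. locally_integrable V \<and> KS_norm V < \<infinity>}"

definition Kato_class :: "(real ^ 'n \<Rightarrow> complex) set" where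
  "Kato_class = {V. locally_integrable V \<and>
     ((\<lambda>r. SUP x. \<integral>\<^sup>+y\<in>{y. norm (x - y) < r}.
              ennreal (norm (V y) / norm (x - y) ^ (CARD('n) - 2)) \<partial>lebesgue)
        \<longlongrightarrow> 0) (at_right (0::real))}"

end

theory Submission
  imports Defs
begin

text \<open>
  Put \<open>f = |\<Delta>u|\<close>. Testing the weak equation with a cut-off of the regularised Newton kernel
  \<open>(|y - x|\<^sup>2 + e\<^sup>2) powr (-(n - 2)/2)\<close>, whose Laplacian is a negative multiple of an approximate identity,
  gives \<open>m |u| \<le> I f\<close> almost everywhere, where \<open>I f\<close> is the integral of \<open>f(y) / |x - y|^(n-2)\<close> in \<open>y\<close> and
  \<open>m > 0\<close> depends only on \<open>n\<close>. Hence \<open>m f \<le> |V| I f\<close>.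

  If \<open>V\<close> is in the Kato class, integrate this and use Tonelli: \<open>m \<integral>f\<close> is at most \<open>\<integral>f\<close> times the supremum of
  the potential of \<open>|V|\<close> on a small ball, so \<open>\<integral>f = 0\<close>.

  In the Kerman-Sawyer case write \<open>f = |V| h\<close> and let \<open>E = \<integral> f I f\<close>, which is finite since \<open>f\<close> is in
  \<open>L\<^sup>2\<close> with compact support. Then \<open>m \<integral> h\<^sup>2 |V| = m \<integral> h f \<le> E\<close>, because \<open>h \<le> |u|\<close>. Conversely, \<open>E\<close> is
  controlled by the sum over dyadic cubes \<open>Q\<close> of \<open>side(Q)^(2-n) (\<integral>\<^sub>Q h |V|)\<^sup>2\<close>, and the dyadic Carleson
  embedding theorem, whose packing condition is exactly the finiteness of the Kerman-Sawyer norm, bounds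
  this sum by a constant times the norm times \<open>\<integral> h\<^sup>2 |V|\<close>. If the norm is small, \<open>E = 0\<close>.
\<close>

subsection \<open>Test functions\<close>

text \<open>The Newton kernel is neither smooth nor compactly supported, so it cannot itself be a
  test function. The regularisation repairs smoothness, and the cut-off costs nothing because
  \<open>u\<close> and its Laplacian live on \<open>K\<close>. The regularised kernel stays below
  the true one, so the estimate is uniform in \<open>e\<close>; \<open>m\<close> is the mass of the
  bump, and the factor n(n - 2) \<ge> 1 is discarded.

  The quotient h = f / |V| replaces |u| because the integral of |V| |u|^2 is not given to be finite,
  whereas that of h^2 |V| is at most E / m; without this finiteness nothing could be absorbed.

  The other obstacle is that the Kerman-Sawyer norm tests one dyadic cube at a time, while close
  points may be separated by a dyadic hyperplane at every scale. Pairs are therefore sorted by the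
  scale of |x - y|, at which they lie in equal or touching cells, and the interaction of touching
  cells is split into squares. Supports of diameter below 1 leave only cubes of side at most
  1.\<close>

lemma partial_deriv_eqI:
  "(f has_derivative f') (at x) \<Longrightarrow> partial_deriv i f x = f' (axis i 1)"
  unfolding partial_deriv_def using frechet_derivative_at by metis

text \<open>\<open>frechet_derivative\<close> is a choice among candidate derivatives, and the two
  functions have the same candidates at \<open>x\<close>. The equality therefore holds even where
  neither function is differentiable.\<close>

lemma partial_deriv_cong_open:
  assumes "open U" "x \<in> U" "\<And>y. y \<in> U \<Longrightarrow> f y = g y"
  shows "partial_deriv i f x = partial_deriv i g x"
proof -
  have "(f has_derivative D) (at x) \<longleftrightarrow> (g has_derivative D) (at x)" for D
    using has_derivative_transform_within_open[of f D x UNIV U g]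
      has_derivative_transform_within_open[of g D x UNIV U f] assms by auto
  then show ?thesis
    unfolding partial_deriv_def frechet_derivative_def by simp
qed

lemma iterated_partial_cong_open:
  assumes "open U" "\<And>y. y \<in> U \<Longrightarrow> f y = g y" "x \<in> U"
  shows "iterated_partial js f x = iterated_partial js g x"
  using assms(3)
  by (induction js arbitrary: x) (auto intro: assms partial_deriv_cong_open[OF assms(1)])

text \<open>
  A class of smooth functions generated so that closure under partial derivatives is an induction. In
  the last rule \<open>G k\<close> is the \<open>k\<close>-th derivative of \<open>G 0\<close>, needed only on the range of \<open>f\<close>; this admits
  real powers of positive functions.
\<close>

inductive smooth_fun :: "(real ^ 'n \<Rightarrow> real) \<Rightarrow> bool" where
  const: "smooth_fun (\<lambda>x. c)"
| coord: "smooth_fun (\<lambda>x. x $ i)"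
| add: "smooth_fun f \<Longrightarrow> smooth_fun g \<Longrightarrow> smooth_fun (\<lambda>x. f x + g x)"
| mult: "smooth_fun f \<Longrightarrow> smooth_fun g \<Longrightarrow> smooth_fun (\<lambda>x. f x * g x)"
| comp: "smooth_fun f \<Longrightarrow> (\<And>k x. (G k has_real_derivative G (Suc k) (f x)) (at (f x)))
           \<Longrightarrow> smooth_fun (\<lambda>x. G k (f x))"

lemma smooth_fun_has_derivative:
  assumes "smooth_fun f"
  shows "\<exists>f'. (\<forall>x. (f has_derivative f' x) (at x)) \<and> (\<forall>i. smooth_fun (\<lambda>x. f' x (axis i 1)))"
  using assms
proof induction
  case (const c)
  show ?case
    by (rule exI[of _ "\<lambda>x h. 0"]) (auto intro: smooth_fun.const)
next
  case (coord j)
  show ?case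
    by (rule exI[of _ "\<lambda>x h. h $ j"])
      (auto intro: smooth_fun.const bounded_linear_imp_has_derivative bounded_linear_vec_nth)
next
  case (add f g)
  then obtain f' g' where "\<And>x. (f has_derivative f' x) (at x)" "\<And>i. smooth_fun (\<lambda>x. f' x (axis i 1))"
    "\<And>x. (g has_derivative g' x) (at x)" "\<And>i. smooth_fun (\<lambda>x. g' x (axis i 1))" by blast
  then show ?case
    by (intro exI[of _ "\<lambda>x h. f' x h + g' x h"]) (auto intro: smooth_fun.add has_derivative_add)
next
  case (mult f g)
  then obtain f' g' where "\<And>x. (f has_derivative f' x) (at x)" "\<And>i. smooth_fun (\<lambda>x. f' x (axis i 1))"
    "\<And>x. (g has_derivative g' x) (at x)" "\<And>i. smooth_fun (\<lambda>x. g' x (axis i 1))" by blast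
  with mult show ?case
    by (intro exI[of _ "\<lambda>x h. f x * g' x h + f' x h * g x"])
      (intro conjI allI smooth_fun.add smooth_fun.mult has_derivative_mult, auto)
next
  case (comp f G k)
  then obtain f' where f': "\<And>x. (f has_derivative f' x) (at x)" "\<And>i. smooth_fun (\<lambda>x. f' x (axis i 1))"
    by blast
  have "((\<lambda>x. G k (f x)) has_derivative (\<lambda>h. G (Suc k) (f x) * f' x h)) (at x)" for x
    using has_derivative_compose[OF f'(1) comp(2)[of k x, unfolded has_field_derivative_def]] by simp
  \<comment> \<open>The rule \<open>comp\<close> concludes for every index \<open>k\<close>, not
    only for 0, precisely so that it applies again to the derivative.\<close>
  moreover have "smooth_fun (\<lambda>x. G (Suc k) (f x))"
    by (rule smooth_fun.comp) (use comp in auto)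
  ultimately show ?case using f'(2)
    by (intro exI[of _ "\<lambda>x h. G (Suc k) (f x) * f' x h"]) (intro conjI allI smooth_fun.mult, auto)
qed

lemma smooth_fun_partial_deriv:
  assumes "smooth_fun f"
  shows "smooth_fun (partial_deriv i f)"
proof -
  from smooth_fun_has_derivative[OF assms] obtain f' where
    f': "\<And>x. (f has_derivative f' x) (at x)" "\<And>i. smooth_fun (\<lambda>x. f' x (axis i 1))" by blast
  then have "partial_deriv i f = (\<lambda>x. f' x (axis i 1))"
    by (auto intro: partial_deriv_eqI)
  with f' show ?thesis by simp
qed

lemma smooth_fun_iterated_partial: "smooth_fun f \<Longrightarrow> smooth_fun (iterated_partial js f)"
  by (induction js) (simp_all add: smooth_fun_partial_deriv)

lemma smooth_fun_differentiable: "smooth_fun f \<Longrightarrow> f differentiable (at x)"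
  using smooth_fun_has_derivative unfolding differentiable_def by blast

lemma smooth_fun_continuous_on: "smooth_fun f \<Longrightarrow> continuous_on A f"
  by (meson continuous_at_imp_continuous_on differentiable_imp_continuous_within smooth_fun_differentiable)

lemma test_functionI:
  assumes "smooth_fun \<phi>" "\<And>x. x \<notin> ball a R \<Longrightarrow> \<phi> x = 0"
  shows "test_function \<phi>"
proof -
  have "{x. \<phi> x \<noteq> 0} \<subseteq> ball a R" using assms(2) by blast
  then have "bounded {x. \<phi> x \<noteq> 0}" by (rule bounded_subset[OF bounded_ball])
  then show ?thesis
    unfolding test_function_def
    using assms(1) by (auto intro: smooth_fun_differentiable smooth_fun_iterated_partial)
qed

lemma smooth_fun_diff: "smooth_fun f \<Longrightarrow> smooth_fun g \<Longrightarrow> smooth_fun (\<lambda>x. f x - g x)"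
  using smooth_fun.add[OF _ smooth_fun.mult[OF smooth_fun.const[of "-1"]], of f g] by simp

lemma smooth_fun_sum: "(\<And>i. i \<in> I \<Longrightarrow> smooth_fun (f i)) \<Longrightarrow> smooth_fun (\<lambda>x. \<Sum>i\<in>I. f i x)"
  by (induction I rule: infinite_finite_induct) (auto intro: smooth_fun.const smooth_fun.add)

lemma smooth_fun_norm_power2: "smooth_fun (\<lambda>x. (norm (x - a))\<^sup>2)"
  unfolding power2_norm_eq_inner inner_vec_def
  by (auto intro!: smooth_fun_sum smooth_fun.mult smooth_fun_diff smooth_fun.coord smooth_fun.const)

lemma smooth_fun_powr:
  assumes "smooth_fun f" "\<And>x. f x > 0"
  shows "smooth_fun (\<lambda>x. f x powr s)"
proof -
  \<comment> \<open>The k-th derivative of \<open>t powr s\<close> for positive \<open>t\<close>: a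
    falling factorial times a shifted power.\<close>
  let ?G = "\<lambda>k t. (\<Prod>i<k. s - real i) * t powr (s - real k)"
  have "smooth_fun (\<lambda>x. ?G 0 (f x))"
  proof (rule smooth_fun.comp[OF assms(1)])
    fix k x
    show "(?G k has_real_derivative ?G (Suc k) (f x)) (at (f x))"
      using assms(2)[of x]
      by (auto intro!: derivative_eq_intros simp: algebra_simps)
  qed
  then show ?thesis by simp
qed

text \<open>The functions \<open>p(1/t) exp(-1/t)\<close>, extended by \<open>0\<close>, are closed under differentiation.\<close>

definition flat_exp :: "real poly \<Rightarrow> real \<Rightarrow> real" where
  "flat_exp p t = (if t > 0 then poly p (1 / t) * exp (- (1 / t)) else 0)"

lemma poly_times_exp_uminus_tendsto_0: "((\<lambda>y. poly p y * exp (- y)) \<longlongrightarrow> (0::real)) at_top"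
proof (rule tendsto_eq_rhs)
  have eq: "(\<lambda>y. poly p y * exp (-y)) = (\<lambda>y. \<Sum>i\<le>degree p. coeff p i * (y ^ i / exp y))"
    by (simp add: fun_eq_iff poly_altdef sum_distrib_right exp_minus divide_inverse mult.assoc)
  show "((\<lambda>y. poly p y * exp (- y)) \<longlongrightarrow> (\<Sum>i\<le>degree p. coeff p i * 0)) at_top"
    unfolding eq by (intro tendsto_intros tendsto_power_div_exp_0)
qed simp

text \<open>With y = 1/t, the derivative of p(y) exp(-y) in t is y^2 (p(y) - p'(y)) exp(-y), which
  is again polynomial in y times the exponential. At 0 it remains to see that the difference
  quotient tends to 0.\<close>

lemma flat_exp_has_derivative:
  "(flat_exp p has_real_derivative flat_exp ([:0, 0, 1:] * (p - pderiv p)) t) (at t)"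
proof (cases t "0 :: real" rule: linorder_cases)
  case less
  have "((\<lambda>t. 0) has_real_derivative 0) (at t)" by simp
  then have "(flat_exp p has_real_derivative 0) (at t)"
    by (rule has_field_derivative_transform_within_open[where S="{..<0}"]) (use less in \<open>auto simp: flat_exp_def\<close>)
  with less show ?thesis by (simp add: flat_exp_def)
next
  case greater
  have "((\<lambda>t. poly p (1 / t) * exp (- (1 / t))) has_real_derivative
      (poly ([:0, 0, 1:] * (p - pderiv p)) (1 / t) * exp (- (1 / t)))) (at t)"
    using greater
    by (auto intro!: derivative_eq_intros DERIV_chain2[OF poly_DERIV] simp: field_simps power2_eq_square)
  then have "(flat_exp p has_real_derivative
      (poly ([:0, 0, 1:] * (p - pderiv p)) (1 / t) * exp (- (1 / t)))) (at t)"
    by (rule has_field_derivative_transform_within_open[where S="{0<..}"]) (use greater in \<open>auto simp: flat_exp_def\<close>)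
  with greater show ?thesis by (simp add: flat_exp_def)
next
  case equal
  \<comment> \<open>Dividing by \<open>h\<close> multiplies the polynomial in 1/h by its variable,
    hence \<open>pCons 0 p\<close>.\<close>
  have "((\<lambda>h. poly (pCons 0 p) (inverse h) * exp (- inverse h)) \<longlongrightarrow> 0) (at_right 0)"
    by (rule filterlim_compose[OF poly_times_exp_uminus_tendsto_0 filterlim_inverse_at_top_right])
  then have "((\<lambda>h. flat_exp p h / h) \<longlongrightarrow> 0) (at_right 0)"
    by (rule Lim_transform_eventually)
      (auto simp: eventually_at_filter flat_exp_def divide_inverse)
  moreover have "((\<lambda>h. flat_exp p h / h) \<longlongrightarrow> 0) (at_left 0)"
    by (rule Lim_transform_eventually[OF tendsto_const])
      (auto simp: eventually_at_filter flat_exp_def)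
  ultimately have "((\<lambda>h. flat_exp p h / h) \<longlongrightarrow> 0) (at 0)"
    by (simp add: filterlim_split_at)
  with equal show ?thesis
    by (simp add: has_field_derivative_iff flat_exp_def)
qed

lemma smooth_fun_flat_exp:
  assumes "smooth_fun f"
  shows "smooth_fun (\<lambda>x. flat_exp 1 (f x))"
proof -
  let ?G = "\<lambda>k. flat_exp (((\<lambda>p. [:0, 0, 1:] * (p - pderiv p)) ^^ k) 1)"
  have "smooth_fun (\<lambda>x. ?G 0 (f x))"
    by (rule smooth_fun.comp[OF assms]) (use flat_exp_has_derivative in simp)
  then show ?thesis by simp
qed

text \<open>The classical quotient A / (A + B), where A is positive exactly inside radius
  \<open>R\<close> and B exactly outside radius \<open>r\<close>. Since r < R the denominator never
  vanishes, and its reciprocal is a real power of a positive function.\<close>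

lemma smooth_cutoff_exists:
  fixes a :: "real ^ 'n"
  assumes "0 < r" "r < R"
  obtains \<theta> where "smooth_fun \<theta>" "\<And>x. x \<in> ball a r \<Longrightarrow> \<theta> x = 1" "\<And>x. x \<notin> ball a R \<Longrightarrow> \<theta> x = 0"
proof
  let ?q = "\<lambda>x. (norm (x - a))\<^sup>2"
  let ?A = "\<lambda>x. flat_exp 1 (R\<^sup>2 - ?q x)" and ?B = "\<lambda>x. flat_exp 1 (?q x - r\<^sup>2)"
  let ?\<theta> = "\<lambda>x. ?A x * (?A x + ?B x) powr (-1)"
  have rR: "r\<^sup>2 < R\<^sup>2" using assms by (simp add: power_strict_mono)
  have pos: "?A x + ?B x > 0" for x
    using rR by (cases "?q x < R\<^sup>2") (auto simp: flat_exp_def intro: add_pos_nonneg)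
  show "smooth_fun ?\<theta>"
    by (intro smooth_fun.mult smooth_fun_powr pos smooth_fun.add smooth_fun_flat_exp smooth_fun_diff
        smooth_fun.const smooth_fun_norm_power2)
  show "?\<theta> x = 1" if "x \<in> ball a r" for x
  proof -
    have "?q x < r\<^sup>2" using that assms by (auto simp: dist_norm norm_minus_commute intro: power_strict_mono)
    then have "?B x = 0" by (simp add: flat_exp_def)
    with pos[of x] show ?thesis by (simp add: powr_minus)
  qed
  show "?\<theta> x = 0" if "x \<notin> ball a R" for x
  proof -
    have "?q x \<ge> R\<^sup>2" using that assms by (auto simp: dist_norm norm_minus_commute intro: power_mono)
    then show ?thesis by (simp add: flat_exp_def)
  qed
qed

subsection \<open>The regularised Newton kernel\<close>

text \<open>Not the Poisson kernel of the half-space, whose exponent is (n + 1)/2. It is e^2 times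
  the power (n + 2)/(n - 2) of the bubble \<open>reg_newton\<close>, that is, the nonlinearity in
  the Yamabe equation solved by that bubble.\<close>

definition poisson_bump :: "real \<Rightarrow> real ^ 'n \<Rightarrow> real" where
  "poisson_bump e z = e\<^sup>2 * ((norm z)\<^sup>2 + e\<^sup>2) powr (- (real CARD('n) + 2) / 2)"

definition reg_newton :: "real \<Rightarrow> real ^ 'n \<Rightarrow> real" where
  "reg_newton e z = ((norm z)\<^sup>2 + e\<^sup>2) powr (- (real CARD('n) - 2) / 2)"

lemma norm_power2_has_derivative:
  fixes x y :: "real ^ 'n"
  shows "((\<lambda>y. (norm (y - x))\<^sup>2) has_derivative (\<lambda>h. 2 * ((y - x) \<bullet> h))) (at y)"
  unfolding power2_norm_eq_inner
  by (auto intro!: derivative_eq_intros simp: inner_commute)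

lemma sum_power2_plus_pos: "e > 0 \<Longrightarrow> (norm z)\<^sup>2 + e\<^sup>2 > (0 :: real)"
  by (intro add_nonneg_pos) auto

lemma partial_deriv_norm_powr:
  fixes x :: "real ^ 'n"
  assumes "e > 0"
  shows "partial_deriv i (\<lambda>y. ((norm (y - x))\<^sup>2 + e\<^sup>2) powr s) =
    (\<lambda>y. 2 * s * (y - x) $ i * ((norm (y - x))\<^sup>2 + e\<^sup>2) powr (s - 1))"
proof
  fix y :: "real ^ 'n"
  have "((\<lambda>t. t powr s) has_real_derivative s * ((norm (y - x))\<^sup>2 + e\<^sup>2) powr (s - 1))
      (at ((norm (y - x))\<^sup>2 + e\<^sup>2))"
    by (rule has_real_derivative_powr) (rule sum_power2_plus_pos[OF assms])
  then have D: "((\<lambda>t. t powr s) has_derivative (\<lambda>h. s * ((norm (y - x))\<^sup>2 + e\<^sup>2) powr (s - 1) * h))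
      (at ((norm (y - x))\<^sup>2 + e\<^sup>2))"
    by (simp add: has_field_derivative_def)
  have "((\<lambda>y. ((norm (y - x))\<^sup>2 + e\<^sup>2)) has_derivative (\<lambda>h. 2 * ((y - x) \<bullet> h))) (at y)"
    using has_derivative_add[OF norm_power2_has_derivative has_derivative_const] by simp
  from has_derivative_compose[OF this D]
  have "((\<lambda>y. ((norm (y - x))\<^sup>2 + e\<^sup>2) powr s) has_derivative
      (\<lambda>h. s * ((norm (y - x))\<^sup>2 + e\<^sup>2) powr (s - 1) * (2 * ((y - x) \<bullet> h)))) (at y)" .
  from partial_deriv_eqI[OF this] show "partial_deriv i (\<lambda>y. ((norm (y - x))\<^sup>2 + e\<^sup>2) powr s) y =
      2 * s * (y - x) $ i * ((norm (y - x))\<^sup>2 + e\<^sup>2) powr (s - 1)"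
    by (simp add: inner_axis)
qed

lemma partial_deriv_coord_mult_norm_powr:
  fixes x :: "real ^ 'n"
  assumes "e > 0"
  shows "partial_deriv i (\<lambda>y. c * (y - x) $ i * ((norm (y - x))\<^sup>2 + e\<^sup>2) powr s) =
    (\<lambda>y. c * ((norm (y - x))\<^sup>2 + e\<^sup>2) powr s
      + 2 * c * s * ((y - x) $ i)\<^sup>2 * ((norm (y - x))\<^sup>2 + e\<^sup>2) powr (s - 1))"
proof
  fix y :: "real ^ 'n"
  let ?p = "\<lambda>y. ((norm (y - x))\<^sup>2 + e\<^sup>2) powr s"
  have "smooth_fun ?p"
    by (intro smooth_fun_powr smooth_fun.add smooth_fun.const smooth_fun_norm_power2 sum_power2_plus_pos assms)
  then obtain p' where p': "(?p has_derivative p') (at y)"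
    using smooth_fun_has_derivative by blast
  have "((\<lambda>y. c * (y - x) $ i) has_derivative (\<lambda>h. c * h $ i)) (at y)"
    by (auto intro!: derivative_eq_intros bounded_linear_imp_has_derivative bounded_linear_vec_nth)
  from partial_deriv_eqI[OF has_derivative_mult[OF this p']]
  have "partial_deriv i (\<lambda>y. c * (y - x) $ i * ?p y) y = c * (y - x) $ i * p' (axis i 1) + c * ?p y"
    by simp
  also have "p' (axis i 1) = 2 * s * (y - x) $ i * ((norm (y - x))\<^sup>2 + e\<^sup>2) powr (s - 1)"
    using partial_deriv_eqI[OF p', of i] partial_deriv_norm_powr[OF assms, of i x s] by simp
  finally show "partial_deriv i (\<lambda>y. c * (y - x) $ i * ?p y) y = c * ?p y
      + 2 * c * s * ((y - x) $ i)\<^sup>2 * ((norm (y - x))\<^sup>2 + e\<^sup>2) powr (s - 1)"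
    by (simp add: algebra_simps power2_eq_square)
qed

lemma laplacian_reg_newton:
  fixes x y :: "real ^ 'n"
  assumes "e > 0"
  shows "(\<Sum>i\<in>UNIV. iterated_partial [i, i] (\<lambda>y. reg_newton e (y - x)) y)
    = - (real CARD('n) * (real CARD('n) - 2)) * poisson_bump e (y - x)"
proof -
  define s where "s = - (real CARD('n) - 2) / 2"
  define q where "q = (norm (y - x))\<^sup>2 + e\<^sup>2"
  have q: "q > 0" unfolding q_def by (rule sum_power2_plus_pos[OF assms])
  have ni: "(\<Sum>i\<in>UNIV. ((y - x) $ i)\<^sup>2) = (norm (y - x))\<^sup>2"
    unfolding power2_norm_eq_inner inner_vec_def by (simp add: power2_eq_square)
  have nq: "(norm (y - x))\<^sup>2 = q - e\<^sup>2" by (simp add: q_def)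
  have "(\<Sum>i\<in>UNIV. iterated_partial [i, i] (\<lambda>y. reg_newton e (y - x)) y) =
     (\<Sum>i\<in>UNIV. 2 * s * q powr (s - 1) + 4 * s * (s - 1) * ((y - x) $ i)\<^sup>2 * q powr (s - 2))"
    unfolding reg_newton_def s_def[symmetric]
    by (simp only: iterated_partial.simps partial_deriv_norm_powr[OF assms]
        partial_deriv_coord_mult_norm_powr[OF assms] q_def) simp
  also have "\<dots> = real CARD('n) * (2 * s * q powr (s - 1))
      + 4 * s * (s - 1) * (q - e\<^sup>2) * q powr (s - 2)"
    by (simp add: sum.distrib sum_distrib_left[symmetric] sum_distrib_right[symmetric] ni nq
        del: vector_minus_component)
  also have "q powr (s - 1) = q * q powr (s - 2)"
    using q powr_add[of q 1 "s - 2"] by simp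
  also have "real CARD('n) * (2 * s * (q * q powr (s - 2))) + 4 * s * (s - 1) * (q - e\<^sup>2) * q powr (s - 2)
      = 2 * s * (real CARD('n) + 2 * (s - 1)) * q * q powr (s - 2) - 4 * s * (s - 1) * (e\<^sup>2 * q powr (s - 2))"
    by (simp add: algebra_simps)
  \<comment> \<open>The exponent is the one that makes |z|^(2 - n) harmonic: the leading term
    cancels and only the term with \<open>e\<^sup>2\<close> survives.\<close>
  also have "real CARD('n) + 2 * (s - 1) = 0"
    by (simp add: s_def field_simps)
  also have "s - 2 = - (real CARD('n) + 2) / 2"
    by (simp add: s_def field_simps)
  finally show ?thesis
    unfolding poisson_bump_def q_def s_def by (simp add: field_simps)
qed

lemma smooth_fun_reg_newton: "e > 0 \<Longrightarrow> smooth_fun (\<lambda>y. reg_newton e (y - x))"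
  unfolding reg_newton_def
  by (intro smooth_fun_powr smooth_fun.add smooth_fun.const smooth_fun_norm_power2 sum_power2_plus_pos)

lemma smooth_fun_poisson_bump: "e > 0 \<Longrightarrow> smooth_fun (\<lambda>y. poisson_bump e (y - x))"
  unfolding poisson_bump_def
  by (intro smooth_fun.mult smooth_fun_powr smooth_fun.add smooth_fun.const smooth_fun_norm_power2 sum_power2_plus_pos)

section \<open>Testing the weak Laplacian with the cut-off kernel\<close>

lemma locally_integrable_measurable:
  fixes u :: "real ^ 'n \<Rightarrow> complex"
  assumes "locally_integrable u"
  shows "u \<in> borel_measurable lebesgue"
proof (rule borel_measurable_LIMSEQ_metric)
  fix k :: nat
  show "(\<lambda>x. indicator (cball 0 (real k)) x *\<^sub>R u x) \<in> borel_measurable lebesgue"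
    using assms compact_cball unfolding locally_integrable_def set_integrable_def
    by (blast intro: borel_measurable_integrable)
next
  fix x :: "real ^ 'n"
  obtain k where k: "norm x \<le> real k" using real_arch_simple by blast
  have "\<forall>\<^sub>F k in sequentially. u x = indicator (cball 0 (real k)) x *\<^sub>R u x"
    using eventually_ge_at_top[of k] by eventually_elim (use k in auto)
  then show "(\<lambda>k. indicator (cball 0 (real k)) x *\<^sub>R u x) \<longlonglongrightarrow> u x"
    by (rule Lim_transform_eventually[OF tendsto_const])
qed

text \<open>Either factor may carry the compact support: a cut-off in \<open>h\<close>, or the
  vanishing of \<open>u\<close> off \<open>K\<close>. Both situations occur below.\<close>

lemma continuous_mult_integrable:
  fixes h :: "real ^ 'n \<Rightarrow> real"
  assumes h: "continuous_on UNIV h" and u: "locally_integrable u" and "compact K"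
    and van: "AE x in lebesgue. x \<notin> K \<longrightarrow> h x = 0 \<or> u x = 0"
  shows "integrable lebesgue (\<lambda>x. h x *\<^sub>R u x)"
proof -
  have [measurable]: "u \<in> borel_measurable lebesgue" by (rule locally_integrable_measurable[OF u])
  have hm[measurable]: "h \<in> borel_measurable lebesgue"
    using h by (simp add: borel_measurable_continuous_onI measurable_completion)
  have uK: "integrable lebesgue (\<lambda>x. indicator K x *\<^sub>R u x)"
    using u \<open>compact K\<close> unfolding locally_integrable_def set_integrable_def by blast
  have "bounded (h ` K)"
    using h \<open>compact K\<close> by (meson compact_continuous_image compact_imp_bounded continuous_on_subset subset_UNIV)
  then obtain B where B: "\<And>x. x \<in> K \<Longrightarrow> \<bar>h x\<bar> \<le> B" unfolding bounded_iff by auto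
  show ?thesis
  proof (rule Bochner_Integration.integrable_bound)
    show "integrable lebesgue (\<lambda>x. B *\<^sub>R (indicator K x *\<^sub>R u x))"
      using uK by (rule integrable_scaleR_right)
    show "AE x in lebesgue. norm (h x *\<^sub>R u x) \<le> norm (B *\<^sub>R indicat_real K x *\<^sub>R u x)"
      using van
    proof eventually_elim
      case (elim x)
      show ?case
      proof (cases "x \<in> K")
        case True
        with B[of x] have "\<bar>h x\<bar> \<le> \<bar>B\<bar>" by linarith
        with True show ?thesis by (simp add: mult_right_mono)
      qed (use elim in auto)
    qed
  qed measurable
qed

lemma smooth_fun_mult_measurable:
  fixes u :: "real ^ 'n \<Rightarrow> complex"
  assumes "smooth_fun h" "u \<in> borel_measurable lebesgue"
  shows "(\<lambda>y. h y *\<^sub>R u y) \<in> borel_measurable lebesgue"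
proof -
  have "h \<in> borel_measurable lebesgue"
    using smooth_fun_continuous_on[OF assms(1)] by (simp add: borel_measurable_continuous_onI measurable_completion)
  then show ?thesis using assms(2) by (rule borel_measurable_scaleR)
qed

text \<open>The cut-off equals 1 on an open ball around \<open>K\<close>, so on \<open>K\<close> all
  iterated partials of the test function are those of the kernel, and off \<open>K\<close> both
  \<open>u\<close> and \<open>L\<close> vanish almost everywhere. The cut-off thus leaves no trace
  and no commutator terms arise, wherever \<open>x\<close> lies.\<close>

lemma weak_laplacian_reg_newton:
  fixes u L :: "real ^ 'n \<Rightarrow> complex"
  assumes K: "compact K" and u: "locally_integrable u" and uL: "has_weak_laplacian u L"
    and u0: "AE x in lebesgue. x \<notin> K \<longrightarrow> u x = 0" and L0: "AE x in lebesgue. x \<notin> K \<longrightarrow> L x = 0"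
    and e: "e > 0"
  shows "(\<integral>y. reg_newton e (y - x) *\<^sub>R L y \<partial>lebesgue) =
    - (real CARD('n) * (real CARD('n) - 2)) *\<^sub>R (\<integral>y. poisson_bump e (y - x) *\<^sub>R u y \<partial>lebesgue)"
proof -
  obtain g where g: "\<And>i. has_weak_partial [i, i] u (g i)" and L: "L = (\<lambda>x. \<Sum>i\<in>UNIV. g i x)"
    using uL unfolding has_weak_laplacian_def by blast
  have gl: "locally_integrable (g i)" for i
    using g unfolding has_weak_partial_def by blast
  have Lm: "L \<in> borel_measurable lebesgue"
    unfolding L using locally_integrable_measurable[OF gl] by (rule borel_measurable_sum)
  obtain r where r: "r > 0" "K \<subseteq> ball 0 r"
    using compact_imp_bounded[OF K] bounded_subset_ballD by blast
  obtain \<theta> :: "real ^ 'n \<Rightarrow> real" where \<theta>: "smooth_fun \<theta>" "\<And>x. x \<in> ball 0 r \<Longrightarrow> \<theta> x = 1" "\<And>x. x \<notin> ball 0 (r + 1) \<Longrightarrow> \<theta> x = 0"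
    by (rule smooth_cutoff_exists[of r "r + 1" 0]) (use r in auto)
  let ?N = "\<lambda>y. reg_newton e (y - x)"
  let ?\<phi> = "\<lambda>y. \<theta> y * ?N y"
  have sN: "smooth_fun ?N" by (rule smooth_fun_reg_newton[OF e])
  have s\<phi>: "smooth_fun ?\<phi>" by (intro smooth_fun.mult \<theta> sN)
  have t\<phi>: "test_function ?\<phi>" by (rule test_functionI[OF s\<phi>, of 0 "r + 1"]) (use \<theta> in auto)
  have loc: "iterated_partial js ?\<phi> y = iterated_partial js ?N y" if "y \<in> K" for js y
    by (rule iterated_partial_cong_open[of "ball 0 r"]) (use \<theta> r that in auto)
  have "(\<Sum>i\<in>UNIV. \<integral>y. iterated_partial [i, i] ?\<phi> y *\<^sub>R u y \<partial>lebesgue)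
      = (\<Sum>i\<in>UNIV. \<integral>y. ?\<phi> y *\<^sub>R g i y \<partial>lebesgue)"
    using g t\<phi> unfolding has_weak_partial_def by (intro sum.cong) auto
  also have "\<dots> = (\<integral>y. (\<Sum>i\<in>UNIV. ?\<phi> y *\<^sub>R g i y) \<partial>lebesgue)"
  proof (rule Bochner_Integration.integral_sum[symmetric])
    show "integrable lebesgue (\<lambda>y. ?\<phi> y *\<^sub>R g i y)" for i
      by (rule continuous_mult_integrable[OF smooth_fun_continuous_on[OF s\<phi>] gl, of "cball 0 (r + 1)"])
        (use \<theta>(3) in \<open>auto intro!: AE_I2\<close>)
  qed
  also have "\<dots> = (\<integral>y. ?N y *\<^sub>R L y \<partial>lebesgue)"
  proof (rule Bochner_Integration.integral_cong_AE)
    have "(\<lambda>y. ?\<phi> y *\<^sub>R L y) \<in> borel_measurable lebesgue" "(\<lambda>y. ?N y *\<^sub>R L y) \<in> borel_measurable lebesgue"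
      using smooth_fun_mult_measurable[OF s\<phi> Lm] smooth_fun_mult_measurable[OF sN Lm] .
    then show "(\<lambda>y. \<Sum>i\<in>UNIV. ?\<phi> y *\<^sub>R g i y) \<in> borel_measurable lebesgue"
      "(\<lambda>y. ?N y *\<^sub>R L y) \<in> borel_measurable lebesgue"
      by (auto simp: L scaleR_sum_right)
    show "AE y in lebesgue. (\<Sum>i\<in>UNIV. ?\<phi> y *\<^sub>R g i y) = ?N y *\<^sub>R L y"
      using L0
    proof eventually_elim
      case (elim y)
      have "(\<Sum>i\<in>UNIV. ?\<phi> y *\<^sub>R g i y) = ?\<phi> y *\<^sub>R L y"
        by (simp add: L scaleR_sum_right)
      with elim \<theta>(2)[of y] r show ?case by (cases "y \<in> K") auto
    qed
  qed
  also have "(\<Sum>i\<in>UNIV. \<integral>y. iterated_partial [i, i] ?\<phi> y *\<^sub>R u y \<partial>lebesgue)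
      = (\<Sum>i\<in>UNIV. \<integral>y. iterated_partial [i, i] ?N y *\<^sub>R u y \<partial>lebesgue)"
  proof (intro sum.cong refl Bochner_Integration.integral_cong_AE)
    have *: "(\<lambda>y. h y *\<^sub>R u y) \<in> borel_measurable lebesgue" if "smooth_fun h" for h
      by (rule smooth_fun_mult_measurable[OF that locally_integrable_measurable[OF u]])
    show "(\<lambda>y. iterated_partial [i, i] ?\<phi> y *\<^sub>R u y) \<in> borel_measurable lebesgue"
      "(\<lambda>y. iterated_partial [i, i] ?N y *\<^sub>R u y) \<in> borel_measurable lebesgue" for i
      by (rule *[OF smooth_fun_iterated_partial[OF s\<phi>]], rule *[OF smooth_fun_iterated_partial[OF sN]])
    show "AE y in lebesgue. iterated_partial [i, i] ?\<phi> y *\<^sub>R u y = iterated_partial [i, i] ?N y *\<^sub>R u y" for i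
      using u0
    proof eventually_elim
      case (elim y)
      with loc[of y "[i, i]"] show ?case by (cases "y \<in> K") (simp_all del: iterated_partial.simps)
    qed
  qed
  also have "\<dots> = (\<integral>y. (\<Sum>i\<in>UNIV. iterated_partial [i, i] ?N y *\<^sub>R u y) \<partial>lebesgue)"
    by (intro Bochner_Integration.integral_sum[symmetric] continuous_mult_integrable[OF _ u K]
        smooth_fun_continuous_on smooth_fun_iterated_partial sN) (use u0 in auto)
  also have "\<dots> = (\<integral>y. (- (real CARD('n) * (real CARD('n) - 2)) * poisson_bump e (y - x)) *\<^sub>R u y \<partial>lebesgue)"
    unfolding scaleR_sum_left[symmetric] laplacian_reg_newton[OF e] ..
  also have "\<dots> = - (real CARD('n) * (real CARD('n) - 2)) *\<^sub>R (\<integral>y. poisson_bump e (y - x) *\<^sub>R u y \<partial>lebesgue)"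
    unfolding scaleR_scaleR[symmetric]
    by (rule integral_scaleR_right)
  finally show ?thesis by simp
qed

subsection \<open>Integrability of the kernels\<close>

lemma dyadic_scale:
  fixes t :: real
  assumes "0 < t" "t < 1"
  obtains k where "(1/2) ^ Suc k \<le> t" "t < (1/2) ^ k"
proof -
  have ex: "\<exists>k. (1/2) ^ k \<le> t"
    using real_arch_pow_inv[of t "1/2"] assms by (auto intro: less_imp_le)
  define k where "k = (LEAST k. (1/2) ^ k \<le> t)"
  have 1: "(1/2) ^ k \<le> t" unfolding k_def by (rule LeastI_ex[OF ex])
  have 2: "k \<noteq> 0" using 1 assms by (metis not_less power_0)
  then obtain j where j: "k = Suc j" using not0_implies_Suc by blast
  then have "\<not> (1/2) ^ j \<le> t"
    unfolding k_def using not_less_Least[of j "\<lambda>k. (1/2) ^ k \<le> t"] by (metis lessI)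
  with 1 j that show ?thesis by auto
qed

lemma half_power_power2: "((1/2) ^ k)\<^sup>2 = (1/4 :: real) ^ k"
  unfolding power2_eq_square power_mult_distrib[symmetric] by simp

lemma pow2_half: "2 ^ k * (1/2) ^ k = (1 :: real)"
  unfolding power_mult_distrib[symmetric] by simp

lemma power2_powr:
  fixes e :: real
  assumes "e > 0"
  shows "(e\<^sup>2) powr (- (real m + 2) / 2) = inverse (e ^ (m + 2))"
proof -
  have "(e\<^sup>2) powr (- (real m + 2) / 2) = (e powr 2) powr (- (real m + 2) / 2)"
    using assms by simp
  also have "\<dots> = e powr (2 * (- (real m + 2) / 2))" by (simp only: powr_powr)
  also have "2 * (- (real m + 2) / 2) = - real (m + 2)" by simp
  finally show ?thesis using assms by (simp only: powr_minus powr_realpow)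
qed

text \<open>Each shell is enlarged to the full ball of radius \<open>r k\<close>, on which the
  constant \<open>c k\<close> is integrated. The overlaps are harmless because the resulting series
  of constants times volumes converges.\<close>

lemma nn_integral_shells_finite:
  fixes g :: "'a :: euclidean_space \<Rightarrow> real"
  assumes r: "\<And>k. r k \<ge> 0" and c: "\<And>k. c k \<ge> 0" and summ: "summable (\<lambda>k. c k * r k ^ DIM('a))"
    and g: "\<And>z. z \<in> S \<Longrightarrow> \<exists>k. norm z < r k \<and> g z \<le> c k"
  shows "(\<integral>\<^sup>+z\<in>S. ennreal (g z) \<partial>lborel) < \<infinity>"
proof -
  have [measurable]: "ball (0 :: 'a) (r k) \<in> sets borel" for k by simp
  have "(\<integral>\<^sup>+z\<in>S. ennreal (g z) \<partial>lborel)
    \<le> (\<integral>\<^sup>+(z :: 'a). (\<Sum>k. ennreal (c k) * indicator (ball 0 (r k)) z) \<partial>lborel)"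
  proof (rule nn_integral_mono)
    fix z :: 'a
    show "ennreal (g z) * indicator S z \<le> (\<Sum>k. ennreal (c k) * indicator (ball 0 (r k)) z)"
    proof (cases "z \<in> S")
      case True
      then obtain k where "norm z < r k" "g z \<le> c k" using g by blast
      then have "ennreal (g z) * indicator S z \<le> (\<Sum>k\<in>{k}. ennreal (c k) * indicator (ball 0 (r k)) z)"
        using True by (auto intro: ennreal_leI)
      also have "\<dots> \<le> (\<Sum>k. ennreal (c k) * indicator (ball 0 (r k)) z)"
        by (rule sum_le_suminf) auto
      finally show ?thesis .
    qed simp
  qed
  also have "\<dots> = (\<Sum>k. \<integral>\<^sup>+(z :: 'a). ennreal (c k) * indicator (ball 0 (r k)) z \<partial>lborel)"
    by (rule nn_integral_suminf) measurable
  also have "\<dots> = (\<Sum>k. ennreal (c k) * emeasure lborel (ball 0 (r k) :: 'a set))"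
    by (intro suminf_cong nn_integral_cmult_indicator) simp
  also have "\<dots> = (\<Sum>k. ennreal (unit_ball_vol (real DIM('a)) * (c k * r k ^ DIM('a))))"
    using r c by (intro suminf_cong) (simp add: emeasure_ball ennreal_mult[symmetric] mult_ac)
  also have "\<dots> = ennreal (\<Sum>k. unit_ball_vol (real DIM('a)) * (c k * r k ^ DIM('a)))"
    using r c summ by (intro suminf_ennreal2) (auto intro!: summable_mult)
  also have "\<dots> < \<infinity>" by simp
  finally show ?thesis .
qed

text \<open>Division by zero makes this \<open>0\<close> at the origin when \<open>CARD('n) \<ge> 3\<close>.\<close>

definition newton_kernel :: "real ^ 'n \<Rightarrow> real" where
  "newton_kernel z = 1 / norm z ^ (CARD('n) - 2)"

lemma newton_kernel_nonneg: "newton_kernel z \<ge> 0"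
  by (simp add: newton_kernel_def)

lemma newton_kernel_minus_commute: "newton_kernel (x - y) = newton_kernel (y - x)"
  by (simp add: newton_kernel_def norm_minus_commute)

lemma newton_kernel_measurable[measurable]: "newton_kernel \<in> borel_measurable borel"
  unfolding newton_kernel_def[abs_def] by measurable

text \<open>On the shell with outer radius 2^(-k) the kernel is at most 2^((k+1)(n-2)), while the
  volume is of order 2^(-kn). The product decays like 4^(-k), whatever the dimension.\<close>

lemma newton_kernel_integrable_unit_ball:
  assumes "CARD('n) \<ge> 3"
  shows "(\<integral>\<^sup>+z\<in>ball 0 1. ennreal (newton_kernel (z :: real ^ 'n)) \<partial>lborel) < \<infinity>"
proof (rule nn_integral_shells_finite)
  let ?r = "\<lambda>k::nat. (1/2::real) ^ k" and ?c = "\<lambda>k::nat. (2 ^ Suc k :: real) ^ (CARD('n) - 2)"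
  have *: "?c k * ?r k ^ CARD('n) = 2 ^ (CARD('n) - 2) * (1/4) ^ k" for k
  proof -
    obtain m where m: "CARD('n) = m + 2" using le_Suc_ex[of 2 "CARD('n)"] assms by auto
    have "(2 * a) ^ m * b ^ (m + 2) = 2 ^ m * ((a * b) ^ m * b\<^sup>2)" for a b :: real
      by (simp add: power_add power_mult_distrib power2_eq_square mult_ac)
    from this[of "2 ^ k" "(1/2) ^ k"] show ?thesis
      unfolding m half_power_power2 pow2_half by simp
  qed
  show "summable (\<lambda>k. ?c k * ?r k ^ DIM(real ^ 'n))"
    by (simp only: DIM_cart DIM_real mult_1_right *) (intro summable_mult summable_geometric, simp)
  fix z :: "real ^ 'n" assume z: "z \<in> ball 0 1"
  show "\<exists>k. norm z < ?r k \<and> newton_kernel z \<le> ?c k"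
  proof (cases "z = 0")
    case True
    then show ?thesis using assms by (intro exI[of _ 0]) (auto simp: newton_kernel_def power_0_left)
  next
    case False
    then obtain k where k: "(1/2) ^ Suc k \<le> norm z" "norm z < (1/2) ^ k"
      using dyadic_scale[of "norm z"] z by auto
    have "newton_kernel z = (1 / norm z) ^ (CARD('n) - 2)" by (simp add: newton_kernel_def power_one_over)
    also have "\<dots> \<le> ?c k"
    proof (rule power_mono)
      have "1 / norm z \<le> 1 / (1/2) ^ Suc k" using k by (intro divide_left_mono) (auto intro!: mult_pos_pos False)
      then show "1 / norm z \<le> 2 ^ Suc k" by (simp add: power_one_over)
    qed simp
    finally show ?thesis using k by blast
  qed
qed auto

lemma poisson_bump_pos: "e > 0 \<Longrightarrow> poisson_bump e z > 0"
  unfolding poisson_bump_def using sum_power2_plus_pos[of e z] by simp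

lemma poisson_bump_measurable[measurable]: "poisson_bump e \<in> borel_measurable borel"
  unfolding poisson_bump_def[abs_def] by measurable

text \<open>The bump decays like |z|^(-n-2), so the shell with outer radius 2^k contributes of order
  4^(-k). The factor 2^(n+2) in \<open>?c\<close> accounts for the inner radius being half the outer
  one; at k = 0, where there is no inner radius, the bound by 1 suffices.\<close>

lemma poisson_bump_integrable: "integrable lborel (poisson_bump 1 :: real ^ 'n \<Rightarrow> real)"
proof -
  let ?r = "\<lambda>k::nat. (2::real) ^ k" and ?c = "\<lambda>k::nat. 2 ^ (CARD('n) + 2) * ((1/2::real) ^ k) ^ (CARD('n) + 2)"
  have *: "?c k * ?r k ^ CARD('n) = 2 ^ (CARD('n) + 2) * (1/4) ^ k" for k
  proof -
    have "2 ^ (m + 2) * b ^ (m + 2) * a ^ m = 2 ^ (m + 2) * ((a * b) ^ m * b\<^sup>2)" for a b :: real and m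
      by (simp add: power_add power_mult_distrib power2_eq_square mult_ac)
    from this[of "CARD('n)" "(1/2) ^ k" "2 ^ k"] show ?thesis
      unfolding half_power_power2 pow2_half by simp
  qed
  have "(\<integral>\<^sup>+z\<in>UNIV. ennreal (poisson_bump 1 (z :: real ^ 'n)) \<partial>lborel) < \<infinity>"
  proof (rule nn_integral_shells_finite)
    show "summable (\<lambda>k. ?c k * ?r k ^ DIM(real ^ 'n))"
      by (simp only: DIM_cart DIM_real mult_1_right *) (intro summable_mult summable_geometric, simp)
    fix z :: "real ^ 'n"
    have ex: "\<exists>k. norm z < 2 ^ k" by (rule real_arch_pow) simp
    define k where "k = (LEAST k. norm z < 2 ^ k)"
    have 1: "norm z < 2 ^ k" unfolding k_def by (rule LeastI_ex[OF ex])
    let ?p = "- (real CARD('n) + 2) / 2"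
    have "poisson_bump 1 z \<le> ?c k"
    proof (cases k)
      case 0
      have "poisson_bump 1 z \<le> 1"
        unfolding poisson_bump_def using powr_mono2'[of ?p 1 "(norm z)\<^sup>2 + 1"] by simp
      also have "\<dots> \<le> ?c k" using 0 one_le_power[of "2 :: real" "CARD('n) + 2"] by (simp only: power_0 power_one mult_1_right)
      finally show ?thesis .
    next
      case (Suc j)
      then have "\<not> norm z < 2 ^ j"
        unfolding k_def using not_less_Least[of j "\<lambda>k. norm z < 2 ^ k"] by (metis lessI)
      then have "(2 ^ j)\<^sup>2 \<le> (norm z)\<^sup>2" by (intro power_mono) auto
      then have "(2 ^ j)\<^sup>2 \<le> (norm z)\<^sup>2 + 1" by linarith
      then have "poisson_bump 1 z \<le> ((2 ^ j)\<^sup>2) powr ?p"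
        unfolding poisson_bump_def by (auto intro!: powr_mono2')
      also have "\<dots> = inverse (2 ^ j) ^ (CARD('n) + 2)"
        by (subst power2_powr) (simp_all add: power_inverse)
      also have "inverse (2 ^ j) = (2 :: real) * (1/2) ^ k" by (simp add: Suc power_one_over inverse_eq_divide)
      also have "\<dots> ^ (CARD('n) + 2) = ?c k" by (rule power_mult_distrib)
      finally show ?thesis .
    qed
    with 1 show "\<exists>k. norm z < ?r k \<and> poisson_bump 1 z \<le> ?c k" by blast
  qed auto
  then show ?thesis
    by (intro integrableI_nonneg) (auto simp: less_imp_le[OF poisson_bump_pos])
qed

lemma poisson_bump_integral_pos: "(\<integral>z. poisson_bump 1 (z :: real ^ 'n) \<partial>lborel) > 0"
proof -
  have "(\<integral>z. poisson_bump 1 (z :: real ^ 'n) \<partial>lborel) \<noteq> 0"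
  proof
    assume "(\<integral>z. poisson_bump 1 (z :: real ^ 'n) \<partial>lborel) = 0"
    then have "AE z in lborel. poisson_bump 1 (z :: real ^ 'n) = 0"
      using poisson_bump_integrable
      by (subst (asm) integral_nonneg_eq_0_iff_AE) (auto simp: less_imp_le[OF poisson_bump_pos])
    then have "AE z :: real ^ 'n in lborel. False"
      by eventually_elim (metis less_irrefl poisson_bump_pos zero_less_one)
    then have "emeasure lborel (UNIV :: (real ^ 'n) set) = 0"
      by (subst (asm) AE_iff_measurable[of UNIV]) auto
    then show False by simp
  qed
  moreover have "(\<integral>z. poisson_bump 1 (z :: real ^ 'n) \<partial>lborel) \<ge> 0"
    by (simp add: less_imp_le[OF poisson_bump_pos])
  ultimately show ?thesis by simp
qed

lemma poisson_bump_scale: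
  assumes "e > 0"
  shows "e ^ CARD('n) * poisson_bump e (e *\<^sub>R z :: real ^ 'n) = poisson_bump 1 z"
proof -
  let ?p = "- (real CARD('n) + 2) / 2"
  have "(norm (e *\<^sub>R z))\<^sup>2 + e\<^sup>2 = e\<^sup>2 * ((norm z)\<^sup>2 + 1)"
    using assms by (simp add: power_mult_distrib algebra_simps)
  then have "poisson_bump e (e *\<^sub>R z) = e\<^sup>2 * ((e\<^sup>2) powr ?p * ((norm z)\<^sup>2 + 1) powr ?p)"
    unfolding poisson_bump_def by (simp only:) (simp add: powr_mult)
  also have "(e\<^sup>2) powr ?p = inverse (e ^ (CARD('n) + 2))"
    by (rule power2_powr[OF assms])
  finally show ?thesis
    using assms unfolding poisson_bump_def by (simp add: power_add field_simps power2_eq_square)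
qed

lemma nn_integral_affine:
  fixes f :: "'a :: euclidean_space \<Rightarrow> ennreal"
  assumes [measurable]: "f \<in> borel_measurable borel" and "c > 0"
  shows "(\<integral>\<^sup>+y. f y \<partial>lborel) = ennreal (c ^ DIM('a)) * (\<integral>\<^sup>+z. f (t + c *\<^sub>R z) \<partial>lborel)"
  by (subst lborel_affine[of c t]) (use assms in \<open>auto simp: nn_integral_density nn_integral_distr nn_integral_cmult\<close>)

lemma nn_integral_poisson_bump_scale:
  fixes f :: "real ^ 'n \<Rightarrow> ennreal"
  assumes [measurable]: "f \<in> borel_measurable borel" and e: "e > 0"
  shows "(\<integral>\<^sup>+y. ennreal (poisson_bump e (y - x)) * f y \<partial>lborel)
    = (\<integral>\<^sup>+z. ennreal (poisson_bump 1 z) * f (x + e *\<^sub>R z) \<partial>lborel)"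
proof -
  have "(\<integral>\<^sup>+y. ennreal (poisson_bump e (y - x)) * f y \<partial>lborel)
    = ennreal (e ^ CARD('n)) * (\<integral>\<^sup>+z. ennreal (poisson_bump e (e *\<^sub>R z :: real ^ 'n)) * f (x + e *\<^sub>R z) \<partial>lborel)"
    using nn_integral_affine[of "\<lambda>y. ennreal (poisson_bump e (y - x)) * f y" e x] e by simp
  also have "\<dots> = (\<integral>\<^sup>+z. ennreal (poisson_bump 1 z) * f (x + e *\<^sub>R z) \<partial>lborel)"
    using e less_imp_le[OF poisson_bump_pos[OF e]] by (subst nn_integral_cmult[symmetric])
      (auto simp: poisson_bump_scale[OF e, symmetric] ennreal_mult' less_imp_le[OF e] mult.assoc)
  finally show ?thesis .
qed

lemma integral_poisson_bump_scale:
  fixes f :: "real ^ 'n \<Rightarrow> complex"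
  assumes [measurable]: "f \<in> borel_measurable borel" and e: "e > 0"
  shows "(\<integral>y. poisson_bump e (y - x) *\<^sub>R f y \<partial>lborel)
    = (\<integral>z. poisson_bump 1 z *\<^sub>R f (x + e *\<^sub>R z) \<partial>lborel)"
  by (subst lborel_affine[of e x])
    (use e in \<open>auto simp: integral_density integral_distr poisson_bump_scale[OF e, symmetric]\<close>)

subsection \<open>Approximate identities\<close>

text \<open>For an indicator, Tietze extends the values 1 on a closed inner approximation and 0 off
  an open outer one. Boundedness of the approximant is kept because its bump averages are later
  passed to the limit by dominated convergence.\<close>

lemma continuous_dense_L1:
  fixes w :: "'a :: euclidean_space \<Rightarrow> complex"
  assumes "integrable lborel w" "d > 0"
  shows "\<exists>g B. continuous_on UNIV g \<and> (\<forall>x. norm (g x) \<le> B) \<and>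
           (\<integral>\<^sup>+x. ennreal (norm (w x - g x)) \<partial>lborel) \<le> ennreal d"
proof -
  define approx where "approx w \<longleftrightarrow> (\<forall>d>0. \<exists>g B. continuous_on UNIV g \<and> (\<forall>x. norm (g x) \<le> B) \<and>
    (\<integral>\<^sup>+x. ennreal (norm (w x - g x)) \<partial>lborel) \<le> ennreal d)" for w :: "'a \<Rightarrow> complex"
  have "approx w"
    using assms(1)
  proof (induction rule: integrable_induct)
    case (base A c)
    show ?case unfolding approx_def
    proof (intro allI impI)
      fix d :: real assume d: "d > 0"
      \<comment> \<open>Chosen so that 2 |c| times 2h is at most \<open>d\<close>: the functions
        differ by at most 2 on a set of measure at most 2h. The summand 1 covers c = 0.\<close>
      define h where "h = d / (4 * (norm c + 1))"
      have "norm c + 1 > 0" by (intro add_nonneg_pos) auto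
      then have h: "h > 0" using d unfolding h_def by simp
      have A: "A \<in> sets lebesgue" using base by simp
      obtain S where S: "closed S" "S \<subseteq> A" "emeasure lebesgue (A - S) < ennreal h"
        using sets_lebesgue_inner_closed[OF A h] by metis
      obtain U where U: "open U" "A \<subseteq> U" "emeasure lebesgue (U - A) < ennreal h"
        using sets_lebesgue_outer_open[OF A h] by metis
      have 1: "continuous_on (S \<union> -U) (indicat_real A)"
        unfolding indicator_def of_bool_def
        by (rule continuous_on_cases) (use S U in auto)
      have 2: "closedin (top_of_set UNIV) (S \<union> -U)"
        using S U by auto
      obtain g where g: "continuous_on UNIV g" "\<And>x. x \<in> S \<union> -U \<Longrightarrow> g x = indicat_real A x" "\<And>x. norm (g x) \<le> 1"
        by (rule Tietze [OF 1 2, of 1]) auto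
      have SU: "S \<in> sets borel" "U \<in> sets borel" "A \<in> sets borel" using S U base by auto
      have "emeasure lborel (U - S) \<le> emeasure lborel ((A - S) \<union> (U - A))"
        by (rule emeasure_mono) (use SU in auto)
      also have "\<dots> \<le> emeasure lborel (A - S) + emeasure lborel (U - A)"
        by (rule emeasure_subadditive) (use SU in auto)
      also have "\<dots> \<le> ennreal h + ennreal h"
        using S(3) U(3) SU by (intro add_mono) (auto simp: less_imp_le)
      finally have US: "emeasure lborel (U - S) \<le> ennreal (2 * h)" using h by (simp add: ennreal_plus[symmetric] del: ennreal_plus)
      have "(\<integral>\<^sup>+x. ennreal (norm (indicat_real A x *\<^sub>R c - g x *\<^sub>R c)) \<partial>lborel)
          \<le> (\<integral>\<^sup>+x. ennreal (2 * norm c) * indicator (U - S) x \<partial>lborel)"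
      proof (rule nn_integral_mono)
        fix x
        have "\<bar>indicat_real A x - g x\<bar> \<le> 2 * indicat_real (U - S) x"
        proof (cases "x \<in> S \<union> - U")
          case False
          then show ?thesis using g(3)[of x] by (auto simp: indicator_def)
        qed (use g(2) in auto)
        then have "\<bar>indicat_real A x - g x\<bar> * norm c \<le> 2 * norm c * indicat_real (U - S) x"
          using mult_right_mono[of _ _ "norm c"] by (fastforce simp: mult_ac)
        then have "ennreal (norm (indicat_real A x *\<^sub>R c - g x *\<^sub>R c)) \<le> ennreal (2 * norm c * indicat_real (U - S) x)"
          by (intro ennreal_leI) (simp add: scaleR_left_diff_distrib[symmetric])
        also have "\<dots> = ennreal (2 * norm c) * indicator (U - S) x"
          by (simp add: indicator_def)
        finally show "ennreal (norm (indicat_real A x *\<^sub>R c - g x *\<^sub>R c)) \<le> ennreal (2 * norm c) * indicator (U - S) x" .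
    qed
    also have "\<dots> = ennreal (2 * norm c) * emeasure lborel (U - S)"
      using SU by (intro nn_integral_cmult_indicator) auto
    also have "\<dots> \<le> ennreal (2 * norm c) * ennreal (2 * h)"
      by (intro mult_left_mono US) simp
    also have "\<dots> = ennreal (4 * norm c * h)" using h by (simp add: ennreal_mult[symmetric])
    also have "\<dots> \<le> ennreal d"
    proof (rule ennreal_leI)
      have "norm c * d \<le> d * (norm c + 1)" using d by (simp add: algebra_simps)
      then show "4 * norm c * h \<le> d"
        unfolding h_def using \<open>norm c + 1 > 0\<close> by (simp add: field_simps)
    qed
    finally have "(\<integral>\<^sup>+x. ennreal (norm (indicat_real A x *\<^sub>R c - g x *\<^sub>R c)) \<partial>lborel) \<le> ennreal d" .
    moreover have "continuous_on UNIV (\<lambda>x. g x *\<^sub>R c)" by (intro continuous_intros g)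
    moreover have "norm (g x *\<^sub>R c) \<le> norm c" for x
      using mult_right_mono[OF g(3)[of x], of "norm c"] by simp
    ultimately show "\<exists>g B. continuous_on UNIV g \<and> (\<forall>x. norm (g x) \<le> B) \<and>
      (\<integral>\<^sup>+x. ennreal (norm (indicat_real A x *\<^sub>R c - g x)) \<partial>lborel) \<le> ennreal d" by blast
    qed
  next
    case (add f f')
    show ?case unfolding approx_def
    proof (intro allI impI)
      fix d :: real assume d: "d > 0"
      then have d2: "d / 2 > 0" by simp
      obtain g B where g: "continuous_on UNIV g" "\<And>x. norm (g x) \<le> B"
        "(\<integral>\<^sup>+x. ennreal (norm (f x - g x)) \<partial>lborel) \<le> ennreal (d / 2)" using add.IH(1) d2 unfolding approx_def by blast
      obtain g' B' where g': "continuous_on UNIV g'" "\<And>x. norm (g' x) \<le> B'"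
        "(\<integral>\<^sup>+x. ennreal (norm (f' x - g' x)) \<partial>lborel) \<le> ennreal (d / 2)" using add.IH(2) d2 unfolding approx_def by blast
      have [measurable]: "g \<in> borel_measurable borel" "g' \<in> borel_measurable borel"
        "f \<in> borel_measurable borel" "f' \<in> borel_measurable borel"
        using g g' add.hyps by (auto intro: borel_measurable_continuous_onI dest: borel_measurable_integrable)
      have "(\<integral>\<^sup>+x. ennreal (norm (f x + f' x - (g x + g' x))) \<partial>lborel)
         \<le> (\<integral>\<^sup>+x. ennreal (norm (f x - g x)) + ennreal (norm (f' x - g' x)) \<partial>lborel)"
        by (intro nn_integral_mono) (simp add: ennreal_plus[symmetric] add_diff_add norm_triangle_ineq ennreal_leI del: ennreal_plus)
      also have "\<dots> \<le> ennreal (d / 2) + ennreal (d / 2)"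
        using g g' by (subst nn_integral_add) (auto intro: add_mono)
      also have "\<dots> = ennreal d" using d by (simp add: ennreal_plus[symmetric] del: ennreal_plus)
      finally have "(\<integral>\<^sup>+x. ennreal (norm (f x + f' x - (g x + g' x))) \<partial>lborel) \<le> ennreal d" .
      moreover have "continuous_on UNIV (\<lambda>x. g x + g' x)" by (intro continuous_intros g g')
      moreover have "norm (g x + g' x) \<le> B + B'" for x
        using g(2)[of x] g'(2)[of x] norm_triangle_ineq[of "g x" "g' x"] by linarith
      ultimately show "\<exists>g B. continuous_on UNIV g \<and> (\<forall>x. norm (g x) \<le> B) \<and>
        (\<integral>\<^sup>+x. ennreal (norm (f x + f' x - g x)) \<partial>lborel) \<le> ennreal d" by blast
    qed
  next
    case (lim f s)
    show ?case unfolding approx_def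
    proof (intro allI impI)
      fix d :: real assume d: "d > 0"
      then have d2: "d / 2 > 0" by simp
      have [measurable]: "s i \<in> borel_measurable borel" "f \<in> borel_measurable borel" for i
        using borel_measurable_integrable[OF lim.hyps(1)] borel_measurable_integrable[OF lim.hyps(4)] by simp_all
      have "(\<lambda>i. (\<integral>\<^sup>+x. norm (f x - s i x) \<partial>lborel)) \<longlonglongrightarrow> 0"
      proof (rule nn_integral_dominated_convergence_norm[where w="\<lambda>x. 2 * norm (f x)"])
        show "(\<integral>\<^sup>+x. ennreal (2 * norm (f x)) \<partial>lborel) < \<infinity>"
          using lim.hyps(4) by (simp add: integrable_iff_bounded nn_integral_cmult ennreal_mult ennreal_mult_less_top)
        show "AE x in lborel. norm (s i x) \<le> 2 * norm (f x)" for i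
          by (rule AE_I2) (rule lim.hyps(3))
        show "AE x in lborel. (\<lambda>i. s i x) \<longlonglongrightarrow> f x"
          by (rule AE_I2) (rule lim.hyps(2))
      qed measurable
      then have "\<forall>\<^sub>F i in sequentially. (\<integral>\<^sup>+x. norm (f x - s i x) \<partial>lborel) < ennreal (d / 2)"
        by (rule order_tendstoD) (use d2 in simp)
      then obtain i where i: "(\<integral>\<^sup>+x. norm (f x - s i x) \<partial>lborel) < ennreal (d / 2)"
        using eventually_happens'[OF sequentially_bot] by blast
      obtain g B where g: "continuous_on UNIV g" "\<And>x. norm (g x) \<le> B"
        "(\<integral>\<^sup>+x. ennreal (norm (s i x - g x)) \<partial>lborel) \<le> ennreal (d / 2)" using lim.IH[of i] d2 unfolding approx_def by blast
      have [measurable]: "g \<in> borel_measurable borel"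
        using g by (auto intro: borel_measurable_continuous_onI)
      have "(\<integral>\<^sup>+x. ennreal (norm (f x - g x)) \<partial>lborel)
         \<le> (\<integral>\<^sup>+x. ennreal (norm (f x - s i x)) + ennreal (norm (s i x - g x)) \<partial>lborel)"
      proof (intro nn_integral_mono)
        fix x
        have "norm (f x - g x) \<le> norm (f x - s i x) + norm (s i x - g x)"
          using norm_triangle_ineq[of "f x - s i x" "s i x - g x"] by simp
        then show "ennreal (norm (f x - g x)) \<le> ennreal (norm (f x - s i x)) + ennreal (norm (s i x - g x))"
          by (simp add: ennreal_plus[symmetric] ennreal_leI del: ennreal_plus)
    qed
    also have "\<dots> \<le> ennreal (d / 2) + ennreal (d / 2)"
      using add_mono[OF less_imp_le[OF i] g(3)] by (subst nn_integral_add) simp_all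
    also have "\<dots> = ennreal d" using d2 by (subst ennreal_plus[symmetric]) auto
    finally have "(\<integral>\<^sup>+x. ennreal (norm (f x - g x)) \<partial>lborel) \<le> ennreal d" .
    with g(1,2) show "\<exists>g B. continuous_on UNIV g \<and> (\<forall>x. norm (g x) \<le> B) \<and>
      (\<integral>\<^sup>+x. ennreal (norm (f x - g x)) \<partial>lborel) \<le> ennreal d"
      by blast
    qed
  qed
  from this[unfolded approx_def, rule_format, OF assms(2)] show ?thesis by simp
qed

section \<open>Mass and integrability of the rescaled bumps\<close>

lemma nn_integral_poisson_bump:
  fixes x :: "real ^ 'n"
  assumes "e > 0"
  shows "(\<integral>\<^sup>+y. ennreal (poisson_bump e (y - x)) \<partial>lborel) = ennreal (\<integral>z. poisson_bump 1 (z :: real ^ 'n) \<partial>lborel)"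
proof -
  have "(\<integral>\<^sup>+y. ennreal (poisson_bump e (y - x)) \<partial>lborel) = (\<integral>\<^sup>+z. ennreal (poisson_bump 1 (z :: real ^ 'n)) \<partial>lborel)"
    using nn_integral_poisson_bump_scale[of "\<lambda>_. 1" e x] assms by simp
  also have "\<dots> = ennreal (\<integral>z. poisson_bump 1 (z :: real ^ 'n) \<partial>lborel)"
    by (rule nn_integral_eq_integral[OF poisson_bump_integrable]) (simp add: less_imp_le[OF poisson_bump_pos])
  finally show ?thesis .
qed

lemma poisson_bump_commute: "poisson_bump e (x - y) = poisson_bump e (y - x)"
  by (simp add: poisson_bump_def norm_minus_commute)

lemma poisson_bump_translate_integrable:
  fixes x :: "real ^ 'n"
  assumes "e > 0"
  shows "integrable lborel (\<lambda>y. poisson_bump e (y - x))"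
proof (rule integrableI_nonneg)
  show "(\<integral>\<^sup>+y. ennreal (poisson_bump e (y - x)) \<partial>lborel) < \<infinity>"
    unfolding nn_integral_poisson_bump[OF assms] by simp
qed (use assms in \<open>auto simp: less_imp_le[OF poisson_bump_pos]\<close>)

lemma poisson_bump_le:
  fixes z :: "real ^ 'n"
  assumes "e > 0"
  shows "poisson_bump e z \<le> poisson_bump e (0 :: real ^ 'n)"
  unfolding poisson_bump_def
  using assms by (intro mult_left_mono powr_mono2') auto

text \<open>Two alternatives are provided because the function being averaged is integrable, while
  its continuous approximant is only known to be bounded.\<close>

lemma poisson_bump_mult_integrable:
  fixes f :: "real ^ 'n \<Rightarrow> complex"
  assumes e: "e > 0" and [measurable]: "f \<in> borel_measurable borel"
    and f: "integrable lborel f \<or> (\<forall>y. norm (f y) \<le> C)"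
  shows "integrable lborel (\<lambda>y. poisson_bump e (y - x) *\<^sub>R f y)"
  using f
proof
  assume f: "integrable lborel f"
  show ?thesis
  proof (rule Bochner_Integration.integrable_bound)
    show "integrable lborel (\<lambda>y. poisson_bump e (0 :: real ^ 'n) *\<^sub>R f y)"
      using f by (rule integrable_scaleR_right)
    show "AE y in lborel. norm (poisson_bump e (y - x) *\<^sub>R f y) \<le> norm (poisson_bump e (0 :: real ^ 'n) *\<^sub>R f y)"
      by (auto intro!: AE_I2 mult_right_mono poisson_bump_le[OF e] simp: abs_of_pos[OF poisson_bump_pos[OF e]])
  qed measurable
next
  assume f: "\<forall>y. norm (f y) \<le> C"
  show ?thesis
  proof (rule Bochner_Integration.integrable_bound)
    show "integrable lborel (\<lambda>y. C * poisson_bump e (y - x))"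
      using poisson_bump_translate_integrable[OF e] by (rule integrable_mult_right)
    have "C \<ge> 0" using f norm_ge_zero order_trans by blast
    then show "AE y in lborel. norm (poisson_bump e (y - x) *\<^sub>R f y) \<le> norm (C * poisson_bump e (y - x))"
      using f less_imp_le[OF poisson_bump_pos[OF e]]
      by (auto intro!: AE_I2 simp: abs_mult mult.commute[of C] mult_left_mono)
  qed measurable
qed

text \<open>
  On \<open>B\<close> the positive part of \<open>m |w| - W\<close> is at most \<open>|m w - P\<^sub>e w|\<close> for every \<open>e\<close>, where \<open>P\<^sub>e\<close> is the
  convolution with the bump of scale \<open>e\<close>. This tends to \<open>0\<close> in \<open>L\<^sup>1(B)\<close>, so neither pointwise convergence
  nor local integrability of \<open>W\<close> is needed.
\<close>

lemma approximate_identity_bound: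
  fixes w :: "real ^ 'n \<Rightarrow> complex" and W :: "real ^ 'n \<Rightarrow> ennreal"
  assumes w: "integrable lborel w" and [measurable]: "W \<in> borel_measurable borel" "B \<in> sets borel"
    and B: "emeasure lborel B < \<infinity>"
    and bound: "\<And>x e. x \<in> B \<Longrightarrow> e > 0 \<Longrightarrow> ennreal (norm (\<integral>y. poisson_bump e (y - x) *\<^sub>R w y \<partial>lborel)) \<le> W x"
  shows "AE x in lborel. x \<in> B \<longrightarrow> ennreal ((\<integral>z. poisson_bump 1 (z :: real ^ 'n) \<partial>lborel) * norm (w x)) \<le> W x"
proof -
  define m where "m = (\<integral>z. poisson_bump 1 (z :: real ^ 'n) \<partial>lborel)"
  have m: "m > 0" unfolding m_def by (rule poisson_bump_integral_pos)
  have wm[measurable]: "w \<in> borel_measurable borel" using w by (auto dest: borel_measurable_integrable)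
  define P where "P e f x = (\<integral>y. poisson_bump e (y - x) *\<^sub>R f y \<partial>lborel)" for e and f :: "real ^ 'n \<Rightarrow> complex" and x
  define D where "D x = ennreal (m * norm (w x)) - W x" for x
  have [measurable]: "D \<in> borel_measurable borel" unfolding D_def[abs_def] by measurable
  have main: "(\<integral>\<^sup>+x\<in>B. D x \<partial>lborel) \<le> ennreal \<eta>" if \<eta>: "\<eta> > 0" for \<eta>
  proof -
    \<comment> \<open>The approximation error enters twice, each time with the factor
      \<open>m\<close>, so the two contributions add up to \<eta>.\<close>
    define \<delta> where "\<delta> = \<eta> / (2 * m)"
    have \<delta>: "\<delta> > 0" using \<eta> m by (simp add: \<delta>_def)
    obtain g G where g: "continuous_on UNIV g" "\<And>x. norm (g x) \<le> G"
      "(\<integral>\<^sup>+x. ennreal (norm (w x - g x)) \<partial>lborel) \<le> ennreal \<delta>"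
      using continuous_dense_L1[OF w \<delta>] by blast
    have gm[measurable]: "g \<in> borel_measurable borel" using g by (intro borel_measurable_continuous_onI)
    have [measurable]: "P e g \<in> borel_measurable borel" for e
      unfolding P_def[abs_def] by measurable
    let ?h = "\<lambda>y. ennreal (norm (w y - g y))"
    let ?R = "\<lambda>e x. \<integral>\<^sup>+y. ennreal (poisson_bump e (y - x)) * ?h y \<partial>lborel"
    \<comment> \<open>Compare \<open>m w\<close> with its average through \<open>g\<close>: the
      error is m(w - g), plus m g minus the average of g, minus the average of w - g. The first and
      last parts are small in \<open>L\<^sup>1\<close> uniformly in \<open>e\<close>, and only the
      middle one needs the limit.\<close>
    have D_le: "D x \<le> ennreal m * ?h x + ennreal (norm (m *\<^sub>R g x - P e g x)) + ?R e x"
      if x: "x \<in> B" and e: "e > 0" for x e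
    proof -
      have Ig: "integrable lborel (\<lambda>y. poisson_bump e (y - x) *\<^sub>R g y)"
        using poisson_bump_mult_integrable[OF e gm] g by blast
      have Iw: "integrable lborel (\<lambda>y. poisson_bump e (y - x) *\<^sub>R w y)"
        using poisson_bump_mult_integrable[OF e wm] w by blast
      have Iwg: "integrable lborel (\<lambda>y. poisson_bump e (y - x) *\<^sub>R (w y - g y))"
        using Bochner_Integration.integrable_diff[OF Iw Ig] by (simp add: scaleR_diff_right)
      have eq: "P e w x - P e g x = (\<integral>y. poisson_bump e (y - x) *\<^sub>R (w y - g y) \<partial>lborel)"
        unfolding P_def scaleR_diff_right using Iw Ig by simp
      have "ennreal (norm (P e w x - P e g x)) \<le> (\<integral>\<^sup>+y. ennreal (norm (poisson_bump e (y - x) *\<^sub>R (w y - g y))) \<partial>lborel)"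
        unfolding eq by (rule integral_norm_bound_ennreal[OF Iwg])
      also have "\<dots> = ?R e x"
        by (simp add: ennreal_mult'' abs_of_pos[OF poisson_bump_pos[OF e]])
      finally have R: "ennreal (norm (P e w x - P e g x)) \<le> ?R e x" .
      have "norm (m *\<^sub>R w x) \<le> norm (P e w x) + (norm (m *\<^sub>R (w x - g x)) + norm (m *\<^sub>R g x - P e g x) + norm (P e w x - P e g x))"
      proof -
        have "m *\<^sub>R w x = P e w x + (m *\<^sub>R (w x - g x) + (m *\<^sub>R g x - P e g x) - (P e w x - P e g x))"
          by (simp add: algebra_simps)
        then have "norm (m *\<^sub>R w x) \<le> norm (P e w x) + norm (m *\<^sub>R (w x - g x) + (m *\<^sub>R g x - P e g x) - (P e w x - P e g x))"
          by (metis norm_triangle_ineq)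
        also have "\<dots> \<le> norm (P e w x) + (norm (m *\<^sub>R (w x - g x) + (m *\<^sub>R g x - P e g x)) + norm (P e w x - P e g x))"
          by (intro add_left_mono norm_triangle_ineq4)
        finally show ?thesis using norm_triangle_ineq[of "m *\<^sub>R (w x - g x)" "m *\<^sub>R g x - P e g x"] by linarith
      qed
      then have "ennreal (m * norm (w x)) \<le> ennreal (norm (P e w x) + (m * norm (w x - g x) + norm (m *\<^sub>R g x - P e g x) + norm (P e w x - P e g x)))"
        using m by (intro ennreal_leI) simp
      also have "\<dots> = ennreal (norm (P e w x)) + (ennreal m * ?h x + ennreal (norm (m *\<^sub>R g x - P e g x)) + ennreal (norm (P e w x - P e g x)))"
        using m by (simp add: ennreal_mult)
      also have "\<dots> \<le> W x + (ennreal m * ?h x + ennreal (norm (m *\<^sub>R g x - P e g x)) + ?R e x)"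
        using bound[OF x e] R unfolding P_def by (intro add_mono order_refl)
      finally show ?thesis unfolding D_def by (subst ennreal_minus_le_iff) simp
    qed
    have mass: "(\<integral>\<^sup>+x. ennreal (poisson_bump e (y - x)) \<partial>lborel) = ennreal m" if "e > 0" for e and y :: "real ^ 'n"
      using nn_integral_poisson_bump[OF that, of y] unfolding m_def by (simp add: poisson_bump_commute[of e y])
    \<comment> \<open>By Tonelli, averaging multiplies the integral of a nonnegative function by the
      mass \<open>m\<close>, whatever the scale \<open>e\<close>.\<close>
    have Rint: "(\<integral>\<^sup>+x. ?R e x \<partial>lborel) \<le> ennreal (m * \<delta>)" if e: "e > 0" for e
    proof -
      have "(\<integral>\<^sup>+x. ?R e x \<partial>lborel) = (\<integral>\<^sup>+y. (\<integral>\<^sup>+x. ennreal (poisson_bump e (y - x)) * ?h y \<partial>lborel) \<partial>lborel)"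
        by (rule lborel_pair.Fubini') measurable
      also have "\<dots> = (\<integral>\<^sup>+y. ennreal m * ?h y \<partial>lborel)"
        by (simp add: nn_integral_multc mass[OF e])
      also have "\<dots> = ennreal m * (\<integral>\<^sup>+y. ?h y \<partial>lborel)" by (rule nn_integral_cmult) measurable
      also have "\<dots> \<le> ennreal m * ennreal \<delta>" by (intro mult_left_mono g) simp
      finally show ?thesis using m \<delta> by (simp add: ennreal_mult)
    qed
    let ?e = "\<lambda>k :: nat. 1 / (real k + 1)"
    have e0: "?e k > 0" for k by simp
    have e_lim: "?e \<longlonglongrightarrow> 0" using LIMSEQ_inverse_real_of_nat by (simp add: inverse_eq_divide add.commute)
    have Pg: "P (?e k) g x = (\<integral>z. poisson_bump 1 z *\<^sub>R g (x + ?e k *\<^sub>R z) \<partial>lborel)" for k x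
      unfolding P_def by (rule integral_poisson_bump_scale[OF gm e0])
    have Plim: "(\<lambda>k. P (?e k) g x) \<longlonglongrightarrow> m *\<^sub>R g x" for x
    proof -
      have "(\<lambda>k. \<integral>z. poisson_bump 1 z *\<^sub>R g (x + ?e k *\<^sub>R z) \<partial>lborel) \<longlonglongrightarrow> (\<integral>(z :: real ^ 'n). poisson_bump 1 z *\<^sub>R g x \<partial>lborel)"
      proof (rule integral_dominated_convergence[where w="\<lambda>z. G * poisson_bump 1 z"])
        show "integrable lborel (\<lambda>z :: real ^ 'n. G * poisson_bump 1 z)"
          using poisson_bump_integrable by (rule integrable_mult_right)
        show "AE z in lborel. (\<lambda>k. poisson_bump 1 z *\<^sub>R g (x + ?e k *\<^sub>R z)) \<longlonglongrightarrow> poisson_bump 1 z *\<^sub>R g x"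
        proof (intro AE_I2 tendsto_scaleR tendsto_const)
          fix z :: "real ^ 'n"
          have "(\<lambda>k. x + ?e k *\<^sub>R z) \<longlonglongrightarrow> x + 0 *\<^sub>R z" by (intro tendsto_intros e_lim)
          then show "(\<lambda>k. g (x + ?e k *\<^sub>R z)) \<longlonglongrightarrow> g x"
            using g(1) by (intro isCont_tendsto_compose[of x g]) (auto simp: continuous_on_eq_continuous_at)
        qed
        show "AE z in lborel. norm (poisson_bump 1 z *\<^sub>R g (x + ?e k *\<^sub>R z)) \<le> G * poisson_bump 1 z" for k
          using g(2)
          by (auto intro!: AE_I2 mult_left_mono simp: mult.commute[of G] abs_of_pos[OF poisson_bump_pos] less_imp_le[OF poisson_bump_pos])
      qed measurable
      also have "(\<integral>(z :: real ^ 'n). poisson_bump 1 z *\<^sub>R g x \<partial>lborel) = m *\<^sub>R g x"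
        unfolding m_def by (intro integral_scaleR_left poisson_bump_integrable)
      finally show ?thesis unfolding Pg .
    qed
    have Pbound: "norm (P (?e k) g x) \<le> m * G" for k x
    proof -
      have "ennreal (norm (P (?e k) g x)) \<le> (\<integral>\<^sup>+y. ennreal (norm (poisson_bump (?e k) (y - x) *\<^sub>R g y)) \<partial>lborel)"
        unfolding P_def by (rule integral_norm_bound_ennreal) (use poisson_bump_mult_integrable[OF e0 gm] g in blast)
      also have "\<dots> \<le> (\<integral>\<^sup>+y. ennreal (poisson_bump (?e k) (y - x)) * ennreal G \<partial>lborel)"
        using g(2)
        by (intro nn_integral_mono) (auto simp: ennreal_mult'' abs_of_pos[OF poisson_bump_pos[OF e0]] intro!: mult_left_mono ennreal_leI)
      also have "\<dots> = ennreal m * ennreal G"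
        using nn_integral_poisson_bump[OF e0, of k x] by (subst nn_integral_multc) (auto simp: m_def)
      finally have "ennreal (norm (P (?e k) g x)) \<le> ennreal (m * G)" using m by (simp add: ennreal_mult')
      moreover have "0 \<le> m * G" using m g(2)[of 0] norm_ge_zero[of "g 0"] by (intro mult_nonneg_nonneg) linarith+
      ultimately show ?thesis by (simp add: ennreal_le_iff)
    qed
    \<comment> \<open>The averages of \<open>g\<close> converge pointwise and are bounded by
      \<open>m * G\<close>; the finite measure of \<open>B\<close> makes this constant an integrable
      majorant on \<open>B\<close>.\<close>
    have "(\<lambda>k. \<integral>\<^sup>+x. norm (indicat_real B x *\<^sub>R (m *\<^sub>R g x) - indicat_real B x *\<^sub>R P (?e k) g x) \<partial>lborel) \<longlonglongrightarrow> 0"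
    proof (rule nn_integral_dominated_convergence_norm[where w="\<lambda>x. m * G * indicat_real B x"])
      show "AE x in lborel. norm (indicat_real B x *\<^sub>R P (?e k) g x) \<le> m * G * indicat_real B x" for k
        using Pbound by (auto intro!: AE_I2 simp: indicator_def)
      have "(\<integral>\<^sup>+x. ennreal (m * G * indicat_real B x) \<partial>lborel) = (\<integral>\<^sup>+x. ennreal (m * G) * indicator B x \<partial>lborel)"
        by (intro nn_integral_cong) (auto simp: indicator_def)
      also have "\<dots> = ennreal (m * G) * emeasure lborel B" by (intro nn_integral_cmult_indicator) simp
      finally show "(\<integral>\<^sup>+x. ennreal (m * G * indicat_real B x) \<partial>lborel) < \<infinity>"
        using B by (simp add: ennreal_mult_less_top)
      show "AE x in lborel. (\<lambda>k. indicat_real B x *\<^sub>R P (?e k) g x) \<longlonglongrightarrow> indicat_real B x *\<^sub>R (m *\<^sub>R g x)"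
        by (intro AE_I2 tendsto_scaleR tendsto_const Plim)
    qed measurable
    then have lim: "(\<lambda>k. ennreal (m * \<delta>) + (\<integral>\<^sup>+x. norm (indicat_real B x *\<^sub>R (m *\<^sub>R g x) - indicat_real B x *\<^sub>R P (?e k) g x) \<partial>lborel) + ennreal (m * \<delta>))
        \<longlonglongrightarrow> ennreal (m * \<delta>) + 0 + ennreal (m * \<delta>)"
      by (intro tendsto_add tendsto_const)
    have "(\<integral>\<^sup>+x\<in>B. D x \<partial>lborel) \<le> ennreal (m * \<delta>) + 0 + ennreal (m * \<delta>)"
    proof (rule LIMSEQ_le_const[OF lim], intro exI allI impI)
      fix k
      let ?Q = "\<lambda>x. ennreal (norm (indicat_real B x *\<^sub>R (m *\<^sub>R g x) - indicat_real B x *\<^sub>R P (?e k) g x))"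
      have "(\<integral>\<^sup>+x\<in>B. D x \<partial>lborel) \<le> (\<integral>\<^sup>+x. (ennreal m * ?h x + ?Q x) + ?R (?e k) x \<partial>lborel)"
        using D_le[OF _ e0, of _ k] by (intro nn_integral_mono) (auto simp: indicator_def)
      also have "\<dots> = ennreal m * (\<integral>\<^sup>+x. ?h x \<partial>lborel) + (\<integral>\<^sup>+x. ?Q x \<partial>lborel) + (\<integral>\<^sup>+x. ?R (?e k) x \<partial>lborel)"
        by (simp add: nn_integral_add nn_integral_cmult)
      also have "\<dots> \<le> ennreal (m * \<delta>) + (\<integral>\<^sup>+x. ?Q x \<partial>lborel) + ennreal (m * \<delta>)"
      proof (intro add_mono order_refl Rint e0)
        have "ennreal m * (\<integral>\<^sup>+x. ?h x \<partial>lborel) \<le> ennreal m * ennreal \<delta>" by (intro mult_left_mono g) simp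
        then show "ennreal m * (\<integral>\<^sup>+x. ?h x \<partial>lborel) \<le> ennreal (m * \<delta>)" using m \<delta> by (simp add: ennreal_mult)
      qed
      finally show "(\<integral>\<^sup>+x\<in>B. D x \<partial>lborel) \<le> ennreal (m * \<delta>) + (\<integral>\<^sup>+x. ?Q x \<partial>lborel) + ennreal (m * \<delta>)" .
    qed
    also have "\<dots> = ennreal \<eta>"
      using m \<eta> by (simp add: ennreal_plus[symmetric] \<delta>_def del: ennreal_plus)
    finally show ?thesis .
  qed
  have "(\<integral>\<^sup>+x\<in>B. D x \<partial>lborel) \<le> 0"
    by (rule ennreal_le_epsilon) (use main in auto)
  then have "(\<integral>\<^sup>+x\<in>B. D x \<partial>lborel) = 0" by simp
  then have "AE x in lborel. D x * indicator B x = 0"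
    by (subst (asm) nn_integral_0_iff_AE) auto
  then show ?thesis
  proof eventually_elim
    case (elim x)
    then show ?case
      using diff_eq_0_iff_ennreal[of "ennreal (m * norm (w x))" "W x"]
      by (auto simp: D_def m_def indicator_def split: if_splits)
  qed
qed

subsection \<open>Pointwise bound by the Newton potential\<close>

lemma emeasure_lborel_ball_less_top: "emeasure lborel (ball (c :: 'a :: euclidean_space) r) < top"
  using emeasure_bounded_finite[OF bounded_ball, of c r] by simp

text \<open>Tonelli arguments are carried out for \<open>lborel\<close> and jointly Borel
  integrands, whereas the data are measurable only for the completed measure. Hence every function
  is first replaced by a Borel version.\<close>

lemma borel_representative:
  fixes g :: "'a :: euclidean_space \<Rightarrow> complex"
  assumes "g \<in> borel_measurable lebesgue"
  obtains g' where "g' \<in> borel_measurable borel" "AE x in lborel. g x = g' x"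
proof -
  have "(\<lambda>x. Re (g x)) \<in> borel_measurable lebesgue" "(\<lambda>x. Im (g x)) \<in> borel_measurable lebesgue"
    using assms by measurable
  from this[THEN completion_ex_borel_measurable_real]
  obtain p q where pq: "p \<in> borel_measurable lborel" "AE x in lborel. Re (g x) = p x"
    "q \<in> borel_measurable lborel" "AE x in lborel. Im (g x) = q x" by blast
  have "(\<lambda>x. Complex (p x) (q x)) \<in> borel_measurable borel"
    using pq by (simp add: Complex_eq)
  moreover have "AE x in lborel. g x = Complex (p x) (q x)"
    using pq(2,4) by eventually_elim (simp add: complex_eq_iff)
  ultimately show ?thesis by (rule that)
qed

lemma integral_lebesgue_eq_lborel:
  fixes f f' :: "'a :: euclidean_space \<Rightarrow> complex"
  assumes "f \<in> borel_measurable lebesgue" "f' \<in> borel_measurable borel" "AE x in lborel. f x = f' x"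
  shows "integral\<^sup>L lebesgue f = integral\<^sup>L lborel f'"
proof -
  have "integral\<^sup>L lebesgue f = integral\<^sup>L lebesgue f'"
    using assms by (intro Bochner_Integration.integral_cong_AE AE_completion) (auto intro: measurable_completion)
  also have "\<dots> = integral\<^sup>L lborel f'"
    using assms by (intro integral_completion) simp
  finally show ?thesis .
qed

lemma integrable_lebesgue_imp_lborel:
  fixes f f' :: "'a :: euclidean_space \<Rightarrow> complex"
  assumes "integrable lebesgue f" "f' \<in> borel_measurable borel" "AE x in lborel. f x = f' x"
  shows "integrable lborel f'"
proof -
  have "integrable lebesgue f'"
    using assms(1)
    by (rule integrable_cong_AE_imp)
      (use assms in \<open>auto intro!: measurable_completion AE_completion elim: eventually_mono\<close>)
  then show ?thesis using assms(2) by (subst (asm) integrable_completion) auto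
qed

text \<open>Adding \<open>e\<^sup>2\<close> under a negative power only decreases it. This makes the
  potential bound independent of \<open>e\<close>.\<close>

lemma reg_newton_le_newton_kernel:
  fixes z :: "real ^ 'n"
  assumes "CARD('n) \<ge> 3" "z \<noteq> 0"
  shows "reg_newton e z \<le> newton_kernel z"
proof -
  have "(norm z)\<^sup>2 powr (- (real CARD('n) - 2) / 2) = (norm z powr 2) powr (- (real CARD('n) - 2) / 2)"
    using assms by simp
  also have "\<dots> = norm z powr (2 * (- (real CARD('n) - 2) / 2))"
    by (simp only: powr_powr)
  also have "2 * (- (real CARD('n) - 2) / 2) = - (real (CARD('n) - 2))"
    using assms by (simp add: of_nat_diff)
  also have "norm z powr \<dots> = newton_kernel z"
    using assms unfolding newton_kernel_def
    by (subst powr_minus, subst powr_realpow) (simp_all add: inverse_eq_divide)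
  finally have eq: "(norm z)\<^sup>2 powr (- (real CARD('n) - 2) / 2) = newton_kernel z" .
  show ?thesis
    unfolding reg_newton_def eq[symmetric] using assms by (intro powr_mono2') auto
qed

text \<open>The tested equation bounds every bump average of \<open>u'\<close> by the same potential
  \<open>W\<close>, for all scales and all centres. The approximate identity bound converts this
  into a pointwise estimate.\<close>

lemma newton_potential_bound:
  fixes u L u' L' :: "real ^ 'n \<Rightarrow> complex"
  assumes N: "CARD('n) \<ge> 3" and K: "compact K" and u: "locally_integrable u" and uL: "has_weak_laplacian u L"
    and u0: "AE x in lebesgue. x \<notin> K \<longrightarrow> u x = 0" and L0: "AE x in lebesgue. x \<notin> K \<longrightarrow> L x = 0"
    and L: "L \<in> borel_measurable lebesgue"
    and u'[measurable]: "u' \<in> borel_measurable borel" and uu': "AE x in lborel. u x = u' x"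
    and L'[measurable]: "L' \<in> borel_measurable borel" and LL': "AE x in lborel. L x = L' x"
  shows "AE x in lborel. ennreal ((\<integral>z. poisson_bump 1 (z :: real ^ 'n) \<partial>lborel) * norm (u' x))
    \<le> (\<integral>\<^sup>+y. ennreal (newton_kernel (y - x)) * ennreal (norm (L' y)) \<partial>lborel)"
proof -
  have um: "u \<in> borel_measurable lebesgue" by (rule locally_integrable_measurable[OF u])
  obtain r where r: "K \<subseteq> ball 0 r"
    using compact_imp_bounded[OF K] bounded_subset_ballD by blast
  have "integrable lebesgue (\<lambda>x. 1 *\<^sub>R u x)"
    by (rule continuous_mult_integrable[OF _ u K]) (use u0 in auto)
  then have u'i: "integrable lborel u'"
    by (intro integrable_lebesgue_imp_lborel[OF _ u' uu']) simp
  define W where "W x = (\<integral>\<^sup>+y. ennreal (newton_kernel (y - x)) * ennreal (norm (L' y)) \<partial>lborel)" for x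
  have W[measurable]: "W \<in> borel_measurable borel"
    unfolding W_def[abs_def] by measurable
  have bound: "ennreal (norm (\<integral>y. poisson_bump e (y - x) *\<^sub>R u' y \<partial>lborel)) \<le> W x" if e: "e > 0" for x e
  proof -
    have m[measurable]: "reg_newton e \<in> borel_measurable borel"
      unfolding reg_newton_def[abs_def] by measurable
    have 1: "(\<integral>y. reg_newton e (y - x) *\<^sub>R L y \<partial>lebesgue) = (\<integral>y. reg_newton e (y - x) *\<^sub>R L' y \<partial>lborel)"
    proof (rule integral_lebesgue_eq_lborel)
      show "(\<lambda>y. reg_newton e (y - x) *\<^sub>R L y) \<in> borel_measurable lebesgue"
        by (rule smooth_fun_mult_measurable[OF smooth_fun_reg_newton[OF e] L])
      show "AE y in lborel. reg_newton e (y - x) *\<^sub>R L y = reg_newton e (y - x) *\<^sub>R L' y"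
        using LL' by eventually_elim simp
    qed measurable
    have 2: "(\<integral>y. poisson_bump e (y - x) *\<^sub>R u y \<partial>lebesgue) = (\<integral>y. poisson_bump e (y - x) *\<^sub>R u' y \<partial>lborel)"
    proof (rule integral_lebesgue_eq_lborel)
      show "(\<lambda>y. poisson_bump e (y - x) *\<^sub>R u y) \<in> borel_measurable lebesgue"
        by (rule smooth_fun_mult_measurable[OF smooth_fun_poisson_bump[OF e] um])
      show "AE y in lborel. poisson_bump e (y - x) *\<^sub>R u y = poisson_bump e (y - x) *\<^sub>R u' y"
        using uu' by eventually_elim simp
    qed measurable
    let ?P = "\<integral>y. poisson_bump e (y - x) *\<^sub>R u' y \<partial>lborel" and ?I = "\<integral>y. reg_newton e (y - x) *\<^sub>R L' y \<partial>lborel"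
    have eq: "?I = - (real CARD('n) * (real CARD('n) - 2)) *\<^sub>R ?P"
      using weak_laplacian_reg_newton[OF K u uL u0 L0 e, of x] unfolding 1 2 .
    have "1 * 1 \<le> real CARD('n) * (real CARD('n) - 2)"
      using N by (intro mult_mono) auto
    then have "1 * norm ?P \<le> \<bar>real CARD('n) * (real CARD('n) - 2)\<bar> * norm ?P"
      by (intro mult_right_mono) auto
    then have "norm ?P \<le> norm ?I" unfolding eq by simp
    then have "ennreal (norm ?P) \<le> ennreal (norm ?I)" by (rule ennreal_leI)
    \<comment> \<open>If the integrand is not Bochner integrable its integral is 0 by convention,
      and the bound is trivial.\<close>
    also have "\<dots> \<le> (\<integral>\<^sup>+y. ennreal (norm (reg_newton e (y - x) *\<^sub>R L' y)) \<partial>lborel)"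
    proof (cases "integrable lborel (\<lambda>y. reg_newton e (y - x) *\<^sub>R L' y)")
      case True
      then show ?thesis by (rule integral_norm_bound_ennreal)
    qed (simp add: not_integrable_integral_eq)
    also have "\<dots> \<le> W x"
      unfolding W_def
    proof (rule nn_integral_mono_AE)
      show "AE y in lborel. ennreal (norm (reg_newton e (y - x) *\<^sub>R L' y)) \<le> ennreal (newton_kernel (y - x)) * ennreal (norm (L' y))"
        using AE_lborel_singleton[of x]
      proof eventually_elim
        case (elim y)
        have "0 \<le> reg_newton e (y - x)" by (simp add: reg_newton_def)
        moreover have "reg_newton e (y - x) \<le> newton_kernel (y - x)"
          by (rule reg_newton_le_newton_kernel[OF N]) (use elim in simp)
        ultimately have "norm (reg_newton e (y - x) *\<^sub>R L' y) \<le> newton_kernel (y - x) * norm (L' y)"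
          by (simp add: mult_right_mono)
        then show ?case
          by (simp add: ennreal_mult''[symmetric] ennreal_leI)
      qed
    qed
    finally show ?thesis .
  qed
  \<comment> \<open>A ball containing \<open>K\<close> supplies the finite measure required; off
    \<open>K\<close> the function vanishes and there is nothing to show.\<close>
  have "AE x in lborel. x \<in> ball 0 r \<longrightarrow> ennreal ((\<integral>z. poisson_bump 1 (z :: real ^ 'n) \<partial>lborel) * norm (u' x)) \<le> W x"
    by (rule approximate_identity_bound[OF u'i W]) (use bound in \<open>auto simp: emeasure_lborel_ball_less_top\<close>)
  moreover have "AE x in lborel. x \<notin> K \<longrightarrow> u x = 0"
    using u0 by (simp add: AE_completion_iff)
  ultimately show ?thesis
    using uu'
  proof eventually_elim
    case (elim x)
    show ?case
    proof (cases "x \<in> K")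
      case True
      then show ?thesis using elim r by (auto simp: W_def)
    next
      case False
      then have "u' x = 0" using elim by simp
      then show ?thesis by simp
    qed
  qed
qed

text \<open>Times a cut-off, the bump is a test function, so the bump averages of the cut-off
  difference vanish and the approximate identity bound with \<open>W = 0\<close> applies on every
  ball. Uniqueness matters because \<open>sobolev_space\<close> and
  \<open>has_weak_laplacian\<close> each choose their own second derivatives.\<close>

lemma has_weak_partial_unique:
  fixes u g g' :: "real ^ 'n \<Rightarrow> complex"
  assumes g: "has_weak_partial js u g" and g': "has_weak_partial js u g'"
  shows "AE x in lebesgue. g x = g' x"
proof -
  have gl: "locally_integrable g" "locally_integrable g'"
    using g g' unfolding has_weak_partial_def by auto
  have local: "AE x in lborel. x \<in> ball 0 (real k + 1) \<longrightarrow> g x = g' x" for k :: nat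
  proof -
    let ?R = "real k + 1"
    obtain \<theta> :: "real ^ 'n \<Rightarrow> real" where \<theta>: "smooth_fun \<theta>"
      "\<And>x. x \<in> ball 0 ?R \<Longrightarrow> \<theta> x = 1" "\<And>x. x \<notin> ball 0 (?R + 1) \<Longrightarrow> \<theta> x = 0"
      by (rule smooth_cutoff_exists[of ?R "?R + 1" 0]) auto
    define w where "w x = \<theta> x *\<^sub>R g x - \<theta> x *\<^sub>R g' x" for x
    have int: "integrable lebesgue (\<lambda>y. (p y * \<theta> y) *\<^sub>R f y)" if "smooth_fun p" "locally_integrable f" for p f
    proof (rule continuous_mult_integrable[OF smooth_fun_continuous_on[OF smooth_fun.mult[OF that(1) \<theta>(1)]] that(2) compact_cball])
      show "AE x in lebesgue. x \<notin> cball 0 (?R + 1) \<longrightarrow> p x * \<theta> x = 0 \<or> f x = 0"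
        using \<theta>(3) by (intro AE_I2) simp
    qed
    have wi: "integrable lebesgue w"
      unfolding w_def using int[OF smooth_fun.const[of 1]] gl by simp
    then have wm: "w \<in> borel_measurable lebesgue" by (rule borel_measurable_integrable)
    obtain w' where w'[measurable]: "w' \<in> borel_measurable borel" and ww': "AE x in lborel. w x = w' x"
      by (rule borel_representative[OF wm])
    have zero: "(\<integral>y. poisson_bump e (y - x) *\<^sub>R w' y \<partial>lborel) = 0" if e: "e > 0" for e x
    proof -
      let ?p = "\<lambda>y. poisson_bump e (y - x)"
      have sp: "smooth_fun ?p" by (rule smooth_fun_poisson_bump[OF e])
      have t: "test_function (\<lambda>y. ?p y * \<theta> y)"
        by (rule test_functionI[OF smooth_fun.mult[OF sp \<theta>(1)], of 0 "?R + 1"]) (use \<theta>(3) in auto)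
      have "(\<integral>y. ?p y *\<^sub>R w' y \<partial>lborel) = (\<integral>y. ?p y *\<^sub>R w y \<partial>lebesgue)"
      proof (rule integral_lebesgue_eq_lborel[symmetric])
        show "(\<lambda>y. ?p y *\<^sub>R w y) \<in> borel_measurable lebesgue"
          by (rule smooth_fun_mult_measurable[OF sp wm])
        show "AE y in lborel. ?p y *\<^sub>R w y = ?p y *\<^sub>R w' y"
          using ww' by eventually_elim simp
      qed measurable
      also have "\<dots> = (\<integral>y. (?p y * \<theta> y) *\<^sub>R g y - (?p y * \<theta> y) *\<^sub>R g' y \<partial>lebesgue)"
        by (simp add: w_def scaleR_diff_right)
      also have "\<dots> = (\<integral>y. (?p y * \<theta> y) *\<^sub>R g y \<partial>lebesgue) - (\<integral>y. (?p y * \<theta> y) *\<^sub>R g' y \<partial>lebesgue)"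
        by (rule Bochner_Integration.integral_diff[OF int[OF sp gl(1)] int[OF sp gl(2)]])
      also have "\<dots> = 0"
      proof -
        have "(-1) ^ length js * (\<integral>y. (?p y * \<theta> y) *\<^sub>R g y \<partial>lebesgue) = (-1) ^ length js * (\<integral>y. (?p y * \<theta> y) *\<^sub>R g' y \<partial>lebesgue)"
          using g[unfolded has_weak_partial_def, THEN conjunct2, THEN conjunct2, rule_format, OF t]
            g'[unfolded has_weak_partial_def, THEN conjunct2, THEN conjunct2, rule_format, OF t] by simp
        then show ?thesis by simp
      qed
      finally show ?thesis .
    qed
    have "AE x in lborel. x \<in> ball 0 ?R \<longrightarrow> ennreal ((\<integral>z. poisson_bump 1 (z :: real ^ 'n) \<partial>lborel) * norm (w' x)) \<le> 0"
      by (rule approximate_identity_bound[OF integrable_lebesgue_imp_lborel[OF wi w' ww']])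
        (use zero in \<open>auto simp: emeasure_lborel_ball_less_top\<close>)
    then show ?thesis
      using ww'
    proof eventually_elim
      case (elim x)
      show ?case
      proof
        assume x: "x \<in> ball 0 ?R"
        with elim have "(\<integral>z. poisson_bump 1 (z :: real ^ 'n) \<partial>lborel) * norm (w' x) \<le> 0"
          by (simp add: ennreal_eq_0_iff)
        then have "w' x = 0"
          using poisson_bump_integral_pos[where 'n='n] by (simp add: mult_le_0_iff)
        with elim \<theta>(2)[OF x] show "g x = g' x" by (simp add: w_def)
      qed
    qed
  qed
  have "AE x in lborel. \<forall>k :: nat. x \<in> ball 0 (real k + 1) \<longrightarrow> g x = g' x"
    using local unfolding AE_all_countable by blast
  then have "AE x in lborel. g x = g' x"
  proof eventually_elim
    case (elim x)
    obtain k :: nat where "norm x < real k" using reals_Archimedean2 by blast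
    then have "x \<in> ball 0 (real k + 1)" by simp
    with elim show ?case by blast
  qed
  then show ?thesis by (rule AE_completion)
qed

text \<open>Uniqueness transfers square integrability from the derivatives supplied by the Sobolev
  space to the summands of \<open>L\<close>. It is needed for the Newton energy to be
  finite.\<close>

lemma weak_laplacian_L2:
  fixes u L :: "real ^ 'n \<Rightarrow> complex"
  assumes u: "u \<in> sobolev_space 2 2" and uL: "has_weak_laplacian u L"
  shows "(\<integral>\<^sup>+x. ennreal ((norm (L x))\<^sup>2) \<partial>lebesgue) < \<infinity>"
proof -
  obtain g where g: "\<And>i. has_weak_partial [i, i] u (g i)" and L: "L = (\<lambda>x. \<Sum>i\<in>UNIV. g i x)"
    using uL unfolding has_weak_laplacian_def by blast
  have "\<exists>h \<in> Lp_space 2. has_weak_partial [i, i] u h" for i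
    using u unfolding sobolev_space_def by simp
  then obtain h where h: "\<And>i. h i \<in> Lp_space 2" "\<And>i. has_weak_partial [i, i] u (h i)" by metis
  have gm[measurable]: "g i \<in> borel_measurable lebesgue" for i
    using g locally_integrable_measurable unfolding has_weak_partial_def by blast
  have gi: "(\<integral>\<^sup>+x. ennreal ((norm (g i x))\<^sup>2) \<partial>lebesgue) < \<infinity>" for i
  proof -
    have "(\<integral>\<^sup>+x. ennreal ((norm (g i x))\<^sup>2) \<partial>lebesgue) = (\<integral>\<^sup>+x. ennreal (norm (norm (h i x) powr 2)) \<partial>lebesgue)"
    proof (rule nn_integral_cong_AE)
      show "AE x in lebesgue. ennreal ((norm (g i x))\<^sup>2) = ennreal (norm (norm (h i x) powr 2))"
        using has_weak_partial_unique[OF g[of i] h(2)[of i]]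
        by eventually_elim (simp add: powr_numeral)
    qed
    also have "\<dots> < \<infinity>"
      using h(1)[of i] unfolding Lp_space_def integrable_iff_bounded by simp
    finally show ?thesis .
  qed
  have "(\<integral>\<^sup>+x. ennreal ((norm (L x))\<^sup>2) \<partial>lebesgue)
     \<le> (\<integral>\<^sup>+x. ennreal (real CARD('n)) * (\<Sum>i\<in>UNIV. ennreal ((norm (g i x))\<^sup>2)) \<partial>lebesgue)"
  proof (rule nn_integral_mono)
    fix x
    have "(norm (L x))\<^sup>2 \<le> (\<Sum>i\<in>UNIV. norm (g i x))\<^sup>2"
      unfolding L by (intro power_mono norm_sum) simp
    also have "\<dots> \<le> real CARD('n) * (\<Sum>i\<in>UNIV. (norm (g i x))\<^sup>2)"
      using sum_squared_le_sum_of_squares[of "\<lambda>i. norm (g i x)" "UNIV :: 'n set"] by (simp add: mult.commute)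
    finally show "ennreal ((norm (L x))\<^sup>2) \<le> ennreal (real CARD('n)) * (\<Sum>i\<in>UNIV. ennreal ((norm (g i x))\<^sup>2))"
      by (simp add: ennreal_mult[symmetric] sum_nonneg ennreal_leI)
  qed
  also have "\<dots> = ennreal (real CARD('n)) * (\<Sum>i\<in>UNIV. \<integral>\<^sup>+x. ennreal ((norm (g i x))\<^sup>2) \<partial>lebesgue)"
    by (subst nn_integral_cmult) (simp_all add: nn_integral_sum del: sum_ennreal)
  also have "\<dots> < \<infinity>"
    using gi by (simp add: ennreal_mult_less_top)
  finally show ?thesis .
qed

subsection \<open>Dyadic Carleson embedding\<close>

text \<open>Labelling children by Boolean vectors turns the sum over the children of a cell into a
  sum over a finite type.\<close>

definition dyadic_child :: "('n \<Rightarrow> int) \<Rightarrow> ('n \<Rightarrow> bool) \<Rightarrow> 'n \<Rightarrow> int" where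
  "dyadic_child k e = (\<lambda>i. 2 * k i + of_bool (e i))"

text \<open>Quotient and parity of each coordinate recover parent and label. Hence summing over
  parents and then over children visits every cell of the next generation once.\<close>

lemma bij_dyadic_child: "bij (\<lambda>(k, e). dyadic_child k e)"
proof (rule bijI')
  fix p q :: "('a \<Rightarrow> int) \<times> ('a \<Rightarrow> bool)"
  have *: "(\<lambda>i. dyadic_child k e i div 2) = k" "(\<lambda>i. odd (dyadic_child k e i)) = e" for k and e :: "'a \<Rightarrow> bool"
    by (auto simp: dyadic_child_def)
  show "((case p of (k, e) \<Rightarrow> dyadic_child k e) = (case q of (k, e) \<Rightarrow> dyadic_child k e)) = (p = q)"
    using * by (metis case_prod_conv surj_pair)
next
  fix m :: "'a \<Rightarrow> int"
  have "m = dyadic_child (\<lambda>i. m i div 2) (\<lambda>i. odd (m i))"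
    by (auto simp: dyadic_child_def fun_eq_iff)
  then show "\<exists>p. m = (case p of (k, e) \<Rightarrow> dyadic_child k e)"
    by (intro exI[of _ "(\<lambda>i. m i div 2, \<lambda>i. odd (m i))"]) simp
qed

text \<open>The total of \<open>\<alpha>\<close> over the tree below the cell \<open>k\<close> of
  generation \<open>j\<close>: \<open>N\<close> generations, the root included.\<close>

primrec dyadic_sum :: "(nat \<Rightarrow> ('n::finite \<Rightarrow> int) \<Rightarrow> real) \<Rightarrow> nat \<Rightarrow> nat \<Rightarrow> ('n \<Rightarrow> int) \<Rightarrow> real" where
  "dyadic_sum \<alpha> 0 j k = 0"
| "dyadic_sum \<alpha> (Suc N) j k = \<alpha> j k + (\<Sum>e\<in>UNIV. dyadic_sum \<alpha> N (Suc j) (dyadic_child k e))"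

text \<open>Raising the denominator from \<open>D0\<close> to \<open>D\<close> lowers f^2 / D by f^2
  (D - D0) / (D0 D). Since D0 and D are at most 2m and D - D0 is at least lam m^2 / A, the drop is
  at least lam f^2 / (4A): this is the origin of the 4A. Completing the square then replaces -f^2 /
  D by an arbitrary \<open>t\<close>.\<close>

lemma bellman_step:
  fixes F f m D D0 A lam t :: real
  assumes "m > 0" "m \<le> D0" "D0 + lam * m\<^sup>2 / A \<le> D" "D \<le> 2 * m" "A > 0" "lam \<ge> 0"
  shows "lam * f\<^sup>2 + 4 * A * (F - f\<^sup>2 / D0) \<le> 4 * A * (F - 2 * t * f + t\<^sup>2 * D)"
proof -
  have D0: "D0 > 0" using assms by linarith
  have "lam * m\<^sup>2 / A \<ge> 0" using assms by simp
  then have D: "D > 0" "D0 \<le> D" using assms D0 by linarith+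
  have "lam * f\<^sup>2 / (4 * A) = f\<^sup>2 * (lam * m\<^sup>2 / A) / (2 * m * (2 * m))"
    using assms by (simp add: field_simps power2_eq_square)
  also have "\<dots> \<le> f\<^sup>2 * (D - D0) / (D0 * D)"
    using assms D0 D by (intro frac_le mult_left_mono mult_mono mult_nonneg_nonneg) auto
  also have "\<dots> = f\<^sup>2 / D0 - f\<^sup>2 / D" using D0 D by (simp add: field_simps)
  also have "\<dots> \<le> f\<^sup>2 / D0 - 2 * t * f + t\<^sup>2 * D"
  proof -
    have "0 \<le> (f - t * D)\<^sup>2 / D" using D by simp
    also have "\<dots> = f\<^sup>2 / D - 2 * t * f + t\<^sup>2 * D"
      using D by (simp add: field_simps power2_eq_square)
    finally show ?thesis by simp
  qed
  finally have "lam * f\<^sup>2 \<le> 4 * A * (f\<^sup>2 / D0 - 2 * t * f + t\<^sup>2 * D)"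
    using assms by (simp add: field_simps)
  then show ?thesis by (simp add: algebra_simps)
qed

text \<open>
  The Bellman function is \<open>F - f\<^sup>2 / (m + M/A)\<close>; writing it as a minimum over \<open>t\<close> makes the induction
  hypotheses of the children additive.
\<close>

lemma dyadic_carleson:
  fixes F f m M :: "nat \<Rightarrow> ('n::finite \<Rightarrow> int) \<Rightarrow> real" and lam :: "nat \<Rightarrow> real"
  assumes F: "\<And>j k. F j k = (\<Sum>e\<in>UNIV. F (Suc j) (dyadic_child k e))"
    and f: "\<And>j k. f j k = (\<Sum>e\<in>UNIV. f (Suc j) (dyadic_child k e))"
    and m: "\<And>j k. m j k = (\<Sum>e\<in>UNIV. m (Suc j) (dyadic_child k e))"
    and M: "\<And>j k. lam j * (m j k)\<^sup>2 + (\<Sum>e\<in>UNIV. M (Suc j) (dyadic_child k e)) \<le> M j k"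
    and M0: "\<And>j k. 0 \<le> M j k" and MA: "\<And>j k. M j k \<le> A * m j k"
    and sq: "\<And>j k t. 0 \<le> F j k - 2 * t * f j k + t\<^sup>2 * m j k"
    and m0: "\<And>j k. 0 \<le> m j k" and lam: "\<And>j. 0 \<le> lam j" and A: "A > 0"
  shows "dyadic_sum (\<lambda>j k. lam j * (f j k)\<^sup>2) N j k
    \<le> 4 * A * (F j k - 2 * t * f j k + t\<^sup>2 * (m j k + M j k / A))"
proof (induction N arbitrary: j k t)
  case 0
  have "0 \<le> t\<^sup>2 * (M j k / A)" using M0 A by simp
  then have "0 \<le> F j k - 2 * t * f j k + t\<^sup>2 * (m j k + M j k / A)"
    using sq[of j k t] by (simp add: distrib_left)
  then show ?case using A by simp
next
  case (Suc N)
  let ?S = "\<lambda>N j k. dyadic_sum (\<lambda>j k. lam j * (f j k)\<^sup>2) N j k"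
  define D0 where "D0 = m j k + (\<Sum>e\<in>UNIV. M (Suc j) (dyadic_child k e)) / A"
  define D where "D = m j k + M j k / A"
  have IH: "(\<Sum>e\<in>UNIV. ?S N (Suc j) (dyadic_child k e)) \<le> 4 * A * (F j k - 2 * s * f j k + s\<^sup>2 * D0)" for s
  proof -
    have "(\<Sum>e\<in>UNIV. ?S N (Suc j) (dyadic_child k e)) \<le>
      (\<Sum>e\<in>UNIV. 4 * A * (F (Suc j) (dyadic_child k e) - 2 * s * f (Suc j) (dyadic_child k e)
         + s\<^sup>2 * (m (Suc j) (dyadic_child k e) + M (Suc j) (dyadic_child k e) / A)))"
      by (intro sum_mono Suc.IH)
    also have "\<dots> = 4 * A * (F j k - 2 * s * f j k + s\<^sup>2 * D0)"
      unfolding D0_def F[of j k] f[of j k] m[of j k]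
      by (simp add: sum_distrib_left[symmetric] sum.distrib sum_subtractf sum_divide_distrib[symmetric])
    finally show ?thesis .
  qed
  have DD0: "D0 + lam j * (m j k)\<^sup>2 / A \<le> D"
    using M[of j k] A unfolding D_def D0_def by (simp add: add_divide_distrib[symmetric] divide_right_mono add.commute)
  have mD0: "m j k \<le> D0"
    unfolding D0_def using A M0 by (simp add: sum_nonneg)
  have D2: "D \<le> 2 * m j k"
    using MA[of j k] A unfolding D_def by (simp add: field_simps)
  show ?case
  proof (cases "m j k = 0")
    case True
    \<comment> \<open>With zero mass the quadratic polynomial in \<open>t\<close> is affine, and it
      can be nonnegative for all \<open>t\<close> only if its slope vanishes.\<close>
    have "f j k = 0"
    proof (rule ccontr)
      assume "f j k \<noteq> 0"
      then have "0 \<le> F j k - 2 * ((\<bar>F j k\<bar> + 1) / f j k) * f j k"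
        using sq[of j k "(\<bar>F j k\<bar> + 1) / f j k"] True by simp
      then show False using \<open>f j k \<noteq> 0\<close> by simp
    qed
    moreover have "D \<ge> 0" using M0[of j k] A True by (simp add: D_def)
    ultimately have "?S (Suc N) j k \<le> 4 * A * (F j k - 2 * 0 * f j k + 0\<^sup>2 * D0)"
      using IH[of 0] by simp
    also have "\<dots> \<le> 4 * A * (F j k - 2 * t * f j k + t\<^sup>2 * D)"
      using \<open>f j k = 0\<close> \<open>D \<ge> 0\<close> A by (intro mult_left_mono) auto
    finally show ?thesis unfolding D_def .
  next
    case False
    then have mp: "m j k > 0" using m0[of j k] by simp
    \<comment> \<open>The value \<open>t = f / D0\<close> minimises the bound obtained from the
      children.\<close>
    have "?S (Suc N) j k \<le> lam j * (f j k)\<^sup>2 + 4 * A * (F j k - 2 * (f j k / D0) * f j k + (f j k / D0)\<^sup>2 * D0)"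
      using IH[of "f j k / D0"] by simp
    also have "F j k - 2 * (f j k / D0) * f j k + (f j k / D0)\<^sup>2 * D0 = F j k - (f j k)\<^sup>2 / D0"
      using mp mD0 by (simp add: field_simps power2_eq_square)
    also have "lam j * (f j k)\<^sup>2 + 4 * A * (F j k - (f j k)\<^sup>2 / D0) \<le> 4 * A * (F j k - 2 * t * f j k + t\<^sup>2 * D)"
      by (rule bellman_step[OF mp mD0 DD0 D2 A lam])
    finally show ?thesis unfolding D_def .
  qed
qed

subsection \<open>Dyadic cells and the Newton kernel\<close>

definition dyadic_index :: "nat \<Rightarrow> real ^ 'n \<Rightarrow> 'n \<Rightarrow> int" where
  "dyadic_index j x = (\<lambda>i. \<lfloor>2 ^ j * x $ i\<rfloor>)"

definition dyadic_cell :: "nat \<Rightarrow> ('n \<Rightarrow> int) \<Rightarrow> (real ^ 'n) set" where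
  "dyadic_cell j k = {x. dyadic_index j x = k}"

lemma dyadic_cell_borel[measurable]: "dyadic_cell j k \<in> sets borel"
proof -
  have "dyadic_cell j k = {x. \<forall>i. \<lfloor>2 ^ j * x $ i\<rfloor> = k i}"
    by (auto simp: dyadic_cell_def dyadic_index_def fun_eq_iff)
  then show ?thesis by simp
qed

lemma dyadic_index_measurable[measurable]:
  "dyadic_index j \<in> borel \<rightarrow>\<^sub>M (count_space UNIV :: ('n::finite \<Rightarrow> int) measure)"
proof (subst measurable_count_space_eq_countable)
  show "countable (UNIV :: ('n \<Rightarrow> int) set)" by simp
  have *: "dyadic_index j -` {k} \<inter> space borel \<in> sets borel" for k :: "'n \<Rightarrow> int"
    using dyadic_cell_borel[of j k] by (simp add: dyadic_cell_def vimage_def)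
  show "dyadic_index j \<in> space borel \<rightarrow> (UNIV :: ('n \<Rightarrow> int) set) \<and>
      (\<forall>a\<in>(UNIV :: ('n \<Rightarrow> int) set). dyadic_index j -` {a} \<inter> space borel \<in> sets borel)"
    by (intro conjI ballI * Pi_I UNIV_I)
qed

lemma dyadic_index_Suc: "dyadic_index j x = (\<lambda>i. dyadic_index (Suc j) x i div 2)"
proof
  fix i
  have "2 ^ j * x $ i = (2 ^ Suc j * x $ i) / of_int 2" by simp
  then show "dyadic_index j x i = dyadic_index (Suc j) x i div 2"
    unfolding dyadic_index_def by (metis floor_divide_real_eq_div zero_le_numeral)
qed

text \<open>Nesting and disjointness at once: halving the fine index gives the coarse one, and the
  parities of the fine index single out the child.\<close>

lemma mem_dyadic_cell_child:
  "x \<in> dyadic_cell (Suc j) (dyadic_child k e) \<longleftrightarrow>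
    x \<in> dyadic_cell j k \<and> e = (\<lambda>i. odd (dyadic_index (Suc j) x i))"
proof
  assume "x \<in> dyadic_cell (Suc j) (dyadic_child k e)"
  then have "dyadic_index (Suc j) x = dyadic_child k e" by (simp add: dyadic_cell_def)
  then show "x \<in> dyadic_cell j k \<and> e = (\<lambda>i. odd (dyadic_index (Suc j) x i))"
    using dyadic_index_Suc[of j x] by (auto simp: dyadic_cell_def dyadic_child_def)
next
  assume *: "x \<in> dyadic_cell j k \<and> e = (\<lambda>i. odd (dyadic_index (Suc j) x i))"
  then have k: "k = (\<lambda>i. dyadic_index (Suc j) x i div 2)"
    using dyadic_index_Suc[of j x] by (simp add: dyadic_cell_def)
  show "x \<in> dyadic_cell (Suc j) (dyadic_child k e)"
    using * unfolding k by (auto simp: dyadic_cell_def dyadic_child_def fun_eq_iff)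
qed

text \<open>Only one summand survives. The weight \<open>g\<close> lets the indicator of a second
  point ride along, which evaluates sums over children of indicators of pairs.\<close>

lemma sum_indicator_dyadic_child:
  "(\<Sum>e\<in>UNIV. g e * indicator (dyadic_cell (Suc j) (dyadic_child k e)) x)
    = g (\<lambda>i. odd (dyadic_index (Suc j) x i)) * (indicator (dyadic_cell j k) x :: 'b :: comm_semiring_1)"
proof -
  have "indicator (dyadic_cell (Suc j) (dyadic_child k e)) x
    = (if e = (\<lambda>i. odd (dyadic_index (Suc j) x i)) then indicator (dyadic_cell j k) x else (0 :: 'b))" for e
    by (auto simp: indicator_def mem_dyadic_cell_child)
  then have "(\<Sum>e\<in>UNIV. g e * indicator (dyadic_cell (Suc j) (dyadic_child k e)) x)
    = (\<Sum>e\<in>UNIV. if e = (\<lambda>i. odd (dyadic_index (Suc j) x i)) then g e * (indicator (dyadic_cell j k) x :: 'b) else 0)"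
    by (intro sum.cong) auto
  also have "\<dots> = g (\<lambda>i. odd (dyadic_index (Suc j) x i)) * indicator (dyadic_cell j k) x"
    by (subst sum.delta) auto
  finally show ?thesis .
qed

lemma dyadic_cell_norm_le:
  fixes x y :: "real ^ 'n"
  assumes "x \<in> dyadic_cell j k" "y \<in> dyadic_cell j k"
  shows "norm (x - y) \<le> real CARD('n) * (1/2) ^ j"
proof -
  have "\<bar>x $ i - y $ i\<bar> \<le> (1/2) ^ j" for i
  proof -
    have "\<lfloor>2 ^ j * x $ i\<rfloor> = \<lfloor>2 ^ j * y $ i\<rfloor>"
      using assms by (auto simp: dyadic_cell_def dyadic_index_def fun_eq_iff)
    then have "\<bar>2 ^ j * x $ i - 2 ^ j * y $ i\<bar> \<le> 1" by linarith
    then have "2 ^ j * \<bar>x $ i - y $ i\<bar> \<le> 1"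
      by (simp add: right_diff_distrib[symmetric] abs_mult)
    then show ?thesis by (simp add: power_one_over field_simps)
  qed
  then have "(\<Sum>i\<in>UNIV. \<bar>(x - y) $ i\<bar>) \<le> (\<Sum>i\<in>(UNIV :: 'n set). (1/2) ^ j)"
    by (intro sum_mono) simp
  then show ?thesis using norm_le_l1_cart[of "x - y"] by simp
qed

lemma dyadic_newton_kernel_lower:
  fixes x y :: "real ^ 'n"
  assumes "x \<in> dyadic_cell j k" "y \<in> dyadic_cell j k" "x \<noteq> y"
  shows "(2 ^ j) ^ (CARD('n) - 2) \<le> real CARD('n) ^ (CARD('n) - 2) * newton_kernel (x - y)"
proof -
  have "2 ^ j * norm (x - y) \<le> real CARD('n)"
    using dyadic_cell_norm_le[OF assms(1,2)] by (simp add: power_one_over field_simps)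
  then have "2 ^ j \<le> real CARD('n) / norm (x - y)"
    using assms by (simp add: field_simps)
  then have "(2 ^ j) ^ (CARD('n) - 2) \<le> (real CARD('n) / norm (x - y)) ^ (CARD('n) - 2)"
    by (intro power_mono) auto
  then show ?thesis by (simp add: newton_kernel_def power_divide)
qed

text \<open>The cells of one generation whose closures meet a given cell, itself included, as index
  displacements.\<close>

definition neighbour_offsets :: "('n::finite \<Rightarrow> int) set" where
  "neighbour_offsets = {\<tau>. \<forall>i. \<bar>\<tau> i\<bar> \<le> 1}"

lemma finite_neighbour_offsets: "finite (neighbour_offsets :: ('n::finite \<Rightarrow> int) set)"
proof -
  have eq: "neighbour_offsets = (PiE UNIV (\<lambda>_. {-1..1}) :: ('n \<Rightarrow> int) set)"
    by (auto simp: neighbour_offsets_def PiE_def Pi_def abs_le_iff)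
  show ?thesis unfolding eq by (rule finite_PiE) auto
qed

text \<open>At the generation with 2^(-j-1) \<le> |x - y| < 2^(-j) each coordinate moves by less
  than one side, so the cells of \<open>x\<close> and \<open>y\<close> are equal or touching, and
  the single term for this \<open>j\<close> already suffices. The lower bound on |x - y| costs
  2^(n-2), and |x - y| < 1 guarantees that such a \<open>j\<close> \<ge> 0 exists.\<close>

lemma dyadic_newton_kernel_upper:
  fixes x y :: "real ^ 'n"
  assumes "CARD('n) \<ge> 3" "norm (x - y) < 1"
  shows "ennreal (newton_kernel (x - y)) \<le> ennreal (2 ^ (CARD('n) - 2)) *
    (\<Sum>j. ennreal ((2 ^ j) ^ (CARD('n) - 2)) *
       (\<Sum>\<tau>\<in>neighbour_offsets. indicator (dyadic_cell j (\<lambda>i. dyadic_index j x i + \<tau> i)) y))"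
    (is "_ \<le> _ * (\<Sum>j. ?g j)")
proof (cases "x = y")
  case True
  then show ?thesis
    using assms by (simp add: newton_kernel_def power_0_left)
next
  case False
  then obtain j where j: "(1/2) ^ Suc j \<le> norm (x - y)" "norm (x - y) < (1/2) ^ j"
    using dyadic_scale[of "norm (x - y)"] assms by auto
  define \<tau> where "\<tau> i = dyadic_index j y i - dyadic_index j x i" for i
  have "\<bar>\<tau> i\<bar> \<le> 1" for i
  proof -
    have "\<bar>x $ i - y $ i\<bar> < (1/2) ^ j"
      using component_le_norm_cart[of "x - y" i] j by simp
    then have "2 ^ j * \<bar>x $ i - y $ i\<bar> < 1" by (simp add: power_one_over field_simps)
    then have "\<bar>2 ^ j * x $ i - 2 ^ j * y $ i\<bar> < 1"
      by (simp add: right_diff_distrib[symmetric] abs_mult)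
    then show ?thesis unfolding \<tau>_def dyadic_index_def by linarith
  qed
  then have \<tau>: "\<tau> \<in> neighbour_offsets" by (simp add: neighbour_offsets_def)
  have y: "y \<in> dyadic_cell j (\<lambda>i. dyadic_index j x i + \<tau> i)"
    by (simp add: dyadic_cell_def \<tau>_def)
  have "1 / norm (x - y) \<le> 1 / (1/2) ^ Suc j" using j False by (intro divide_left_mono) (auto intro!: mult_pos_pos)
  then have "1 / norm (x - y) \<le> 2 * 2 ^ j" by (simp add: power_one_over)
  then have "(1 / norm (x - y)) ^ (CARD('n) - 2) \<le> (2 * 2 ^ j) ^ (CARD('n) - 2)"
    by (intro power_mono) auto
  then have "newton_kernel (x - y) \<le> 2 ^ (CARD('n) - 2) * (2 ^ j) ^ (CARD('n) - 2)"
    by (simp add: newton_kernel_def power_one_over power_mult_distrib)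
  then have "ennreal (newton_kernel (x - y)) \<le> ennreal (2 ^ (CARD('n) - 2)) * (ennreal ((2 ^ j) ^ (CARD('n) - 2)) * 1)"
    by (simp add: ennreal_mult[symmetric] ennreal_leI)
  also have "(1 :: ennreal) = (\<Sum>\<sigma>\<in>{\<tau>}. indicator (dyadic_cell j (\<lambda>i. dyadic_index j x i + \<sigma> i)) y)"
    using y by simp
  also have "\<dots> \<le> (\<Sum>\<tau>\<in>neighbour_offsets. indicator (dyadic_cell j (\<lambda>i. dyadic_index j x i + \<tau> i)) y)"
    by (rule sum_mono2[OF finite_neighbour_offsets]) (use \<tau> in auto)
  also have "ennreal ((2 ^ j) ^ (CARD('n) - 2)) * (\<Sum>\<tau>\<in>neighbour_offsets. indicator (dyadic_cell j (\<lambda>i. dyadic_index j x i + \<tau> i)) y)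
      = (\<Sum>j\<in>{j}. ?g j)" by simp
  also have "\<dots> \<le> (\<Sum>j. ?g j)" by (rule sum_le_suminf) auto
  finally show ?thesis by (simp add: mult_left_mono)
qed

subsection \<open>The trace inequality\<close>

text \<open>Points are sorted by the value of \<open>loc\<close>: this is Tonelli for
  \<open>M\<close> and the counting measure on the countable range.\<close>

lemma nn_integral_fibres:
  fixes loc :: "'a \<Rightarrow> 'k :: countable"
  assumes M: "sigma_finite_measure M" and loc[measurable]: "loc \<in> M \<rightarrow>\<^sub>M count_space UNIV"
    and g[measurable]: "g \<in> borel_measurable M"
  shows "(\<integral>\<^sup>+x. g x * G (loc x) \<partial>M) = (\<integral>\<^sup>+k. G k * (\<integral>\<^sup>+x. g x * indicator {x. loc x = k} x \<partial>M) \<partial>count_space UNIV)"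
proof -
  interpret M: sigma_finite_measure M by fact
  interpret C: sigma_finite_measure "count_space (UNIV :: 'k set)"
    by (rule sigma_finite_measure_count_space_countable) simp
  interpret P: pair_sigma_finite "count_space (UNIV :: 'k set)" M ..
  have meas: "(\<lambda>x. g x * indicator {x. loc x = k} x) \<in> borel_measurable M" for k
    by measurable
  have "(\<integral>\<^sup>+k. G k * (\<integral>\<^sup>+x. g x * indicator {x. loc x = k} x \<partial>M) \<partial>count_space UNIV)
     = (\<integral>\<^sup>+k. (\<integral>\<^sup>+x. G k * (g x * indicator {x. loc x = k} x) \<partial>M) \<partial>count_space UNIV)"
    by (intro nn_integral_cong nn_integral_cmult[symmetric] meas)
  also have "\<dots> = (\<integral>\<^sup>+x. (\<integral>\<^sup>+k. G k * (g x * indicator {x. loc x = k} x) \<partial>count_space UNIV) \<partial>M)"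
  proof (rule P.Fubini'[symmetric])
    show "(\<lambda>(k, x). G k * (g x * indicator {x. loc x = k} x)) \<in> borel_measurable (count_space UNIV \<Otimes>\<^sub>M M)"
      by (rule measurable_pair_measure_countable1) (use meas in \<open>auto intro!: borel_measurable_times\<close>)
  qed
  also have "\<dots> = (\<integral>\<^sup>+x. g x * G (loc x) \<partial>M)"
  proof (rule nn_integral_cong)
    fix x
    have "(\<integral>\<^sup>+k. G k * (g x * indicator {x. loc x = k} x) \<partial>count_space UNIV)
      = (\<integral>\<^sup>+k. (g x * G (loc x)) * indicator {loc x} k \<partial>count_space UNIV)"
      by (intro nn_integral_cong) (auto simp: indicator_def mult_ac)
    also have "\<dots> = g x * G (loc x)"
      by (subst nn_integral_cmult_indicator) auto
    finally show "(\<integral>\<^sup>+k. G k * (g x * indicator {x. loc x = k} x) \<partial>count_space UNIV) = g x * G (loc x)" .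
  qed
  finally show ?thesis ..
qed

text \<open>Trees rooted at all cells of generation \<open>j\<close> visit each cell of the
  following generations exactly once, by the bijection between cells and pairs of parent and
  label.\<close>

lemma nn_integral_dyadic_sum:
  fixes \<alpha> :: "nat \<Rightarrow> ('n::finite \<Rightarrow> int) \<Rightarrow> real"
  assumes \<alpha>: "\<And>j k. 0 \<le> \<alpha> j k"
  shows "(\<integral>\<^sup>+k. ennreal (dyadic_sum \<alpha> N j k) \<partial>count_space UNIV) = (\<Sum>i<N. \<integral>\<^sup>+k. ennreal (\<alpha> (j + i) k) \<partial>count_space UNIV)"
proof (induction N arbitrary: j)
  case (Suc N)
  have nonneg: "0 \<le> dyadic_sum \<alpha> N j k" for N j k
    by (induction N arbitrary: j k) (auto intro: add_nonneg_nonneg sum_nonneg \<alpha>)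
  let ?S = "\<lambda>k. ennreal (dyadic_sum \<alpha> N (Suc j) k)"
  have "(\<integral>\<^sup>+k. ennreal (dyadic_sum \<alpha> (Suc N) j k) \<partial>count_space UNIV)
     = (\<integral>\<^sup>+k. ennreal (\<alpha> j k) + (\<Sum>e\<in>UNIV. ?S (dyadic_child k e)) \<partial>count_space UNIV)"
    by (simp add: ennreal_plus \<alpha> nonneg sum_nonneg)
  also have "\<dots> = (\<integral>\<^sup>+k. ennreal (\<alpha> j k) \<partial>count_space UNIV)
      + (\<integral>\<^sup>+k. (\<Sum>e\<in>UNIV. ?S (dyadic_child k e)) \<partial>count_space UNIV)"
    by (rule nn_integral_add) auto
  also have "(\<integral>\<^sup>+k. (\<Sum>e\<in>UNIV. ?S (dyadic_child k e)) \<partial>count_space UNIV)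
     = (\<integral>\<^sup>+k. \<integral>\<^sup>+e. ?S (case (k, e) of (k, e) \<Rightarrow> dyadic_child k e) \<partial>count_space UNIV \<partial>count_space UNIV)"
    by (simp add: nn_integral_count_space_finite)
  also have "\<dots> = (\<integral>\<^sup>+p. ?S (case p of (k, e) \<Rightarrow> dyadic_child k e) \<partial>count_space UNIV)"
    by (rule nn_integral_fst_count_space)
  also have "\<dots> = (\<integral>\<^sup>+k. ?S k \<partial>count_space UNIV)"
    by (rule nn_integral_bij_count_space[OF bij_dyadic_child])
  also have "\<dots> = (\<Sum>i<N. \<integral>\<^sup>+k. ennreal (\<alpha> (Suc j + i) k) \<partial>count_space UNIV)" by (rule Suc.IH)
  finally show ?case
    by (subst sum.lessThan_Suc_shift) simp
qed simp

text \<open>In the application \<open>M\<close> is |V| dx restricted to a small ball,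
  \<open>h\<close> is the quotient f / |V|, and \<open>testing\<close> is the Kerman-Sawyer
  condition on cubes of side at most 1. The support condition \<open>h_supp\<close> keeps pairs
  within the range of these cubes.\<close>

locale dyadic_energy = finite_measure M for M :: "(real ^ 'n) measure" +
  fixes h :: "real ^ 'n \<Rightarrow> real" and c :: real
  assumes sets_M[measurable_cong]: "sets M = sets borel"
    and no_atoms: "\<And>x. emeasure M {x} = 0"
    and dim: "CARD('n) \<ge> 3"
    and h_borel[measurable]: "h \<in> borel_measurable borel" and h_nonneg: "\<And>x. 0 \<le> h x"
    and h_L2: "integrable M (\<lambda>x. (h x)\<^sup>2)"
    and h_supp: "\<And>x y. h x \<noteq> 0 \<Longrightarrow> h y \<noteq> 0 \<Longrightarrow> norm (x - y) < 1"
    and c: "c > 0"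
    and testing: "\<And>j k. (\<integral>\<^sup>+x\<in>dyadic_cell j k. (\<integral>\<^sup>+y\<in>dyadic_cell j k. ennreal (newton_kernel (x - y)) \<partial>M) \<partial>M)
      \<le> ennreal c * emeasure M (dyadic_cell j k)"
begin

text \<open>The factor \<open>n^(n-2)\<close> makes the kernel at least \<open>side(Q)^(2-n)\<close> on a cell \<open>Q\<close>, whose diameter is at most \<open>n side(Q)\<close>.\<close>

definition "cell_energy j k = (\<integral>\<^sup>+x. \<integral>\<^sup>+y. ennreal ((real CARD('n) ^ (CARD('n) - 2)) * newton_kernel (x - y)) * (indicator (dyadic_cell j k) x * indicator (dyadic_cell j k) y) \<partial>M \<partial>M)"

lemma kernel_split: "ennreal ((real CARD('n) ^ (CARD('n) - 2)) * newton_kernel z)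
    = ennreal (real CARD('n) ^ (CARD('n) - 2)) * ennreal (newton_kernel z)"
  by (rule ennreal_mult') simp

lemma cell_energy_le: "cell_energy j k \<le> ennreal ((real CARD('n) ^ (CARD('n) - 2)) * c * measure M (dyadic_cell j k))"
proof -
  have "cell_energy j k = (\<integral>\<^sup>+x. ennreal (real CARD('n) ^ (CARD('n) - 2)) * ((\<integral>\<^sup>+y\<in>dyadic_cell j k. ennreal (newton_kernel (x - y)) \<partial>M) * indicator (dyadic_cell j k) x) \<partial>M)"
    unfolding cell_energy_def
  proof (rule nn_integral_cong)
    fix x
    have "(\<integral>\<^sup>+y. ennreal ((real CARD('n) ^ (CARD('n) - 2)) * newton_kernel (x - y)) * (indicator (dyadic_cell j k) x * indicator (dyadic_cell j k) y) \<partial>M)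
      = (\<integral>\<^sup>+y. (ennreal (real CARD('n) ^ (CARD('n) - 2)) * indicator (dyadic_cell j k) x) * (ennreal (newton_kernel (x - y)) * indicator (dyadic_cell j k) y) \<partial>M)"
      unfolding kernel_split by (intro nn_integral_cong) (simp only: mult_ac)
    also have "\<dots> = (ennreal (real CARD('n) ^ (CARD('n) - 2)) * indicator (dyadic_cell j k) x) * (\<integral>\<^sup>+y\<in>dyadic_cell j k. ennreal (newton_kernel (x - y)) \<partial>M)"
      by (rule nn_integral_cmult) measurable
    finally show "(\<integral>\<^sup>+y. ennreal ((real CARD('n) ^ (CARD('n) - 2)) * newton_kernel (x - y)) * (indicator (dyadic_cell j k) x * indicator (dyadic_cell j k) y) \<partial>M)
      = ennreal (real CARD('n) ^ (CARD('n) - 2)) * ((\<integral>\<^sup>+y\<in>dyadic_cell j k. ennreal (newton_kernel (x - y)) \<partial>M) * indicator (dyadic_cell j k) x)"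
      by (simp add: mult_ac)
  qed
  also have "\<dots> = ennreal (real CARD('n) ^ (CARD('n) - 2)) * (\<integral>\<^sup>+x\<in>dyadic_cell j k. (\<integral>\<^sup>+y\<in>dyadic_cell j k. ennreal (newton_kernel (x - y)) \<partial>M) \<partial>M)"
    by (rule nn_integral_cmult) measurable
  also have "\<dots> \<le> ennreal (real CARD('n) ^ (CARD('n) - 2)) * (ennreal c * emeasure M (dyadic_cell j k))"
    by (intro mult_left_mono testing) simp
  also have "\<dots> = ennreal ((real CARD('n) ^ (CARD('n) - 2)) * c * measure M (dyadic_cell j k))"
    using c by (simp add: emeasure_eq_measure ennreal_mult mult.assoc)
  finally show ?thesis .
qed

lemma nn_integral_cell_product:
  "(\<integral>\<^sup>+x. \<integral>\<^sup>+y. ennreal r * (indicator (dyadic_cell j k) x * indicator (dyadic_cell j k) y) \<partial>M \<partial>M)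
    = ennreal (r * (measure M (dyadic_cell j k))\<^sup>2)"
proof (cases "r \<ge> 0")
  case True
  have "(\<integral>\<^sup>+x. \<integral>\<^sup>+y. ennreal r * (indicator (dyadic_cell j k) x * indicator (dyadic_cell j k) y) \<partial>M \<partial>M)
    = (\<integral>\<^sup>+x. (\<integral>\<^sup>+y. (ennreal r * indicator (dyadic_cell j k) x) * indicator (dyadic_cell j k) y \<partial>M) \<partial>M)"
    by (simp add: mult.assoc)
  also have "\<dots> = (\<integral>\<^sup>+x. (ennreal r * emeasure M (dyadic_cell j k)) * indicator (dyadic_cell j k) x \<partial>M)"
    by (intro nn_integral_cong, subst nn_integral_cmult_indicator) (auto simp: mult_ac)
  also have "\<dots> = (ennreal r * emeasure M (dyadic_cell j k)) * emeasure M (dyadic_cell j k)"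
    by (rule nn_integral_cmult_indicator) measurable
  finally show ?thesis
    using True by (simp add: emeasure_eq_measure ennreal_mult power2_eq_square mult.assoc)
next
  case False
  then show ?thesis by (simp add: ennreal_neg mult_nonpos_nonneg)
qed

text \<open>Off the diagonal this is the diameter bound for the cell. On the diagonal the kernel
  takes its default value 0 and the pointwise comparison would fail, so the absence of atoms is
  essential.\<close>

lemma cell_energy_ge: "ennreal (((2 ^ j :: real) ^ (CARD('n) - 2)) * (measure M (dyadic_cell j k))\<^sup>2) \<le> cell_energy j k"
  unfolding cell_energy_def nn_integral_cell_product[symmetric]
proof (rule nn_integral_mono, rule nn_integral_mono_AE)
  fix x
  have "{x} \<in> null_sets M" using no_atoms by (intro null_setsI) (auto simp: sets_M)
  from AE_not_in[OF this]
  show "AE y in M. ennreal (((2 ^ j :: real) ^ (CARD('n) - 2))) * (indicator (dyadic_cell j k) x * indicator (dyadic_cell j k) y)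
      \<le> ennreal ((real CARD('n) ^ (CARD('n) - 2)) * newton_kernel (x - y)) * (indicator (dyadic_cell j k) x * indicator (dyadic_cell j k) y)"
  proof eventually_elim
    case (elim y)
    then show ?case
      using dyadic_newton_kernel_lower[of x j k y]
      by (auto simp: indicator_def intro: ennreal_leI)
  qed
qed

text \<open>Pairs of points in different children are counted in the energy of the cell but not in
  those of its children, and on them the scaled kernel is at least
  \<open>(2 ^ j) ^ (CARD('n) - 2)\<close>. The terms are arranged so that no subtraction in
  \<open>ennreal\<close> occurs.\<close>

lemma cell_energy_children:
  "(\<Sum>e\<in>UNIV. cell_energy (Suc j) (dyadic_child k e)) + ennreal (((2 ^ j :: real) ^ (CARD('n) - 2)) * (measure M (dyadic_cell j k))\<^sup>2)
    \<le> cell_energy j k + (\<Sum>e\<in>UNIV. ennreal (((2 ^ j :: real) ^ (CARD('n) - 2)) * (measure M (dyadic_cell (Suc j) (dyadic_child k e)))\<^sup>2))"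
proof -
  let ?q = "\<lambda>j k x y. indicator (dyadic_cell j k) x * indicator (dyadic_cell j k) y :: ennreal"
  let ?s = "\<lambda>x y. \<Sum>e\<in>UNIV. ?q (Suc j) (dyadic_child k e) x y"
  let ?K = "\<lambda>x y. ennreal ((real CARD('n) ^ (CARD('n) - 2)) * newton_kernel (x - y))"
  have pointwise: "?K x y * ?s x y + ennreal (((2 ^ j :: real) ^ (CARD('n) - 2))) * ?q j k x y \<le> ?K x y * ?q j k x y + ennreal (((2 ^ j :: real) ^ (CARD('n) - 2))) * ?s x y" for x y
  proof -
    have s: "?s x y = indicator (dyadic_cell (Suc j) (dyadic_child k (\<lambda>i. odd (dyadic_index (Suc j) y i)))) x * indicator (dyadic_cell j k) y"
      by (rule sum_indicator_dyadic_child)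
    show ?thesis
    proof (cases "x \<in> dyadic_cell j k \<and> y \<in> dyadic_cell j k")
      case True
      show ?thesis
      \<comment> \<open>Equal points lie in the same child, so \<open>?s\<close> and
        \<open>?q j k\<close> agree and both sides coincide whatever the value of the
        kernel.\<close>
      proof (cases "x = y")
        case True
        then show ?thesis unfolding s by (simp add: mem_dyadic_cell_child indicator_def)
      next
        case False
        then have "ennreal (((2 ^ j :: real) ^ (CARD('n) - 2))) \<le> ?K x y"
          using dyadic_newton_kernel_lower[of x j k y] True by (intro ennreal_leI) auto
        with True show ?thesis unfolding s by (auto simp: indicator_def add.commute)
      qed
    next
      case False
      then show ?thesis unfolding s by (auto simp: indicator_def mem_dyadic_cell_child)
    qed
  qed
  have T_add: "(\<integral>\<^sup>+x. \<integral>\<^sup>+y. a x y + b x y \<partial>M \<partial>M) = (\<integral>\<^sup>+x. \<integral>\<^sup>+y. a x y \<partial>M \<partial>M) + (\<integral>\<^sup>+x. \<integral>\<^sup>+y. b x y \<partial>M \<partial>M)"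
    if [measurable]: "case_prod a \<in> borel_measurable (M \<Otimes>\<^sub>M M)" "case_prod b \<in> borel_measurable (M \<Otimes>\<^sub>M M)" for a b :: "real ^ 'n \<Rightarrow> real ^ 'n \<Rightarrow> ennreal"
    by (subst nn_integral_add[symmetric], measurable) (intro nn_integral_cong nn_integral_add, measurable)
  have T_sum: "(\<integral>\<^sup>+x. \<integral>\<^sup>+y. (\<Sum>e\<in>UNIV. a e x y) \<partial>M \<partial>M) = (\<Sum>e\<in>UNIV. \<integral>\<^sup>+x. \<integral>\<^sup>+y. a e x y \<partial>M \<partial>M)"
    if [measurable]: "\<And>e. case_prod (a e) \<in> borel_measurable (M \<Otimes>\<^sub>M M)" for a :: "('n \<Rightarrow> bool) \<Rightarrow> real ^ 'n \<Rightarrow> real ^ 'n \<Rightarrow> ennreal"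
    by (subst nn_integral_sum[symmetric], measurable) (intro nn_integral_cong nn_integral_sum, measurable)
  have "(\<Sum>e\<in>UNIV. cell_energy (Suc j) (dyadic_child k e)) + ennreal (((2 ^ j :: real) ^ (CARD('n) - 2)) * (measure M (dyadic_cell j k))\<^sup>2)
    = (\<integral>\<^sup>+x. \<integral>\<^sup>+y. ?K x y * ?s x y + ennreal (((2 ^ j :: real) ^ (CARD('n) - 2))) * ?q j k x y \<partial>M \<partial>M)"
    unfolding cell_energy_def nn_integral_cell_product[symmetric] sum_distrib_left
    by (subst T_add, measurable) (subst T_sum, measurable)
  also have "\<dots> \<le> (\<integral>\<^sup>+x. \<integral>\<^sup>+y. ?K x y * ?q j k x y + ennreal (((2 ^ j :: real) ^ (CARD('n) - 2))) * ?s x y \<partial>M \<partial>M)"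
    by (intro nn_integral_mono pointwise)
  also have "\<dots> = cell_energy j k + (\<Sum>e\<in>UNIV. ennreal (((2 ^ j :: real) ^ (CARD('n) - 2)) * (measure M (dyadic_cell (Suc j) (dyadic_child k e)))\<^sup>2))"
    unfolding cell_energy_def nn_integral_cell_product[symmetric] sum_distrib_left
    by (subst T_add, measurable) (subst T_sum, measurable)
  finally show ?thesis .
qed

definition "cell_mean j k = (\<integral>x. indicator (dyadic_cell j k) x * h x \<partial>M)"

lemma h_integrable: "integrable M h"
proof (rule Bochner_Integration.integrable_bound)
  show "integrable M (\<lambda>x. 1 + (h x)\<^sup>2)" using h_L2 by simp
  have "t \<le> 1 + t\<^sup>2" for t :: real
    using zero_le_power2[of "t - 1/2"] by (simp add: power2_eq_square algebra_simps)
  then show "AE x in M. norm (h x) \<le> norm (1 + (h x)\<^sup>2)" using h_nonneg by (auto intro!: AE_I2)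
qed measurable

lemma cell_integrable: "integrable M f \<Longrightarrow> integrable M (\<lambda>x. indicator (dyadic_cell j k) x * f x)" for f :: "real ^ 'n \<Rightarrow> real"
  using integrable_mult_indicator[of "dyadic_cell j k" M f] by (simp add: sets_M)

lemma cell_integral_children:
  fixes f :: "real ^ 'n \<Rightarrow> real"
  assumes "integrable M f"
  shows "(\<integral>x. indicator (dyadic_cell j k) x * f x \<partial>M)
    = (\<Sum>e\<in>UNIV. \<integral>x. indicator (dyadic_cell (Suc j) (dyadic_child k e)) x * f x \<partial>M)"
proof -
  have "indicator (dyadic_cell j k) x * f x = (\<Sum>e\<in>UNIV. indicator (dyadic_cell (Suc j) (dyadic_child k e)) x * f x)" for x
    using sum_indicator_dyadic_child[of "\<lambda>_. 1 :: real" j k x] by (simp add: sum_distrib_right[symmetric])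
  then have eq: "(\<lambda>x. indicator (dyadic_cell j k) x * f x)
    = (\<lambda>x. \<Sum>e\<in>UNIV. indicator (dyadic_cell (Suc j) (dyadic_child k e)) x * f x)" by blast
  show ?thesis
    unfolding eq by (rule Bochner_Integration.integral_sum) (rule cell_integrable[OF assms])
qed

lemma dyadic_embedding:
  "dyadic_sum (\<lambda>j k. ((2 ^ j :: real) ^ (CARD('n) - 2)) * (cell_mean j k)\<^sup>2) N j k
    \<le> 8 * (real CARD('n) ^ (CARD('n) - 2)) * c * (\<integral>x. indicator (dyadic_cell j k) x * (h x)\<^sup>2 \<partial>M)"
proof -
  let ?F = "\<lambda>j k. \<integral>x. indicator (dyadic_cell j k) x * (h x)\<^sup>2 \<partial>M"
  let ?m = "\<lambda>j k. measure M (dyadic_cell j k)"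
  let ?E = "\<lambda>j k. enn2real (cell_energy j k)"
  \<comment> \<open>Doubling \<open>E\<close> and subtracting the top term leaves a superadditive quantity: the off-diagonal part
    of \<open>E\<close> gains the whole top term because the weights at least double from one generation to the next.\<close>
  let ?M = "\<lambda>j k. 2 * ?E j k - ((2 ^ j :: real) ^ (CARD('n) - 2)) * (?m j k)\<^sup>2"
  \<comment> \<open>From ?M \<le> 2 ?E and the testing bound ?E \<le> n^(n-2) c ?m.\<close>
  let ?A = "2 * (real CARD('n) ^ (CARD('n) - 2)) * c"
  have kap: "(real CARD('n) ^ (CARD('n) - 2)) > 0" by simp
  have E: "ennreal (?E j k) = cell_energy j k" for j k
    by (rule ennreal_enn2real) (rule le_less_trans[OF cell_energy_le ennreal_less_top])
  have E_le: "?E j k \<le> (real CARD('n) ^ (CARD('n) - 2)) * c * ?m j k" for j k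
  proof -
    have "ennreal (?E j k) \<le> ennreal ((real CARD('n) ^ (CARD('n) - 2)) * c * ?m j k)"
      unfolding E by (rule cell_energy_le)
    then show ?thesis using c by (subst (asm) ennreal_le_iff) auto
  qed
  have E_ge: "((2 ^ j :: real) ^ (CARD('n) - 2)) * (?m j k)\<^sup>2 \<le> ?E j k" for j k
  proof -
    have "ennreal (((2 ^ j :: real) ^ (CARD('n) - 2)) * (?m j k)\<^sup>2) \<le> ennreal (?E j k)"
      unfolding E by (rule cell_energy_ge)
    then show ?thesis by (subst (asm) ennreal_le_iff) auto
  qed
  have E_children: "(\<Sum>e\<in>UNIV. ?E (Suc j) (dyadic_child k e)) + ((2 ^ j :: real) ^ (CARD('n) - 2)) * (?m j k)\<^sup>2
      \<le> ?E j k + (\<Sum>e\<in>UNIV. ((2 ^ j :: real) ^ (CARD('n) - 2)) * (?m (Suc j) (dyadic_child k e))\<^sup>2)" for j k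
  proof -
    have "ennreal ((\<Sum>e\<in>UNIV. ?E (Suc j) (dyadic_child k e)) + ((2 ^ j :: real) ^ (CARD('n) - 2)) * (?m j k)\<^sup>2)
      \<le> ennreal (?E j k + (\<Sum>e\<in>UNIV. ((2 ^ j :: real) ^ (CARD('n) - 2)) * (?m (Suc j) (dyadic_child k e))\<^sup>2))"
      using cell_energy_children[of j k]
      by (subst (1 2) ennreal_plus) (simp_all add: sum_nonneg E sum_ennreal[symmetric] del: sum_ennreal)
    then show ?thesis
      by (subst (asm) ennreal_le_iff) (auto intro!: add_nonneg_nonneg sum_nonneg)
  qed
  \<comment> \<open>Dimension at least 3 is what makes the weight at least double in each
    generation.\<close>
  have lam_Suc: "2 * ((2 ^ j :: real) ^ (CARD('n) - 2)) \<le> ((2 ^ Suc j :: real) ^ (CARD('n) - 2))" for j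
  proof -
    have "(2::real) ^ 1 \<le> 2 ^ (CARD('n) - 2)" using dim by (intro power_increasing) auto
    then have "2 * ((2 ^ j :: real) ^ (CARD('n) - 2)) \<le> 2 ^ (CARD('n) - 2) * ((2 ^ j :: real) ^ (CARD('n) - 2))" by (intro mult_right_mono) auto
    then show ?thesis by (simp add: power_mult_distrib)
  qed
  have m: "?m j k = (\<integral>x. indicator (dyadic_cell j k) x * 1 \<partial>M)" for j k
    by (simp add: sets_M)
  \<comment> \<open>The choice \<open>t = 0\<close> removes the mass and packing terms and leaves 4
    ?A ?F, hence the factor 8.\<close>
  have "dyadic_sum (\<lambda>j k. ((2 ^ j :: real) ^ (CARD('n) - 2)) * (cell_mean j k)\<^sup>2) N j k
    \<le> 4 * ?A * (?F j k - 2 * 0 * cell_mean j k + 0\<^sup>2 * (?m j k + ?M j k / ?A))"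
  proof (rule dyadic_carleson)
    fix j and k :: "'n \<Rightarrow> int"
    show "?F j k = (\<Sum>e\<in>UNIV. ?F (Suc j) (dyadic_child k e))"
      by (rule cell_integral_children[OF h_L2])
    show "cell_mean j k = (\<Sum>e\<in>UNIV. cell_mean (Suc j) (dyadic_child k e))"
      unfolding cell_mean_def by (rule cell_integral_children[OF h_integrable])
    show "?m j k = (\<Sum>e\<in>UNIV. ?m (Suc j) (dyadic_child k e))"
      unfolding m by (rule cell_integral_children) simp
    have "(\<Sum>e\<in>UNIV. ?M (Suc j) (dyadic_child k e))
      = 2 * (\<Sum>e\<in>UNIV. ?E (Suc j) (dyadic_child k e)) - (\<Sum>e\<in>UNIV. ((2 ^ Suc j :: real) ^ (CARD('n) - 2)) * (?m (Suc j) (dyadic_child k e))\<^sup>2)"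
      by (simp add: sum_subtractf sum_distrib_left)
    also have "\<dots> \<le> 2 * (\<Sum>e\<in>UNIV. ?E (Suc j) (dyadic_child k e)) - (\<Sum>e\<in>UNIV. 2 * ((2 ^ j :: real) ^ (CARD('n) - 2)) * (?m (Suc j) (dyadic_child k e))\<^sup>2)"
      by (intro diff_left_mono sum_mono mult_right_mono lam_Suc) simp
    also have "\<dots> = 2 * (\<Sum>e\<in>UNIV. ?E (Suc j) (dyadic_child k e)) - 2 * (\<Sum>e\<in>UNIV. ((2 ^ j :: real) ^ (CARD('n) - 2)) * (?m (Suc j) (dyadic_child k e))\<^sup>2)"
      by (simp add: sum_distrib_left mult.assoc)
    finally show "((2 ^ j :: real) ^ (CARD('n) - 2)) * (?m j k)\<^sup>2 + (\<Sum>e\<in>UNIV. ?M (Suc j) (dyadic_child k e)) \<le> ?M j k"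
      using E_children[of j k] by linarith
    have "0 \<le> ((2 ^ j :: real) ^ (CARD('n) - 2)) * (?m j k)\<^sup>2" by simp
    then show "0 \<le> ?M j k" "?M j k \<le> ?A * ?m j k"
      using E_ge[of j k] E_le[of j k] by linarith+
    \<comment> \<open>Cauchy-Schwarz in quadratic form: expand the integral of (h - t)^2 over the
      cell.\<close>
    show "0 \<le> ?F j k - 2 * t * cell_mean j k + t\<^sup>2 * ?m j k" for t
    proof -
      have "0 \<le> (\<integral>x. indicator (dyadic_cell j k) x * (h x - t)\<^sup>2 \<partial>M)"
        by (intro Bochner_Integration.integral_nonneg) simp
      also have "\<dots> = (\<integral>x. indicator (dyadic_cell j k) x * (h x)\<^sup>2 - 2 * t * (indicator (dyadic_cell j k) x * h x)
          + t\<^sup>2 * (indicator (dyadic_cell j k) x * 1) \<partial>M)"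
        by (intro Bochner_Integration.integral_cong refl) (simp add: power2_eq_square algebra_simps)
      also have "\<dots> = ?F j k - 2 * t * cell_mean j k + t\<^sup>2 * ?m j k"
        unfolding m cell_mean_def
        using cell_integrable[OF h_L2] cell_integrable[OF h_integrable] cell_integrable[of "\<lambda>_. 1"]
        by (subst Bochner_Integration.integral_add Bochner_Integration.integral_diff; simp)+
      finally show ?thesis .
    qed
    show "0 \<le> ?m j k" "0 \<le> ((2 ^ j :: real) ^ (CARD('n) - 2))" by simp_all
    show "?A > 0" using c by simp
  qed
  then show ?thesis by simp
qed

end

section \<open>From square sums over cells to the full energy\<close>

context dyadic_energy
begin

lemma nn_integral_h_cell: "(\<integral>\<^sup>+y. ennreal (h y) * indicator (dyadic_cell j k) y \<partial>M) = ennreal (cell_mean j k)"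
proof -
  have "(\<integral>\<^sup>+y. ennreal (h y) * indicator (dyadic_cell j k) y \<partial>M) = (\<integral>\<^sup>+y. ennreal (indicator (dyadic_cell j k) y * h y) \<partial>M)"
    by (intro nn_integral_cong) (auto simp: indicator_def)
  also have "\<dots> = ennreal (cell_mean j k)"
    unfolding cell_mean_def using h_nonneg
    by (intro nn_integral_eq_integral cell_integrable h_integrable) auto
  finally show ?thesis .
qed

lemma cell_mean_nonneg: "0 \<le> cell_mean j k"
  unfolding cell_mean_def using h_nonneg by (intro Bochner_Integration.integral_nonneg) auto

lemma index_measurable_M[measurable]: "dyadic_index j \<in> M \<rightarrow>\<^sub>M count_space UNIV"
  using dyadic_index_measurable by (simp cong: measurable_cong_sets add: sets_M)

text \<open>Translation by \<tau> permutes the cells of a generation, so after ab \<le> a^2 + b^2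
  the shifted and unshifted sums of squares are equal.\<close>

lemma neighbour_interaction:
  "(\<integral>\<^sup>+x. ennreal (h x) * ennreal (cell_mean j (\<lambda>i. dyadic_index j x i + \<tau> i)) \<partial>M)
    \<le> 2 * (\<integral>\<^sup>+k. ennreal ((cell_mean j k)\<^sup>2) \<partial>count_space UNIV)"
proof -
  let ?s = "\<lambda>k :: 'n \<Rightarrow> int. \<lambda>i. k i + \<tau> i"
  have "(\<integral>\<^sup>+x. ennreal (h x) * ennreal (cell_mean j (?s (dyadic_index j x))) \<partial>M)
    = (\<integral>\<^sup>+k. ennreal (cell_mean j (?s k)) * (\<integral>\<^sup>+x. ennreal (h x) * indicator {x. dyadic_index j x = k} x \<partial>M) \<partial>count_space UNIV)"
    by (rule nn_integral_fibres[where G="\<lambda>k. ennreal (cell_mean j (?s k))"]) (unfold_locales, measurable)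
  also have "\<dots> = (\<integral>\<^sup>+k. ennreal (cell_mean j (?s k)) * ennreal (cell_mean j k) \<partial>count_space UNIV)"
    using nn_integral_h_cell[of j] by (simp add: dyadic_cell_def)
  also have "\<dots> \<le> (\<integral>\<^sup>+k. ennreal ((cell_mean j (?s k))\<^sup>2) + ennreal ((cell_mean j k)\<^sup>2) \<partial>count_space UNIV)"
  proof (rule nn_integral_mono)
    fix k
    let ?a = "cell_mean j (?s k)" and ?b = "cell_mean j k"
    have "?a * ?b \<le> ?a\<^sup>2 + ?b\<^sup>2"
      using sum_squares_bound[of ?a ?b] cell_mean_nonneg[of j k] cell_mean_nonneg[of j "?s k"] mult_nonneg_nonneg[of ?a ?b]
      by linarith
    then show "ennreal ?a * ennreal ?b \<le> ennreal (?a\<^sup>2) + ennreal (?b\<^sup>2)"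
      using cell_mean_nonneg by (simp add: ennreal_mult[symmetric] ennreal_plus[symmetric] ennreal_leI del: ennreal_plus)
  qed
  also have "\<dots> = (\<integral>\<^sup>+k. ennreal ((cell_mean j (?s k))\<^sup>2) \<partial>count_space UNIV) + (\<integral>\<^sup>+k. ennreal ((cell_mean j k)\<^sup>2) \<partial>count_space UNIV)"
    by (rule nn_integral_add) auto
  also have "(\<integral>\<^sup>+k. ennreal ((cell_mean j (?s k))\<^sup>2) \<partial>count_space UNIV) = (\<integral>\<^sup>+k. ennreal ((cell_mean j k)\<^sup>2) \<partial>count_space UNIV)"
  proof (rule nn_integral_bij_count_space)
    show "bij ?s"
      by (rule bij_betw_byWitness[where f'="\<lambda>k i. k i - \<tau> i"]) auto
  qed
  finally show ?thesis by (simp add: mult_2)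
qed

text \<open>The embedding is applied to the trees rooted at generation 0, whose shares of the
  integral of h^2 add up to the whole. The bound does not depend on the depth \<open>N\<close>, so
  it passes to the infinite sum.\<close>

lemma dyadic_square_sum:
  "(\<Sum>j. ennreal ((2 ^ j) ^ (CARD('n) - 2)) * (\<integral>\<^sup>+k. ennreal ((cell_mean j k)\<^sup>2) \<partial>count_space UNIV))
    \<le> ennreal (8 * real CARD('n) ^ (CARD('n) - 2) * c) * (\<integral>\<^sup>+x. ennreal ((h x)\<^sup>2) \<partial>M)"
  (is "(\<Sum>j. ?T j) \<le> ennreal ?C * _")
proof -
  have "(\<Sum>j<N. ?T j) \<le> ennreal ?C * (\<integral>\<^sup>+x. ennreal ((h x)\<^sup>2) \<partial>M)" for N
  proof -
    let ?\<alpha> = "\<lambda>j k. (2 ^ j) ^ (CARD('n) - 2) * (cell_mean j k)\<^sup>2"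
    have "(\<Sum>j<N. ?T j) = (\<Sum>j<N. \<integral>\<^sup>+k. ennreal (?\<alpha> (0 + j) k) \<partial>count_space UNIV)"
      by (intro sum.cong refl) (simp add: nn_integral_cmult[symmetric] ennreal_mult)
    also have "\<dots> = (\<integral>\<^sup>+k. ennreal (dyadic_sum ?\<alpha> N 0 k) \<partial>count_space UNIV)"
      by (rule nn_integral_dyadic_sum[symmetric]) simp
    also have "\<dots> \<le> (\<integral>\<^sup>+k. ennreal ?C * (\<integral>\<^sup>+x. ennreal ((h x)\<^sup>2) * indicator {x. dyadic_index 0 x = k} x \<partial>M) \<partial>count_space UNIV)"
    proof (rule nn_integral_mono)
      fix k
      have "(\<integral>\<^sup>+x. ennreal ((h x)\<^sup>2) * indicator {x. dyadic_index 0 x = k} x \<partial>M)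
        = (\<integral>\<^sup>+x. ennreal (indicator (dyadic_cell 0 k) x * (h x)\<^sup>2) \<partial>M)"
        by (intro nn_integral_cong) (auto simp: indicator_def dyadic_cell_def)
      also have "\<dots> = ennreal (\<integral>x. indicator (dyadic_cell 0 k) x * (h x)\<^sup>2 \<partial>M)"
        by (intro nn_integral_eq_integral cell_integrable h_L2) auto
      finally show "ennreal (dyadic_sum ?\<alpha> N 0 k) \<le> ennreal ?C * (\<integral>\<^sup>+x. ennreal ((h x)\<^sup>2) * indicator {x. dyadic_index 0 x = k} x \<partial>M)"
        using dyadic_embedding[of N 0 k] c by (simp add: ennreal_mult[symmetric] ennreal_leI)
    qed
    also have "\<dots> = (\<integral>\<^sup>+x. ennreal ((h x)\<^sup>2) * ennreal ?C \<partial>M)"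
      by (rule nn_integral_fibres[where G="\<lambda>k. ennreal ?C", symmetric]) (unfold_locales, measurable)
    also have "\<dots> = ennreal ?C * (\<integral>\<^sup>+x. ennreal ((h x)\<^sup>2) \<partial>M)"
      by (subst nn_integral_multc) (auto simp: mult.commute)
    finally show ?thesis .
  qed
  then show ?thesis unfolding suminf_eq_SUP by (intro SUP_least)
qed

text \<open>Three losses make up the constant: 2^(n-2) from the dyadic majorant of the kernel, twice
  the number of offsets from splitting interactions into squares, and 8 n^(n-2) c from the
  embedding.\<close>

lemma energy_bound:
  "(\<integral>\<^sup>+x. \<integral>\<^sup>+y. ennreal (newton_kernel (x - y)) * (ennreal (h x) * ennreal (h y)) \<partial>M \<partial>M)
    \<le> ennreal (16 * 2 ^ (CARD('n) - 2) * real (card (neighbour_offsets :: ('n \<Rightarrow> int) set)) * real CARD('n) ^ (CARD('n) - 2) * c)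
      * (\<integral>\<^sup>+x. ennreal ((h x)\<^sup>2) \<partial>M)"
proof -
  let ?O = "neighbour_offsets :: ('n \<Rightarrow> int) set"
  let ?l = "\<lambda>j::nat. ennreal ((2 ^ j) ^ (CARD('n) - 2))"
  let ?C = "ennreal (2 ^ (CARD('n) - 2))"
  let ?s = "\<lambda>\<tau> j x i. dyadic_index j x i + \<tau> i"
  let ?T = "\<lambda>j. \<integral>\<^sup>+k. ennreal ((cell_mean j k)\<^sup>2) \<partial>count_space UNIV"
  have meas[measurable]: "(\<lambda>x. ennreal (cell_mean j (?s \<tau> j x))) \<in> borel_measurable M" for j \<tau>
    by (rule measurable_compose[OF index_measurable_M, where g="\<lambda>k. ennreal (cell_mean j (\<lambda>i. k i + \<tau> i))"]) simp
  have inner: "(\<integral>\<^sup>+y. ennreal (newton_kernel (x - y)) * (ennreal (h x) * ennreal (h y)) \<partial>M)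
      \<le> ?C * (\<Sum>j. ?l j * (\<Sum>\<tau>\<in>?O. ennreal (h x) * ennreal (cell_mean j (?s \<tau> j x))))" for x
  proof -
    have "(\<integral>\<^sup>+y. ennreal (newton_kernel (x - y)) * (ennreal (h x) * ennreal (h y)) \<partial>M)
      \<le> (\<integral>\<^sup>+y. ?C * (\<Sum>j. ?l j * (\<Sum>\<tau>\<in>?O. ennreal (h x) * (ennreal (h y) * indicator (dyadic_cell j (?s \<tau> j x)) y))) \<partial>M)"
    proof (rule nn_integral_mono)
      fix y
      show "ennreal (newton_kernel (x - y)) * (ennreal (h x) * ennreal (h y))
        \<le> ?C * (\<Sum>j. ?l j * (\<Sum>\<tau>\<in>?O. ennreal (h x) * (ennreal (h y) * indicator (dyadic_cell j (?s \<tau> j x)) y)))"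
      proof (cases "h x = 0 \<or> h y = 0")
        case False
        then have "norm (x - y) < 1" using h_supp by blast
        then have "ennreal (newton_kernel (x - y)) * (ennreal (h x) * ennreal (h y))
          \<le> (?C * (\<Sum>j. ?l j * (\<Sum>\<tau>\<in>?O. indicator (dyadic_cell j (?s \<tau> j x)) y))) * (ennreal (h x) * ennreal (h y))"
          by (intro mult_right_mono dyadic_newton_kernel_upper dim) auto
        also have "\<dots> = ?C * (\<Sum>j. ?l j * (\<Sum>\<tau>\<in>?O. ennreal (h x) * (ennreal (h y) * indicator (dyadic_cell j (?s \<tau> j x)) y)))"
          unfolding mult.assoc
          by (subst ennreal_suminf_multc[symmetric]) (simp add: sum_distrib_left sum_distrib_right mult_ac)
        finally show ?thesis .
      qed auto
    qed
    also have "\<dots> = ?C * (\<Sum>j. ?l j * (\<Sum>\<tau>\<in>?O. ennreal (h x) * (\<integral>\<^sup>+y. ennreal (h y) * indicator (dyadic_cell j (?s \<tau> j x)) y \<partial>M)))"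
      by (simp add: nn_integral_cmult nn_integral_suminf nn_integral_sum)
    also have "\<dots> = ?C * (\<Sum>j. ?l j * (\<Sum>\<tau>\<in>?O. ennreal (h x) * ennreal (cell_mean j (?s \<tau> j x))))"
      unfolding nn_integral_h_cell ..
    finally show ?thesis .
  qed
  have "(\<integral>\<^sup>+x. \<integral>\<^sup>+y. ennreal (newton_kernel (x - y)) * (ennreal (h x) * ennreal (h y)) \<partial>M \<partial>M)
    \<le> (\<integral>\<^sup>+x. ?C * (\<Sum>j. ?l j * (\<Sum>\<tau>\<in>?O. ennreal (h x) * ennreal (cell_mean j (?s \<tau> j x)))) \<partial>M)"
    by (intro nn_integral_mono inner)
  also have "\<dots> = ?C * (\<Sum>j. ?l j * (\<Sum>\<tau>\<in>?O. \<integral>\<^sup>+x. ennreal (h x) * ennreal (cell_mean j (?s \<tau> j x)) \<partial>M))"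
    by (simp add: nn_integral_cmult nn_integral_suminf nn_integral_sum)
  also have "\<dots> \<le> ?C * (\<Sum>j. ?l j * (\<Sum>\<tau>\<in>?O. 2 * ?T j))"
    by (intro mult_left_mono suminf_le sum_mono neighbour_interaction) auto
  also have "\<dots> = ?C * (\<Sum>j. ennreal (2 * real (card ?O)) * (?l j * ?T j))"
    by (simp add: mult_ac ennreal_mult ennreal_of_nat_eq_real_of_nat)
  also have "\<dots> = ?C * (ennreal (2 * real (card ?O)) * (\<Sum>j. ?l j * ?T j))"
    by (subst ennreal_suminf_cmult) auto
  also have "\<dots> \<le> ?C * (ennreal (2 * real (card ?O)) * (ennreal (8 * real CARD('n) ^ (CARD('n) - 2) * c) * (\<integral>\<^sup>+x. ennreal ((h x)\<^sup>2) \<partial>M)))"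
    by (intro mult_left_mono dyadic_square_sum) auto
  also have "\<dots> = (?C * (ennreal (2 * real (card ?O)) * ennreal (8 * real CARD('n) ^ (CARD('n) - 2) * c))) * (\<integral>\<^sup>+x. ennreal ((h x)\<^sup>2) \<partial>M)"
    by (simp only: mult.assoc)
  also have "?C * (ennreal (2 * real (card ?O)) * ennreal (8 * real CARD('n) ^ (CARD('n) - 2) * c))
    = ennreal (2 ^ (CARD('n) - 2) * ((2 * real (card ?O)) * (8 * real CARD('n) ^ (CARD('n) - 2) * c)))"
  proof -
    have "ennreal p * (ennreal q * ennreal r) = ennreal (p * (q * r))" if "0 \<le> p" "0 \<le> q" "0 \<le> r" for p q r
      using that by (simp add: ennreal_mult)
    then show ?thesis using c by simp
  qed
  also have "2 ^ (CARD('n) - 2) * ((2 * real (card ?O)) * (8 * real CARD('n) ^ (CARD('n) - 2) * c))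
    = 16 * 2 ^ (CARD('n) - 2) * real (card ?O) * real CARD('n) ^ (CARD('n) - 2) * c"
    by simp
  finally show ?thesis .
qed

end

subsection \<open>Vanishing under the two smallness conditions\<close>

lemma newton_potential_ball_bound:
  fixes y a :: "real ^ 'n"
  assumes "r \<le> 1/2" "y \<in> ball a r"
  shows "(\<integral>\<^sup>+x\<in>ball a r. ennreal (newton_kernel (y - x)) \<partial>lborel) \<le> (\<integral>\<^sup>+z\<in>ball 0 1. ennreal (newton_kernel (z :: real ^ 'n)) \<partial>lborel)"
proof -
  have [measurable]: "ball (0 :: real ^ 'n) 1 \<in> sets borel" by simp
  have m: "(\<lambda>x. ennreal (newton_kernel (x - y)) * indicator (ball 0 1) (x - y)) \<in> borel_measurable borel"
    by measurable
  have "(\<integral>\<^sup>+z\<in>ball 0 1. ennreal (newton_kernel (z :: real ^ 'n)) \<partial>lborel)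
    = (\<integral>\<^sup>+x. ennreal (newton_kernel (x - y)) * indicator (ball 0 1) (x - y) \<partial>lborel)"
    using nn_integral_affine[OF m, of 1 y] by simp
  moreover have "(\<integral>\<^sup>+x\<in>ball a r. ennreal (newton_kernel (y - x)) \<partial>lborel)
    \<le> (\<integral>\<^sup>+x. ennreal (newton_kernel (x - y)) * indicator (ball 0 1) (x - y) \<partial>lborel)"
  proof (rule nn_integral_mono)
    fix x
    have "x - y \<in> ball 0 1" if "x \<in> ball a r"
    proof -
      have "dist x y < r + r" using that assms(2) dist_triangle_less_add[of x a r y r] by (simp add: dist_commute)
      then show ?thesis using assms(1) by (simp add: dist_norm norm_minus_commute)
    qed
    then show "ennreal (newton_kernel (y - x)) * indicator (ball a r) x \<le> ennreal (newton_kernel (x - y)) * indicator (ball 0 1) (x - y)"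
      by (auto simp: indicator_def newton_kernel_minus_commute[of y x])
  qed
  ultimately show ?thesis by simp
qed

text \<open>A Schur test: f(x) f(y) is at most f(x)^2 + f(y)^2, and integrating the kernel in the
  other variable over a ball of radius at most 1/2 gives at most its integral over the unit ball.
  Only finiteness is wanted, so no care is taken with constants.\<close>

lemma newton_energy_finite:
  fixes f :: "real ^ 'n \<Rightarrow> real"
  assumes N: "CARD('n) \<ge> 3" and [measurable]: "f \<in> borel_measurable borel" and f0: "\<And>x. 0 \<le> f x"
    and supp: "\<And>x. x \<notin> ball a r \<Longrightarrow> f x = 0" and r: "r \<le> 1/2"
    and f2: "(\<integral>\<^sup>+x. ennreal ((f x)\<^sup>2) \<partial>lborel) < \<infinity>"
  shows "(\<integral>\<^sup>+x. \<integral>\<^sup>+y. ennreal (newton_kernel (y - x)) * (ennreal (f x) * ennreal (f y)) \<partial>lborel \<partial>lborel) < \<infinity>"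
proof -
  let ?K = "\<integral>\<^sup>+z\<in>ball 0 1. ennreal (newton_kernel (z :: real ^ 'n)) \<partial>lborel"
  let ?k = "\<lambda>x y. ennreal (newton_kernel (y - x))"
  let ?B = "indicator (ball a r) :: real ^ 'n \<Rightarrow> ennreal"
  have [measurable]: "ball a r \<in> sets borel" by simp
  have half: "(\<integral>\<^sup>+x. \<integral>\<^sup>+y. ?k x y * (ennreal ((f x)\<^sup>2) * ?B y) \<partial>lborel \<partial>lborel) \<le> ?K * (\<integral>\<^sup>+x. ennreal ((f x)\<^sup>2) \<partial>lborel)"
  proof -
    have "(\<integral>\<^sup>+x. \<integral>\<^sup>+y. ?k x y * (ennreal ((f x)\<^sup>2) * ?B y) \<partial>lborel \<partial>lborel)
      = (\<integral>\<^sup>+x. ennreal ((f x)\<^sup>2) * (\<integral>\<^sup>+y\<in>ball a r. ?k x y \<partial>lborel) \<partial>lborel)"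
      by (subst nn_integral_cmult[symmetric]) (auto simp: mult_ac)
    also have "\<dots> \<le> (\<integral>\<^sup>+x. ennreal ((f x)\<^sup>2) * ?K \<partial>lborel)"
    proof (rule nn_integral_mono)
      fix x
      show "ennreal ((f x)\<^sup>2) * (\<integral>\<^sup>+y\<in>ball a r. ?k x y \<partial>lborel) \<le> ennreal ((f x)\<^sup>2) * ?K"
      proof (cases "x \<in> ball a r")
        case True
        show ?thesis
          using newton_potential_ball_bound[OF r True] by (intro mult_left_mono) (simp_all add: newton_kernel_minus_commute[of x])
      qed (simp add: supp)
    qed
    also have "\<dots> = ?K * (\<integral>\<^sup>+x. ennreal ((f x)\<^sup>2) \<partial>lborel)"
      by (subst nn_integral_multc) (auto simp: mult.commute)
    finally show ?thesis .
  qed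
  have "(\<integral>\<^sup>+x. \<integral>\<^sup>+y. ?k x y * (ennreal (f x) * ennreal (f y)) \<partial>lborel \<partial>lborel)
    \<le> (\<integral>\<^sup>+x. \<integral>\<^sup>+y. ?k x y * (ennreal ((f x)\<^sup>2) * ?B y) + ?k x y * (ennreal ((f y)\<^sup>2) * ?B x) \<partial>lborel \<partial>lborel)"
  proof (intro nn_integral_mono)
    fix x y
    show "?k x y * (ennreal (f x) * ennreal (f y)) \<le> ?k x y * (ennreal ((f x)\<^sup>2) * ?B y) + ?k x y * (ennreal ((f y)\<^sup>2) * ?B x)"
    proof (cases "x \<in> ball a r \<and> y \<in> ball a r")
      case True
      have "f x * f y \<le> (f x)\<^sup>2 + (f y)\<^sup>2"
        using sum_squares_bound[of "f x" "f y"] mult_nonneg_nonneg[OF f0[of x] f0[of y]] by linarith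
      then have "ennreal (f x) * ennreal (f y) \<le> ennreal ((f x)\<^sup>2) + ennreal ((f y)\<^sup>2)"
        using f0 by (simp add: ennreal_mult[symmetric] ennreal_plus[symmetric] ennreal_leI del: ennreal_plus)
      then have "?k x y * (ennreal (f x) * ennreal (f y)) \<le> ?k x y * (ennreal ((f x)\<^sup>2) + ennreal ((f y)\<^sup>2))"
        by (rule mult_left_mono) simp
      with True show ?thesis by (simp add: distrib_left)
    next
      case False
      then have "f x = 0 \<or> f y = 0" using supp by blast
      then show ?thesis by auto
    qed
  qed
  also have "\<dots> = (\<integral>\<^sup>+x. \<integral>\<^sup>+y. ?k x y * (ennreal ((f x)\<^sup>2) * ?B y) \<partial>lborel \<partial>lborel)
      + (\<integral>\<^sup>+x. \<integral>\<^sup>+y. ?k x y * (ennreal ((f y)\<^sup>2) * ?B x) \<partial>lborel \<partial>lborel)"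
    by (subst nn_integral_add[symmetric], measurable) (intro nn_integral_cong nn_integral_add, measurable)
  also have "(\<integral>\<^sup>+x. \<integral>\<^sup>+y. ?k x y * (ennreal ((f y)\<^sup>2) * ?B x) \<partial>lborel \<partial>lborel)
      = (\<integral>\<^sup>+y. \<integral>\<^sup>+x. ?k y x * (ennreal ((f y)\<^sup>2) * ?B x) \<partial>lborel \<partial>lborel)"
    by (subst lborel_pair.Fubini') (simp_all add: newton_kernel_minus_commute)
  also have "(\<integral>\<^sup>+x. \<integral>\<^sup>+y. ?k x y * (ennreal ((f x)\<^sup>2) * ?B y) \<partial>lborel \<partial>lborel)
      + (\<integral>\<^sup>+y. \<integral>\<^sup>+x. ?k y x * (ennreal ((f y)\<^sup>2) * ?B x) \<partial>lborel \<partial>lborel)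
      \<le> ?K * (\<integral>\<^sup>+x. ennreal ((f x)\<^sup>2) \<partial>lborel) + ?K * (\<integral>\<^sup>+x. ennreal ((f x)\<^sup>2) \<partial>lborel)"
    by (intro add_mono half)
  also have "\<dots> < \<infinity>"
    using f2 newton_kernel_integrable_unit_ball[OF N] by (simp add: ennreal_mult_less_top)
  finally show ?thesis .
qed

text \<open>The density \<open>f\<close> charges only points \<open>y\<close> of
  \<open>ball a r\<close>, and for these \<open>ball a r\<close> lies in
  \<open>ball y (2 * r)\<close>. The Kato bound centred at \<open>y\<close> then gains the factor
  1/2.\<close>

lemma kato_vanishing:
  fixes f q v :: "real ^ 'n \<Rightarrow> real"
  assumes [measurable]: "f \<in> borel_measurable borel" "q \<in> borel_measurable borel" "v \<in> borel_measurable borel"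
    and nonneg: "\<And>x. 0 \<le> f x" "\<And>x. 0 \<le> q x" "\<And>x. 0 \<le> v x"
    and supp: "\<And>x. x \<notin> ball a r \<Longrightarrow> f x = 0"
    and fvq: "AE x in lborel. f x \<le> v x * q x"
    and m: "m > 0" and pot: "AE x in lborel. ennreal (m * q x) \<le> (\<integral>\<^sup>+y. ennreal (newton_kernel (y - x)) * ennreal (f y) \<partial>lborel)"
    and f1: "(\<integral>\<^sup>+x. ennreal (f x) \<partial>lborel) < \<infinity>"
    and kato: "\<And>y. (\<integral>\<^sup>+x\<in>ball y (2 * r). ennreal (v x * newton_kernel (y - x)) \<partial>lborel) \<le> ennreal (m / 2)"
  shows "AE x in lborel. f x = 0"
proof -
  let ?I = "\<integral>\<^sup>+x. ennreal (f x) \<partial>lborel"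
  have [measurable]: "ball y s \<in> sets borel" for y :: "real ^ 'n" and s by simp
  have "ennreal m * ?I = (\<integral>\<^sup>+x. ennreal m * ennreal (f x) \<partial>lborel)"
    by (simp add: nn_integral_cmult)
  also have "\<dots> \<le> (\<integral>\<^sup>+x. \<integral>\<^sup>+y. ennreal (v x) * indicator (ball a r) x * (ennreal (newton_kernel (y - x)) * ennreal (f y)) \<partial>lborel \<partial>lborel)"
  proof (rule nn_integral_mono_AE)
    show "AE x in lborel. ennreal m * ennreal (f x) \<le> (\<integral>\<^sup>+y. ennreal (v x) * indicator (ball a r) x * (ennreal (newton_kernel (y - x)) * ennreal (f y)) \<partial>lborel)"
      using fvq pot
    proof eventually_elim
      case (elim x)
      show ?case
      proof (cases "x \<in> ball a r")
        case True
        have "m * f x \<le> v x * (m * q x)" using mult_left_mono[OF elim(1), of m] m by (simp add: mult_ac)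
        then have "ennreal m * ennreal (f x) \<le> ennreal (v x) * ennreal (m * q x)"
          using nonneg m by (simp add: ennreal_mult[symmetric] ennreal_leI)
        also have "\<dots> \<le> ennreal (v x) * (\<integral>\<^sup>+y. ennreal (newton_kernel (y - x)) * ennreal (f y) \<partial>lborel)"
          by (intro mult_left_mono elim) simp
        also have "\<dots> = (\<integral>\<^sup>+y. ennreal (v x) * (ennreal (newton_kernel (y - x)) * ennreal (f y)) \<partial>lborel)"
          by (rule nn_integral_cmult[symmetric]) measurable
        finally show ?thesis using True by simp
      qed (simp add: supp)
    qed
  qed
  also have "\<dots> = (\<integral>\<^sup>+y. \<integral>\<^sup>+x. ennreal (v x) * indicator (ball a r) x * (ennreal (newton_kernel (y - x)) * ennreal (f y)) \<partial>lborel \<partial>lborel)"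
    by (rule lborel_pair.Fubini') measurable
  also have "\<dots> \<le> (\<integral>\<^sup>+y. ennreal (f y) * ennreal (m / 2) \<partial>lborel)"
  proof (rule nn_integral_mono)
    fix y
    show "(\<integral>\<^sup>+x. ennreal (v x) * indicator (ball a r) x * (ennreal (newton_kernel (y - x)) * ennreal (f y)) \<partial>lborel) \<le> ennreal (f y) * ennreal (m / 2)"
    proof (cases "y \<in> ball a r")
      case True
      have "(\<integral>\<^sup>+x. ennreal (v x) * indicator (ball a r) x * (ennreal (newton_kernel (y - x)) * ennreal (f y)) \<partial>lborel)
        \<le> (\<integral>\<^sup>+x. ennreal (f y) * (ennreal (v x * newton_kernel (y - x)) * indicator (ball y (2 * r)) x) \<partial>lborel)"
      proof (rule nn_integral_mono)
        fix x
        have "x \<in> ball y (2 * r)" if "x \<in> ball a r"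
          using that True dist_triangle_less_add[of y a r x r] by (simp add: dist_commute)
        then show "ennreal (v x) * indicator (ball a r) x * (ennreal (newton_kernel (y - x)) * ennreal (f y))
          \<le> ennreal (f y) * (ennreal (v x * newton_kernel (y - x)) * indicator (ball y (2 * r)) x)"
          using nonneg newton_kernel_nonneg[of "y - x"] by (auto simp: indicator_def ennreal_mult mult_ac)
      qed
      also have "\<dots> = ennreal (f y) * (\<integral>\<^sup>+x\<in>ball y (2 * r). ennreal (v x * newton_kernel (y - x)) \<partial>lborel)"
        by (rule nn_integral_cmult) measurable
      also have "\<dots> \<le> ennreal (f y) * ennreal (m / 2)" by (intro mult_left_mono kato) simp
      finally show ?thesis .
    qed (simp add: supp)
  qed
  also have "\<dots> = ennreal (m / 2) * ?I" by (subst nn_integral_multc) (auto simp: mult.commute)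
  finally have le: "ennreal m * ?I \<le> ennreal (m / 2) * ?I" .
  \<comment> \<open>Finiteness of the integral turns the inequality in \<open>ennreal\<close> into
    one between reals, where it forces 0.\<close>
  obtain I where I: "?I = ennreal I" "I \<ge> 0" using f1 by (cases ?I) auto
  have "m * I \<le> m / 2 * I"
    using le m I(2) unfolding I(1) by (simp add: ennreal_mult[symmetric] ennreal_le_iff del: ennreal_le_iff2)
  then have "I = 0" using m I(2) by (simp add: mult_le_cancel_right)
  then have "?I = 0" using I by simp
  then have "AE x in lborel. ennreal (f x) = 0" by (subst (asm) nn_integral_0_iff_AE) auto
  then show ?thesis by eventually_elim (use nonneg in \<open>simp add: ennreal_eq_0_iff order_antisym\<close>)
qed

text \<open>Absorption: if H is the integral of h^2 against v, then m H \<le> E \<le> C H with C < m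
  and H finite, so H = 0. Hence v h, and with it f, vanishes almost everywhere.\<close>

lemma kerman_sawyer_vanishing:
  fixes f q v :: "real ^ 'n \<Rightarrow> real"
  assumes N: "CARD('n) \<ge> 3"
    and [measurable]: "f \<in> borel_measurable borel" "q \<in> borel_measurable borel" "v \<in> borel_measurable borel"
    and nonneg: "\<And>x. 0 \<le> f x" "\<And>x. 0 \<le> q x" "\<And>x. 0 \<le> v x"
    and r: "r \<le> 1/2" and supp: "\<And>x. x \<notin> ball a r \<Longrightarrow> f x = 0" "\<And>x. x \<notin> ball a r \<Longrightarrow> v x = 0"
    and fvq: "AE x in lborel. f x \<le> v x * q x"
    and m: "m > 0" and pot: "AE x in lborel. ennreal (m * q x) \<le> (\<integral>\<^sup>+y. ennreal (newton_kernel (y - x)) * ennreal (f y) \<partial>lborel)"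
    and f2: "(\<integral>\<^sup>+x. ennreal ((f x)\<^sup>2) \<partial>lborel) < \<infinity>"
    and v1: "(\<integral>\<^sup>+x. ennreal (v x) \<partial>lborel) < \<infinity>"
    and c: "c > 0"
    and small: "16 * 2 ^ (CARD('n) - 2) * real (card (neighbour_offsets :: ('n \<Rightarrow> int) set)) * real CARD('n) ^ (CARD('n) - 2) * c < m"
    and testing: "\<And>j k. (\<integral>\<^sup>+x\<in>dyadic_cell j k. (\<integral>\<^sup>+y\<in>dyadic_cell j k. ennreal (v x * v y * newton_kernel (x - y)) \<partial>lborel) \<partial>lborel)
      \<le> ennreal c * (\<integral>\<^sup>+x\<in>dyadic_cell j k. ennreal (v x) \<partial>lborel)"
  shows "AE x in lborel. f x = 0"
proof -
  \<comment> \<open>Where v = 0 the inequality f \<le> v q gives f = 0 almost everywhere, so the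
    value 0 keeps f = v h there.\<close>
  define h where "h x = (if v x = 0 then 0 else f x / v x)" for x
  have h[measurable]: "h \<in> borel_measurable borel" unfolding h_def[abs_def] by measurable
  have h0: "0 \<le> h x" for x using nonneg by (simp add: h_def)
  have h_ball: "x \<in> ball a r" if "h x \<noteq> 0" for x using that supp(2)[of x] by (auto simp: h_def split: if_splits)
  have f_eq: "AE x in lborel. f x = v x * h x"
    using fvq by eventually_elim (use nonneg in \<open>auto simp: h_def order_antisym\<close>)
  define M where "M = density lborel (\<lambda>x. ennreal (v x))"
  have sets_M[measurable_cong]: "sets M = sets borel" by (simp add: M_def)
  have nnM: "(\<integral>\<^sup>+x. g x \<partial>M) = (\<integral>\<^sup>+x. ennreal (v x) * g x \<partial>lborel)" if "g \<in> borel_measurable borel" for g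
    unfolding M_def using that by (intro nn_integral_density) auto
  let ?k = "\<lambda>x y. ennreal (newton_kernel (x - y))"
  let ?H = "\<integral>\<^sup>+x. ennreal ((h x)\<^sup>2) \<partial>M"
  let ?E = "\<integral>\<^sup>+x. \<integral>\<^sup>+y. ?k x y * (ennreal (h x) * ennreal (h y)) \<partial>M \<partial>M"
  interpret M: finite_measure M
    by (rule finite_measureI) (use v1 nnM[of "\<lambda>_. 1"] in \<open>simp add: M_def less_top\<close>)
  have E_eq: "?E = (\<integral>\<^sup>+x. \<integral>\<^sup>+y. ennreal (newton_kernel (y - x)) * (ennreal (f x) * ennreal (f y)) \<partial>lborel \<partial>lborel)"
  proof -
    have "?E = (\<integral>\<^sup>+x. ennreal (v x) * (\<integral>\<^sup>+y. ?k x y * (ennreal (h x) * ennreal (h y)) \<partial>M) \<partial>lborel)"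
      by (rule nnM) (simp add: measurable_cong_sets[OF sets_M[symmetric] refl])
    also have "\<dots> = (\<integral>\<^sup>+x. \<integral>\<^sup>+y. ennreal (newton_kernel (y - x)) * (ennreal (f x) * ennreal (f y)) \<partial>lborel \<partial>lborel)"
    proof (rule nn_integral_cong_AE)
      show "AE x in lborel. ennreal (v x) * (\<integral>\<^sup>+y. ?k x y * (ennreal (h x) * ennreal (h y)) \<partial>M)
        = (\<integral>\<^sup>+y. ennreal (newton_kernel (y - x)) * (ennreal (f x) * ennreal (f y)) \<partial>lborel)"
        using f_eq
      proof eventually_elim
        case (elim x)
        have "ennreal (v x) * (\<integral>\<^sup>+y. ?k x y * (ennreal (h x) * ennreal (h y)) \<partial>M)
          = ennreal (v x) * (\<integral>\<^sup>+y. ennreal (v y) * (?k x y * (ennreal (h x) * ennreal (h y))) \<partial>lborel)"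
          by (subst nnM) simp_all
        also have "\<dots> = (\<integral>\<^sup>+y. ennreal (v x) * (ennreal (v y) * (?k x y * (ennreal (h x) * ennreal (h y)))) \<partial>lborel)"
          by (rule nn_integral_cmult[symmetric]) measurable
        also have "\<dots> = (\<integral>\<^sup>+y. ennreal (newton_kernel (y - x)) * (ennreal (f x) * ennreal (f y)) \<partial>lborel)"
        proof (rule nn_integral_cong_AE)
          show "AE y in lborel. ennreal (v x) * (ennreal (v y) * (?k x y * (ennreal (h x) * ennreal (h y))))
            = ennreal (newton_kernel (y - x)) * (ennreal (f x) * ennreal (f y))"
            using f_eq
            by eventually_elim (use elim nonneg h0 in \<open>simp add: ennreal_mult newton_kernel_minus_commute[of x] mult_ac\<close>)
        qed
        finally show ?case .
      qed
    qed
    finally show ?thesis .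
  qed
  have H_eq: "?H = (\<integral>\<^sup>+x. ennreal (v x * (h x)\<^sup>2) \<partial>lborel)"
    using nonneg by (subst nnM) (simp_all add: ennreal_mult)
  have mHE: "ennreal m * ?H \<le> ?E"
  proof -
    have "ennreal m * ?H = (\<integral>\<^sup>+x. ennreal m * ennreal (v x * (h x)\<^sup>2) \<partial>lborel)"
      unfolding H_eq by (rule nn_integral_cmult[symmetric]) measurable
    also have "\<dots> \<le> ?E"
      unfolding E_eq
    proof (rule nn_integral_mono_AE)
      show "AE x in lborel. ennreal m * ennreal (v x * (h x)\<^sup>2)
        \<le> (\<integral>\<^sup>+y. ennreal (newton_kernel (y - x)) * (ennreal (f x) * ennreal (f y)) \<partial>lborel)"
        using f_eq fvq pot
      proof eventually_elim
        case (elim x)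
        \<comment> \<open>One of the two factors \<open>h\<close> is traded for \<open>q\<close>, to
          which the potential bound applies; the other stays in f = v h.\<close>
        have "h x \<le> q x"
          using elim(2) nonneg(2,3)[of x] by (auto simp: h_def field_simps order_less_le)
        then have "v x * h x * h x \<le> f x * q x"
          unfolding elim(1) using nonneg h0 by (intro mult_left_mono) auto
        then have "m * (v x * (h x)\<^sup>2) \<le> f x * (m * q x)"
          using mult_left_mono[of "v x * h x * h x" "f x * q x" m] m by (simp add: power2_eq_square mult_ac)
        then have "ennreal m * ennreal (v x * (h x)\<^sup>2) \<le> ennreal (f x) * ennreal (m * q x)"
          using nonneg m by (simp add: ennreal_mult[symmetric] ennreal_leI)
        also have "\<dots> \<le> ennreal (f x) * (\<integral>\<^sup>+y. ennreal (newton_kernel (y - x)) * ennreal (f y) \<partial>lborel)"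
          by (intro mult_left_mono elim) simp
        also have "\<dots> = (\<integral>\<^sup>+y. ennreal (f x) * (ennreal (newton_kernel (y - x)) * ennreal (f y)) \<partial>lborel)"
          by (rule nn_integral_cmult[symmetric]) measurable
        finally show ?case by (simp add: mult_ac)
      qed
    qed
    finally show ?thesis .
  qed
  \<comment> \<open>This rests on square integrability of \<open>f\<close> alone. It makes
    \<open>?H\<close> finite before the embedding is invoked, as both the locale assumption on
    \<open>h\<close> and the final cancellation require.\<close>
  have E_fin: "?E < \<infinity>"
    unfolding E_eq by (rule newton_energy_finite[OF N _ nonneg(1) supp(1) r f2]) measurable
  have H_fin: "?H < \<infinity>"
    using le_less_trans[OF mHE E_fin] m by (auto simp: ennreal_mult_less_top)
  have E_le: "?E \<le> ennreal (16 * 2 ^ (CARD('n) - 2) * real (card (neighbour_offsets :: ('n \<Rightarrow> int) set)) * real CARD('n) ^ (CARD('n) - 2) * c) * ?H"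
  proof (rule dyadic_energy.energy_bound)
    show "dyadic_energy M h c"
    proof (unfold_locales)
      show "sets M = sets borel" by (rule sets_M)
      show "emeasure M {x} = 0" for x
      proof -
        have "emeasure M {x} = (\<integral>\<^sup>+y. ennreal (v y) * indicator {x} y \<partial>lborel)"
          unfolding M_def by (rule emeasure_density) auto
        also have "\<dots> = (\<integral>\<^sup>+y. 0 \<partial>(lborel :: (real ^ 'n) measure))"
          by (rule nn_integral_cong_AE) (use AE_lborel_singleton[of x] in \<open>eventually_elim, simp\<close>)
        finally show ?thesis by simp
      qed
      show "integrable M (\<lambda>x. (h x)\<^sup>2)"
        by (rule integrableI_bounded) (use H_fin in \<open>simp_all add: measurable_cong_sets[OF sets_M refl]\<close>)
      show "norm (x - y) < 1" if "h x \<noteq> 0" "h y \<noteq> 0" for x y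
        using h_ball[OF that(1)] h_ball[OF that(2)] dist_triangle_less_add[of x a r y r] r
        by (simp add: dist_commute dist_norm)
      fix j :: nat and k :: "'n \<Rightarrow> int"
      have "(\<integral>\<^sup>+x\<in>dyadic_cell j k. (\<integral>\<^sup>+y\<in>dyadic_cell j k. ?k x y \<partial>M) \<partial>M)
        = (\<integral>\<^sup>+x. ennreal (v x) * ((\<integral>\<^sup>+y\<in>dyadic_cell j k. ?k x y \<partial>M) * indicator (dyadic_cell j k) x) \<partial>lborel)"
        by (rule nnM) (simp add: measurable_cong_sets[OF sets_M[symmetric] refl])
      also have "\<dots> = (\<integral>\<^sup>+x\<in>dyadic_cell j k. (\<integral>\<^sup>+y\<in>dyadic_cell j k. ennreal (v x * v y * newton_kernel (x - y)) \<partial>lborel) \<partial>lborel)"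
      proof (rule nn_integral_cong)
        fix x
        have "ennreal (v x) * (\<integral>\<^sup>+y\<in>dyadic_cell j k. ?k x y \<partial>M)
          = ennreal (v x) * (\<integral>\<^sup>+y. ennreal (v y) * (?k x y * indicator (dyadic_cell j k) y) \<partial>lborel)"
          by (subst nnM) simp_all
        also have "\<dots> = (\<integral>\<^sup>+y. ennreal (v x) * (ennreal (v y) * (?k x y * indicator (dyadic_cell j k) y)) \<partial>lborel)"
          by (rule nn_integral_cmult[symmetric]) measurable
        also have "\<dots> = (\<integral>\<^sup>+y\<in>dyadic_cell j k. ennreal (v x * v y * newton_kernel (x - y)) \<partial>lborel)"
        proof -
          have split: "ennreal (v x * v y * newton_kernel (x - y)) = ennreal (v x) * ennreal (v y) * ?k x y" for y
            by (simp add: ennreal_mult nonneg newton_kernel_nonneg)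
          show ?thesis unfolding split by (simp only: mult_ac)
        qed
        finally show "ennreal (v x) * ((\<integral>\<^sup>+y\<in>dyadic_cell j k. ?k x y \<partial>M) * indicator (dyadic_cell j k) x)
          = (\<integral>\<^sup>+y\<in>dyadic_cell j k. ennreal (v x * v y * newton_kernel (x - y)) \<partial>lborel) * indicator (dyadic_cell j k) x"
          by (simp add: mult.assoc[symmetric])
      qed
      also have "\<dots> \<le> ennreal c * (\<integral>\<^sup>+x\<in>dyadic_cell j k. ennreal (v x) \<partial>lborel)" by (rule testing)
      also have "(\<integral>\<^sup>+x\<in>dyadic_cell j k. ennreal (v x) \<partial>lborel) = emeasure M (dyadic_cell j k)"
        unfolding M_def by (rule emeasure_density[symmetric]) auto
      finally show "(\<integral>\<^sup>+x\<in>dyadic_cell j k. (\<integral>\<^sup>+y\<in>dyadic_cell j k. ?k x y \<partial>M) \<partial>M)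
        \<le> ennreal c * emeasure M (dyadic_cell j k)" .
    qed (use N h h0 c in auto)
  qed
  obtain H where H: "?H = ennreal H" "H \<ge> 0" using H_fin by (cases ?H) auto
  let ?C = "16 * 2 ^ (CARD('n) - 2) * real (card (neighbour_offsets :: ('n \<Rightarrow> int) set)) * real CARD('n) ^ (CARD('n) - 2) * c"
  have "ennreal m * ennreal H \<le> ennreal ?C * ennreal H"
    using order_trans[OF mHE E_le] unfolding H(1) .
  moreover have "?C \<ge> 0" using c by simp
  ultimately have "m * H \<le> ?C * H"
    using m H(2) by (simp only: ennreal_mult[symmetric] less_imp_le ennreal_le_iff mult_nonneg_nonneg)
  then have "H = 0" using small H(2) by (auto simp: mult_le_cancel_right)
  then have "(\<integral>\<^sup>+x. ennreal (v x * (h x)\<^sup>2) \<partial>lborel) = 0" using H H_eq by simp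
  then have "AE x in lborel. ennreal (v x * (h x)\<^sup>2) = 0"
    by (subst (asm) nn_integral_0_iff_AE) auto
  then show ?thesis
    using f_eq
  proof eventually_elim
    case (elim x)
    have "v x * (h x)\<^sup>2 \<le> 0" using elim(1) by (simp only: ennreal_eq_0_iff)
    moreover have "0 \<le> v x * (h x)\<^sup>2" using nonneg(3)[of x] by simp
    ultimately have "v x * (h x)\<^sup>2 = 0" by (rule order_antisym)
    with elim(2) show ?case by auto
  qed
qed

subsection \<open>Unique continuation\<close>

lemma dyadic_cell_in_dyadic_cubes: "dyadic_cell j k \<in> dyadic_cubes"
proof -
  have "dyadic_cell j k = {x. \<forall>i. 2 powi (- int j) * of_int (k i) \<le> x $ i \<and> x $ i < 2 powi (- int j) * (of_int (k i) + 1)}"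
    by (auto simp: dyadic_cell_def dyadic_index_def fun_eq_iff floor_eq_iff power_int_minus field_simps)
  then show ?thesis unfolding dyadic_cubes_def by blast
qed

lemma nn_integral_lebesgue_eq_lborel:
  assumes "AE x in lborel. f x = g x"
  shows "(\<integral>\<^sup>+x. f x \<partial>lebesgue) = (\<integral>\<^sup>+x. g x \<partial>lborel)"
  unfolding nn_integral_completion using assms by (rule nn_integral_cong_AE)

text \<open>One member of the supremum is multiplied by the integral I of v over the cube, which
  cancels the inverse since 0 < I < \<infinity>. If I = 0 the norm says nothing about this cube, but
  then v vanishes almost everywhere on it and so does the double integral.\<close>

lemma KS_norm_testing:
  fixes W :: "real ^ 'n \<Rightarrow> complex" and v :: "real ^ 'n \<Rightarrow> real"
  assumes KS: "KS_norm W \<le> ennreal c" and c: "c \<ge> 0" and v0: "\<And>x. 0 \<le> v x" and [measurable]: "v \<in> borel_measurable borel"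
    and vW: "AE x in lborel. norm (W x) = v x" and v1: "(\<integral>\<^sup>+x. ennreal (v x) \<partial>lborel) < \<infinity>"
  shows "(\<integral>\<^sup>+x\<in>dyadic_cell j k. (\<integral>\<^sup>+y\<in>dyadic_cell j k. ennreal (v x * v y * newton_kernel (x - y)) \<partial>lborel) \<partial>lborel)
      \<le> ennreal c * (\<integral>\<^sup>+x\<in>dyadic_cell j k. ennreal (v x) \<partial>lborel)"
proof -
  let ?Q = "dyadic_cell j k"
  let ?I = "\<integral>\<^sup>+x\<in>?Q. ennreal (v x) \<partial>lborel"
  let ?J = "\<integral>\<^sup>+x\<in>?Q. (\<integral>\<^sup>+y\<in>?Q. ennreal (v x * v y * newton_kernel (x - y)) \<partial>lborel) \<partial>lborel"
  have I: "(\<integral>\<^sup>+x\<in>?Q. ennreal (norm (W x)) \<partial>lebesgue) = ?I"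
    by (rule nn_integral_lebesgue_eq_lborel) (use vW in \<open>eventually_elim, simp\<close>)
  have J: "(\<integral>\<^sup>+x\<in>?Q. (\<integral>\<^sup>+y\<in>?Q. ennreal (norm (W x * W y) / norm (x - y) ^ (CARD('n) - 2)) \<partial>lebesgue) \<partial>lebesgue) = ?J"
  proof (rule nn_integral_lebesgue_eq_lborel)
    show "AE x in lborel. (\<integral>\<^sup>+y\<in>?Q. ennreal (norm (W x * W y) / norm (x - y) ^ (CARD('n) - 2)) \<partial>lebesgue) * indicator ?Q x
      = (\<integral>\<^sup>+y\<in>?Q. ennreal (v x * v y * newton_kernel (x - y)) \<partial>lborel) * indicator ?Q x"
      using vW
    proof eventually_elim
      case (elim x)
      have "(\<integral>\<^sup>+y\<in>?Q. ennreal (norm (W x * W y) / norm (x - y) ^ (CARD('n) - 2)) \<partial>lebesgue)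
        = (\<integral>\<^sup>+y\<in>?Q. ennreal (v x * v y * newton_kernel (x - y)) \<partial>lborel)"
      proof (rule nn_integral_lebesgue_eq_lborel)
        show "AE y in lborel. ennreal (norm (W x * W y) / norm (x - y) ^ (CARD('n) - 2)) * indicator ?Q y
          = ennreal (v x * v y * newton_kernel (x - y)) * indicator ?Q y"
          using vW by eventually_elim (use elim in \<open>simp add: norm_mult newton_kernel_def\<close>)
      qed
      then show ?case by simp
    qed
  qed
  show ?thesis
  proof (cases "?I = 0")
    case True
    then have "AE x in lborel. ennreal (v x) * indicator ?Q x = 0"
      by (subst (asm) nn_integral_0_iff_AE) auto
    then have "AE x in lborel. (\<integral>\<^sup>+y\<in>?Q. ennreal (v x * v y * newton_kernel (x - y)) \<partial>lborel) * indicator ?Q x = 0"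
    proof eventually_elim
      case (elim x)
      show ?case
      proof (cases "x \<in> ?Q")
        case True
        then have "v x = 0" using elim v0[of x] by (simp add: ennreal_eq_0_iff order_antisym)
        then show ?thesis by simp
      qed simp
    qed
    then have "?J = (\<integral>\<^sup>+x. 0 \<partial>(lborel :: (real ^ 'n) measure))" by (rule nn_integral_cong_AE)
    then show ?thesis by simp
  next
    case False
    have "?I \<le> (\<integral>\<^sup>+x. ennreal (v x) \<partial>lborel)"
      by (intro nn_integral_mono) (auto simp: indicator_def)
    then have "?I < \<infinity>" using v1 by (rule le_less_trans)
    then obtain i where i: "?I = ennreal i" "i \<ge> 0" by (cases ?I) auto
    with False have ip: "i > 0" by (cases "i = 0") auto
    have "inverse ?I * ?J \<le> KS_norm W"
      unfolding KS_norm_def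
      by (rule order_trans[OF _ SUP_upper[OF dyadic_cell_in_dyadic_cubes[of j k]]]) (simp only: Let_def I J False if_False order_refl)
    then have "inverse ?I * ?J \<le> ennreal c" using KS by (rule order_trans)
    then have "?I * (inverse ?I * ?J) \<le> ?I * ennreal c" by (rule mult_left_mono) simp
    moreover have "?I * inverse ?I = 1"
      unfolding i(1) using ip by (simp add: inverse_ennreal ennreal_mult[symmetric])
    ultimately have "1 * ?J \<le> ?I * ennreal c"
      by (simp only: mult.assoc[symmetric])
    then show ?thesis by (simp only: mult_1_left mult.commute[of "ennreal c"])
  qed
qed

lemma locally_integrable_sum:
  "(\<And>i. i \<in> I \<Longrightarrow> locally_integrable (g i)) \<Longrightarrow> locally_integrable (\<lambda>x. \<Sum>i\<in>I. g i x)"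
  unfolding locally_integrable_def set_integrable_def scaleR_sum_right
  by (intro allI impI Bochner_Integration.integrable_sum) simp

text \<open>Borel data common to both cases: \<open>f\<close> stands for |L| cut to the ball and
  \<open>q\<close> for |u|. Agreement of \<open>v\<close> with |V| is asked for on the ball only,
  because one application truncates \<open>v\<close> there. The \<open>L\<^sup>1\<close> bound
  serves the Kato case, the \<open>L\<^sup>2\<close> bound the energy.\<close>

lemma solution_reduction:
  fixes u L V :: "real ^ 'n \<Rightarrow> complex" and v :: "real ^ 'n \<Rightarrow> real"
  assumes N: "CARD('n) \<ge> 3" and K: "compact K" "K \<subseteq> ball a r" and u: "u \<in> sobolev_space 2 2"
    and uL: "has_weak_laplacian u L" and le: "AE x in lebesgue. norm (L x) \<le> norm (V x * u x)"
    and u0: "AE x in lebesgue. x \<notin> K \<longrightarrow> u x = 0"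
    and vV: "AE x in lborel. x \<in> ball a r \<longrightarrow> norm (V x) = v x"
  obtains f q :: "real ^ 'n \<Rightarrow> real" where
    "f \<in> borel_measurable borel" "q \<in> borel_measurable borel" "\<forall>x. 0 \<le> f x" "\<forall>x. 0 \<le> q x"
    "\<forall>x. x \<notin> ball a r \<longrightarrow> f x = 0" "AE x in lborel. x \<in> ball a r \<longrightarrow> f x \<le> v x * q x"
    "AE x in lborel. ennreal ((\<integral>z. poisson_bump 1 (z :: real ^ 'n) \<partial>lborel) * q x)
      \<le> (\<integral>\<^sup>+y. ennreal (newton_kernel (y - x)) * ennreal (f y) \<partial>lborel)"
    "(\<integral>\<^sup>+x. ennreal (f x) \<partial>lborel) < \<infinity>" "(\<integral>\<^sup>+x. ennreal ((f x)\<^sup>2) \<partial>lborel) < \<infinity>"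
    "(AE x in lborel. f x = 0) \<longrightarrow> (AE x in lebesgue. u x = 0)"
proof -
  obtain g where g: "\<And>i. has_weak_partial [i, i] u (g i)" and L: "L = (\<lambda>x. \<Sum>i\<in>UNIV. g i x)"
    using uL unfolding has_weak_laplacian_def by blast
  have ul: "locally_integrable u" and gl: "\<And>i. locally_integrable (g i)"
    using g unfolding has_weak_partial_def by auto
  have Ll: "locally_integrable L" unfolding L by (intro locally_integrable_sum gl)
  have Lm: "L \<in> borel_measurable lebesgue" by (rule locally_integrable_measurable[OF Ll])
  have L0: "AE x in lebesgue. x \<notin> K \<longrightarrow> L x = 0"
    using le u0 by eventually_elim auto
  obtain u' where u'[measurable]: "u' \<in> borel_measurable borel" and uu': "AE x in lborel. u x = u' x"
    by (rule borel_representative[OF locally_integrable_measurable[OF ul]])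
  obtain L' where L'[measurable]: "L' \<in> borel_measurable borel" and LL': "AE x in lborel. L x = L' x"
    by (rule borel_representative[OF Lm])
  have [measurable]: "ball a r \<in> sets borel" by simp
  define f where "f x = norm (L' x) * indicator (ball a r) x" for x
  define q where "q x = norm (u' x)" for x
  have fm[measurable]: "f \<in> borel_measurable borel" unfolding f_def[abs_def] by measurable
  have qm: "q \<in> borel_measurable borel" unfolding q_def[abs_def] by measurable
  have fL: "AE x in lborel. norm (L x) = f x" "AE x in lborel. norm (L' x) = f x"
  proof -
    have "AE x in lborel. norm (L x) = f x \<and> norm (L' x) = f x"
      using L0[unfolded AE_completion_iff] LL'
    proof eventually_elim
      case (elim x)
      then show ?case using K by (cases "x \<in> ball a r") (auto simp: f_def)
    qed
    then show "AE x in lborel. norm (L x) = f x" "AE x in lborel. norm (L' x) = f x" by auto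
  qed
  have fvq: "AE x in lborel. x \<in> ball a r \<longrightarrow> f x \<le> v x * q x"
    using fL(1) le[unfolded AE_completion_iff] vV uu'
    by eventually_elim (auto simp: norm_mult q_def)
  have pot: "AE x in lborel. ennreal ((\<integral>z. poisson_bump 1 (z :: real ^ 'n) \<partial>lborel) * q x)
      \<le> (\<integral>\<^sup>+y. ennreal (newton_kernel (y - x)) * ennreal (f y) \<partial>lborel)"
    using newton_potential_bound[OF N K(1) ul uL u0 L0 Lm u' uu' L' LL']
  proof eventually_elim
    case (elim x)
    have "(\<integral>\<^sup>+y. ennreal (newton_kernel (y - x)) * ennreal (norm (L' y)) \<partial>lborel)
      = (\<integral>\<^sup>+y. ennreal (newton_kernel (y - x)) * ennreal (f y) \<partial>lborel)"
      by (rule nn_integral_cong_AE) (use fL(2) in \<open>eventually_elim, simp\<close>)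
    with elim show ?case by (simp add: q_def)
  qed
  have f1: "(\<integral>\<^sup>+x. ennreal (f x) \<partial>lborel) < \<infinity>"
  proof -
    have "integrable lebesgue (\<lambda>x. 1 *\<^sub>R L x)"
      by (rule continuous_mult_integrable[OF _ Ll K(1)]) (use L0 in auto)
    then have "(\<integral>\<^sup>+x. ennreal (norm (L x)) \<partial>lebesgue) < \<infinity>"
      by (simp add: integrable_iff_bounded)
    also have "(\<integral>\<^sup>+x. ennreal (norm (L x)) \<partial>lebesgue) = (\<integral>\<^sup>+x. ennreal (f x) \<partial>lborel)"
      by (rule nn_integral_lebesgue_eq_lborel) (use fL(1) in \<open>eventually_elim, simp\<close>)
    finally show ?thesis .
  qed
  have f2: "(\<integral>\<^sup>+x. ennreal ((f x)\<^sup>2) \<partial>lborel) < \<infinity>"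
  proof -
    have "(\<integral>\<^sup>+x. ennreal ((norm (L x))\<^sup>2) \<partial>lebesgue) = (\<integral>\<^sup>+x. ennreal ((f x)\<^sup>2) \<partial>lborel)"
      by (rule nn_integral_lebesgue_eq_lborel) (use fL(1) in \<open>eventually_elim, simp\<close>)
    then show ?thesis using weak_laplacian_L2[OF u uL] by simp
  qed
  \<comment> \<open>A vanishing \<open>f\<close> has zero potential, so the pointwise bound returns
    the conclusion from the Laplacian to \<open>u\<close> itself.\<close>
  have fin: "AE x in lebesgue. u x = 0" if f0: "AE x in lborel. f x = 0"
  proof (rule AE_completion)
    show "AE x in lborel. u x = 0"
      using pot uu'
    proof eventually_elim
      case (elim x)
      have "(\<integral>\<^sup>+y. ennreal (newton_kernel (y - x)) * ennreal (f y) \<partial>lborel) = (\<integral>\<^sup>+y. 0 \<partial>(lborel :: (real ^ 'n) measure))"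
        by (rule nn_integral_cong_AE) (use f0 in \<open>eventually_elim, simp\<close>)
      with elim(1) have "(\<integral>z. poisson_bump 1 (z :: real ^ 'n) \<partial>lborel) * q x \<le> 0"
        by (simp add: ennreal_eq_0_iff)
      then have "q x = 0"
        using poisson_bump_integral_pos[where 'n='n] by (auto simp: mult_le_0_iff q_def)
      with elim(2) show ?case by (simp add: q_def)
    qed
  qed
  show ?thesis
    by (rule that[OF fm qm _ _ _ fvq pot f1 f2]) (use fin in \<open>auto simp: f_def q_def\<close>)
qed

lemma kato_unique_continuation:
  fixes V :: "real ^ 'n \<Rightarrow> complex"
  assumes N: "CARD('n) \<ge> 3" and V: "V \<in> Kato_class"
  shows "\<exists>\<rho>>0. \<forall>K u L. compact K \<and> K \<subseteq> ball a \<rho> \<and> u \<in> sobolev_space 2 2 \<and> has_weak_laplacian u L \<and>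
     (AE x in lebesgue. norm (L x) \<le> norm (V x * u x)) \<and> (AE x in lebesgue. x \<notin> K \<longrightarrow> u x = 0)
     \<longrightarrow> (AE x in lebesgue. u x = 0)"
proof -
  define m where "m = (\<integral>z. poisson_bump 1 (z :: real ^ 'n) \<partial>lborel)"
  have m: "m > 0" unfolding m_def by (rule poisson_bump_integral_pos)
  let ?S = "\<lambda>r. SUP x. \<integral>\<^sup>+y\<in>{y. norm (x - y) < r}. ennreal (norm (V y) / norm (x - y) ^ (CARD('n) - 2)) \<partial>lebesgue"
  have Vl: "locally_integrable V" and lim: "(?S \<longlongrightarrow> 0) (at_right 0)"
    using V unfolding Kato_class_def by auto
  have "\<forall>\<^sub>F r in at_right 0. ?S r < ennreal (m / 2)"
    using lim by (rule order_tendstoD) (use m in simp)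
  then obtain b where b: "b > 0" "\<And>r. 0 < r \<Longrightarrow> r < b \<Longrightarrow> ?S r < ennreal (m / 2)"
    unfolding eventually_at_right_field by auto
  \<comment> \<open>The Kato bound is used on balls of radius 2 \<rho> = b/2 < b, centred at
    arbitrary points.\<close>
  define \<rho> where "\<rho> = b / 4"
  have \<rho>: "\<rho> > 0" "?S (2 * \<rho>) < ennreal (m / 2)"
    using b(1) b(2)[of "2 * \<rho>"] by (auto simp: \<rho>_def)
  obtain V' where V'[measurable]: "V' \<in> borel_measurable borel" and VV': "AE x in lborel. V x = V' x"
    by (rule borel_representative[OF locally_integrable_measurable[OF Vl]])
  define v where "v x = norm (V' x)" for x
  have vm: "v \<in> borel_measurable borel" unfolding v_def[abs_def] by measurable
  have v0: "0 \<le> v x" for x by (simp add: v_def)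
  have kato: "(\<integral>\<^sup>+x\<in>ball y (2 * \<rho>). ennreal (v x * newton_kernel (y - x)) \<partial>lborel) \<le> ennreal (m / 2)" for y
  proof -
    have "(\<integral>\<^sup>+x\<in>ball y (2 * \<rho>). ennreal (v x * newton_kernel (y - x)) \<partial>lborel)
      = (\<integral>\<^sup>+x\<in>{x. norm (y - x) < 2 * \<rho>}. ennreal (norm (V x) / norm (y - x) ^ (CARD('n) - 2)) \<partial>lebesgue)"
      by (rule nn_integral_lebesgue_eq_lborel[symmetric])
        (use VV' in \<open>eventually_elim, simp add: v_def newton_kernel_def dist_norm indicator_def\<close>)
    also have "\<dots> \<le> ?S (2 * \<rho>)" by (rule SUP_upper) simp
    finally show ?thesis using \<rho>(2) by simp
  qed
  show ?thesis
  proof (intro exI[of _ \<rho>] conjI allI impI)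
    fix K u L
    assume "compact K \<and> K \<subseteq> ball a \<rho> \<and> u \<in> sobolev_space 2 2 \<and> has_weak_laplacian u L \<and>
     (AE x in lebesgue. norm (L x) \<le> norm (V x * u x)) \<and> (AE x in lebesgue. x \<notin> K \<longrightarrow> u x = 0)"
    then have K: "compact K" and K': "K \<subseteq> ball a \<rho>" and u: "u \<in> sobolev_space 2 2" and uL: "has_weak_laplacian u L"
      and le: "AE x in lebesgue. norm (L x) \<le> norm (V x * u x)" and u0: "AE x in lebesgue. x \<notin> K \<longrightarrow> u x = 0"
      by simp_all
    have vV: "AE x in lborel. x \<in> ball a \<rho> \<longrightarrow> norm (V x) = v x"
      using VV' by eventually_elim (simp add: v_def)
    obtain f q :: "real ^ 'n \<Rightarrow> real" where fq: "f \<in> borel_measurable borel" "q \<in> borel_measurable borel"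
      "\<forall>x. 0 \<le> f x" "\<forall>x. 0 \<le> q x" "\<forall>x. x \<notin> ball a \<rho> \<longrightarrow> f x = 0"
      "AE x in lborel. x \<in> ball a \<rho> \<longrightarrow> f x \<le> v x * q x"
      "AE x in lborel. ennreal (m * q x) \<le> (\<integral>\<^sup>+y. ennreal (newton_kernel (y - x)) * ennreal (f y) \<partial>lborel)"
      "(\<integral>\<^sup>+x. ennreal (f x) \<partial>lborel) < \<infinity>" "(\<integral>\<^sup>+x. ennreal ((f x)\<^sup>2) \<partial>lborel) < \<infinity>"
      "(AE x in lborel. f x = 0) \<longrightarrow> (AE x in lebesgue. u x = 0)"
      by (rule solution_reduction[OF N K K' u uL le u0 vV, folded m_def])
    have "AE x in lborel. f x \<le> v x * q x"
      using fq(6)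
    proof eventually_elim
      case (elim x)
      then show ?case using fq(5) v0[of x] fq(4) by (cases "x \<in> ball a \<rho>") auto
    qed
    then have "AE x in lborel. f x = 0"
      using fq(5) by (intro kato_vanishing[OF fq(1,2) vm fq(3,4)[rule_format] v0 _ _ m fq(7,8) kato]) blast+
    then show "AE x in lebesgue. u x = 0" by (rule fq(10)[rule_format])
  qed (rule \<rho>(1))
qed

lemma kerman_sawyer_unique_continuation:
  fixes V :: "real ^ 'n \<Rightarrow> complex"
  assumes N: "CARD('n) \<ge> 3" and Vl: "locally_integrable V" and \<epsilon>: "\<epsilon> > 0"
    and small: "16 * 2 ^ (CARD('n) - 2) * real (card (neighbour_offsets :: ('n \<Rightarrow> int) set)) * real CARD('n) ^ (CARD('n) - 2)
      * (2 * \<epsilon>) < (\<integral>z. poisson_bump 1 (z :: real ^ 'n) \<partial>lborel)"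
    and V: "Limsup (at_right (0::real)) (\<lambda>r. KS_norm (\<lambda>x. indicator (ball a r) x * V x)) \<le> ennreal \<epsilon>"
  shows "\<exists>\<rho>>0. \<forall>K u L. compact K \<and> K \<subseteq> ball a \<rho> \<and> u \<in> sobolev_space 2 2 \<and> has_weak_laplacian u L \<and>
     (AE x in lebesgue. norm (L x) \<le> norm (V x * u x)) \<and> (AE x in lebesgue. x \<notin> K \<longrightarrow> u x = 0)
     \<longrightarrow> (AE x in lebesgue. u x = 0)"
proof -
  define m where "m = (\<integral>z. poisson_bump 1 (z :: real ^ 'n) \<partial>lborel)"
  have m: "m > 0" unfolding m_def by (rule poisson_bump_integral_pos)
  \<comment> \<open>A bound on the limit superior controls actual radii only at a strictly larger
    level, which explains the 2 \<epsilon> in \<open>small\<close>.\<close>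
  have "ennreal \<epsilon> < ennreal (2 * \<epsilon>)" using \<epsilon> by (intro ennreal_lessI) auto
  with V have "Limsup (at_right (0::real)) (\<lambda>r. KS_norm (\<lambda>x. indicator (ball a r) x * V x)) < ennreal (2 * \<epsilon>)"
    by (rule le_less_trans)
  from Limsup_lessD[OF this]
  obtain b where b: "b > 0" "\<And>r. 0 < r \<Longrightarrow> r < b \<Longrightarrow> KS_norm (\<lambda>x. indicator (ball a r) x * V x) < ennreal (2 * \<epsilon>)"
    unfolding eventually_at_right_field by auto
  \<comment> \<open>Below \<open>b\<close> for the smallness of the norm, and at most 1/2 so that
    two points of the ball are less than 1 apart.\<close>
  define \<rho> where "\<rho> = min (b / 2) (1 / 2)"
  have \<rho>: "\<rho> > 0" "\<rho> \<le> 1/2" using b(1) by (auto simp: \<rho>_def)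
  have KS: "KS_norm (\<lambda>x. indicator (ball a \<rho>) x * V x) \<le> ennreal (2 * \<epsilon>)"
    using b(1) by (intro less_imp_le b(2)) (auto simp: \<rho>_def)
  obtain V' where V'[measurable]: "V' \<in> borel_measurable borel" and VV': "AE x in lborel. V x = V' x"
    by (rule borel_representative[OF locally_integrable_measurable[OF Vl]])
  have [measurable]: "ball a \<rho> \<in> sets borel" by simp
  define v where "v x = norm (V' x) * indicator (ball a \<rho>) x" for x
  have vm: "v \<in> borel_measurable borel" unfolding v_def[abs_def] by measurable
  have v0: "0 \<le> v x" for x by (simp add: v_def)
  have v_supp: "v x = 0" if "x \<notin> ball a \<rho>" for x using that by (simp add: v_def)
  have v1: "(\<integral>\<^sup>+x. ennreal (v x) \<partial>lborel) < \<infinity>"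
  proof -
    have "integrable lebesgue (\<lambda>x. indicat_real (cball a \<rho>) x *\<^sub>R V x)"
      using Vl[unfolded locally_integrable_def, rule_format, OF compact_cball[of a \<rho>]]
      unfolding set_integrable_def .
    then have fin: "(\<integral>\<^sup>+x. ennreal (norm (indicat_real (cball a \<rho>) x *\<^sub>R V x)) \<partial>lebesgue) < \<infinity>"
      by (simp only: integrable_iff_bounded)
    have "(\<integral>\<^sup>+x. ennreal (v x) \<partial>lborel) \<le> (\<integral>\<^sup>+x. ennreal (norm (indicat_real (cball a \<rho>) x *\<^sub>R V x)) \<partial>lborel)"
      by (rule nn_integral_mono_AE) (use VV' in \<open>eventually_elim, auto simp: v_def indicator_def intro!: ennreal_leI\<close>)
    then show ?thesis using fin unfolding nn_integral_completion by (rule le_less_trans)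
  qed
  have vW: "AE x in lborel. norm (indicator (ball a \<rho>) x * V x) = v x"
    using VV' by eventually_elim (simp add: v_def indicator_def)
  show ?thesis
  proof (intro exI[of _ \<rho>] conjI allI impI)
    fix K u L
    assume "compact K \<and> K \<subseteq> ball a \<rho> \<and> u \<in> sobolev_space 2 2 \<and> has_weak_laplacian u L \<and>
     (AE x in lebesgue. norm (L x) \<le> norm (V x * u x)) \<and> (AE x in lebesgue. x \<notin> K \<longrightarrow> u x = 0)"
    then have K: "compact K" and K': "K \<subseteq> ball a \<rho>" and u: "u \<in> sobolev_space 2 2" and uL: "has_weak_laplacian u L"
      and le: "AE x in lebesgue. norm (L x) \<le> norm (V x * u x)" and u0: "AE x in lebesgue. x \<notin> K \<longrightarrow> u x = 0"
      by simp_all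
    have vV: "AE x in lborel. x \<in> ball a \<rho> \<longrightarrow> norm (V x) = v x"
      using VV' by eventually_elim (simp add: v_def)
    obtain f q :: "real ^ 'n \<Rightarrow> real" where fq: "f \<in> borel_measurable borel" "q \<in> borel_measurable borel"
      "\<forall>x. 0 \<le> f x" "\<forall>x. 0 \<le> q x" "\<forall>x. x \<notin> ball a \<rho> \<longrightarrow> f x = 0"
      "AE x in lborel. x \<in> ball a \<rho> \<longrightarrow> f x \<le> v x * q x"
      "AE x in lborel. ennreal (m * q x) \<le> (\<integral>\<^sup>+y. ennreal (newton_kernel (y - x)) * ennreal (f y) \<partial>lborel)"
      "(\<integral>\<^sup>+x. ennreal (f x) \<partial>lborel) < \<infinity>" "(\<integral>\<^sup>+x. ennreal ((f x)\<^sup>2) \<partial>lborel) < \<infinity>"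
      "(AE x in lborel. f x = 0) \<longrightarrow> (AE x in lebesgue. u x = 0)"
      by (rule solution_reduction[OF N K K' u uL le u0 vV, folded m_def])
    have fvq: "AE x in lborel. f x \<le> v x * q x"
      using fq(6)
    proof eventually_elim
      case (elim x)
      then show ?case using fq(5) v0[of x] fq(4) by (cases "x \<in> ball a \<rho>") auto
    qed
    have "AE x in lborel. f x = 0"
    proof (rule kerman_sawyer_vanishing[OF N fq(1,2) vm fq(3,4)[rule_format] v0 \<rho>(2) fq(5)[rule_format] v_supp fvq m fq(7,9) v1])
      show "2 * \<epsilon> > 0" using \<epsilon> by simp
      show "16 * 2 ^ (CARD('n) - 2) * real (card (neighbour_offsets :: ('n \<Rightarrow> int) set)) * real CARD('n) ^ (CARD('n) - 2)
        * (2 * \<epsilon>) < m" using small unfolding m_def .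
      show "(\<integral>\<^sup>+x\<in>dyadic_cell j k. (\<integral>\<^sup>+y\<in>dyadic_cell j k. ennreal (v x * v y * newton_kernel (x - y)) \<partial>lborel) \<partial>lborel)
        \<le> ennreal (2 * \<epsilon>) * (\<integral>\<^sup>+x\<in>dyadic_cell j k. ennreal (v x) \<partial>lborel)" for j k
        by (rule KS_norm_testing[OF KS _ v0 vm vW v1]) (use \<epsilon> in simp)
    qed
    then show "AE x in lebesgue. u x = 0" by (rule fq(10)[rule_format])
  qed (rule \<rho>(1))
qed

theorem corollary1p5:
  assumes "CARD('n::finite) \<ge> 3"
  shows "\<exists>\<epsilon>::real. \<epsilon> > 0 \<and>
    (\<forall>V :: real ^ 'n \<Rightarrow> complex.
       (V \<in> KS_class \<and>
          (\<forall>z. Limsup (at_right (0::real)) (\<lambda>r. KS_norm (\<lambda>x. indicator (ball z r) x * V x))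
                 \<le> ennreal \<epsilon>))
       \<or> V \<in> Kato_class \<longrightarrow>
       (\<forall>a. \<exists>\<rho>::real. \<rho> > 0 \<and>
          (\<forall>K u L.
             compact K \<and> K \<subseteq> ball a \<rho> \<and>
             u \<in> sobolev_space 2 2 \<and> has_weak_laplacian u L \<and>
             (AE x in lebesgue. norm (L x) \<le> norm (V x * u x)) \<and>
             (AE x in lebesgue. x \<notin> K \<longrightarrow> u x = 0)
             \<longrightarrow> (AE x in lebesgue. u x = 0))))"
proof -
  define m where "m = (\<integral>z. poisson_bump 1 (z :: real ^ 'n) \<partial>lborel)"
  have m: "m > 0" unfolding m_def by (rule poisson_bump_integral_pos)
  define C where "C = 16 * 2 ^ (CARD('n) - 2) * real (card (neighbour_offsets :: ('n \<Rightarrow> int) set)) * real CARD('n) ^ (CARD('n) - 2)"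
  have C: "C \<ge> 0" unfolding C_def by simp
  \<comment> \<open>\<open>C\<close> is the energy constant without the factor c, and c will be 2
    \<epsilon>; this choice gives C 2 \<epsilon> \<le> m/2. Both \<open>m\<close> and
    \<open>C\<close> depend on the dimension only.\<close>
  define \<epsilon> where "\<epsilon> = m / (4 * (C + 1))"
  have \<epsilon>: "\<epsilon> > 0" using m C by (simp add: \<epsilon>_def)
  have "C * (2 * \<epsilon>) \<le> m / 2"
    using m C by (simp add: \<epsilon>_def field_simps)
  then have small: "C * (2 * \<epsilon>) < m" using m by linarith
  show ?thesis
  proof (rule exI[of _ \<epsilon>], intro conjI allI impI)
    fix V :: "real ^ 'n \<Rightarrow> complex" and a
    assume "(V \<in> KS_class \<and>
          (\<forall>z. Limsup (at_right (0::real)) (\<lambda>r. KS_norm (\<lambda>x. indicator (ball z r) x * V x)) \<le> ennreal \<epsilon>))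
       \<or> V \<in> Kato_class"
    then show "\<exists>\<rho>::real. \<rho> > 0 \<and>
          (\<forall>K u L.
             compact K \<and> K \<subseteq> ball a \<rho> \<and>
             u \<in> sobolev_space 2 2 \<and> has_weak_laplacian u L \<and>
             (AE x in lebesgue. norm (L x) \<le> norm (V x * u x)) \<and>
             (AE x in lebesgue. x \<notin> K \<longrightarrow> u x = 0)
             \<longrightarrow> (AE x in lebesgue. u x = 0))"
    proof
      assume *: "V \<in> KS_class \<and>
          (\<forall>z. Limsup (at_right (0::real)) (\<lambda>r. KS_norm (\<lambda>x. indicator (ball z r) x * V x)) \<le> ennreal \<epsilon>)"
      then have V: "locally_integrable V" unfolding KS_class_def by simp
      from * have lim: "Limsup (at_right (0::real)) (\<lambda>r. KS_norm (\<lambda>x. indicator (ball a r) x * V x)) \<le> ennreal \<epsilon>"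
        by simp
      show ?thesis
        by (rule kerman_sawyer_unique_continuation[OF assms V \<epsilon> small[unfolded C_def m_def] lim])
    next
      assume "V \<in> Kato_class"
      then show ?thesis by (rule kato_unique_continuation[OF assms])
    qed
  qed (rule \<epsilon>)
qed

end
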